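(* Let $A$, $A_{\rm rc}$, $\mathcal N$ satisfy the state-operator assumptions (i)–(iv) of the context, let $\lambda>0$, and suppose that there is a sequence $(U_M,E_{\mathbb M})_{M\in\mathbb N_0}$, where $\mathbb M=\{1,2,\dots,M\}$, $E_{\mathbb M}=\mathrm{span}\{e_i\mid i\in\mathbb M\}$, and $U_M\subset H$ is an $M$-dimensional subspace with $H=U_M\oplus E_{\mathbb M}^\perp$, such that $$\big|P_{U_M}^{E_{\mathbb M}^\perp}\big|_{\mathcal L(H)}\le C_P\quad\text{for all }M,$$ with $C_P>0$ independent of $M$. Then the closed-loop system $$\dot y+Ay+A_{\rm rc}(t)y+\mathcal N(t,y)-P_{U_M}^{E_{\mathbb M}^\perp}\bigl(Ay+A_{\rm rc}(t)y+\mathcal N(t,y)-(Ay+\lambda y)\bigr)=0,\qquad y(0)=y_0\in V,$$ is exponentially stable for large enough $M$, depending on $|y_0|_V$. That is, for every $R>0$ there is $M_R\in\mathbb N_0$ such that for every $M\ge M_R$ there are constants $C\ge1$ and $\mu>0$ such that for every $y_0\in V$ with $|y_0|_V<R$ the solution is defined for all $t\ge0$ and satisfies $|y(t)|_V^2\le C\,\mathrm e^{-\mu t}|y_0|_V^2$ for all $t\ge0$.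
   Context: Notation: $\mathbb R_0=(0,+\infty)$, $\mathbb N_0=\{1,2,3,\dots\}$; $|\cdot|_X$ is the norm of $X$; $\mathcal L(X,Y)$ is the space of bounded linear operators, $\mathcal L(X)=\mathcal L(X,X)$. For normed spaces $X,Y$, $\mathcal C_{\rm b,i}(X,Y)$ is the set of continuous $f:X\to Y$ for which there is a continuous nondecreasing $\mathfrak n:[0,+\infty)\to\mathbb R$ with $\mathfrak n(0)=0$ and $|f(x)|_Y\le\mathfrak n(|x|_X)$ for all $x\in X$. State-operator assumptions. $H$ and $V\subseteq H$ are separable real Hilbert spaces, with $H$ as pivot space, $H'=H$. (i) $A\in\mathcal L(V,V')$ is a symmetric isomorphism from $V$ onto $V'$ and $(y,z)\mapsto\langle Ay,z\rangle_{V',V}$ is a complete scalar product on $V$; $V$ is endowed with this scalar product. (ii) The inclusion $V\subseteq H$ is continuous, dense and compact. Put $\mathrm D(A)=\{u\in V\mid Au\in H\}$, with $|u|_{\mathrm D(A)}=|Au|_H$. Then $A$ has a nondecreasing sequence of (repeated) eigenvalues $0<\alpha_1\le\alpha_2\le\dots\to+\infty$ and a corresponding complete orthonormal basis of eigenfunctions $(e_i)_{i\in\mathbb N_0}$ of $H$, $Ae_i=\alpha_ie_i$. (iii) For all $t>0$, $A_{\rm rc}(t)\in\mathcal L(V,H)$, and $|A_{\rm rc}|_{L^\infty(\mathbb R_0,\mathcal L(V,H))}\le C_{\rm rc}$ for a constant $C_{\rm rc}\ge0$. (iv) $\mathcal N(t,\cdot)\in\mathcal C_{\rm b,i}(\mathrm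 D(A),H)$ and there are $C_{\mathcal N}\ge0$, $n\in\mathbb N_0$, and nonnegative $\zeta_{1j},\zeta_{2j},\delta_{1j},\delta_{2j}$, $1\le j\le n$, with $\zeta_{2j}+\delta_{2j}<1$ and $\delta_{1j}+\delta_{2j}\ge1$, such that for all $t>0$ and all $y_1,y_2\in\mathrm D(A)$, $$|\mathcal N(t,y_1)-\mathcal N(t,y_2)|_H\le C_{\mathcal N}\sum_{j=1}^n\Bigl(|y_1|_V^{\zeta_{1j}}|y_1|_{\mathrm D(A)}^{\zeta_{2j}}+|y_2|_V^{\zeta_{1j}}|y_2|_{\mathrm D(A)}^{\zeta_{2j}}\Bigr)|y_1-y_2|_V^{\delta_{1j}}|y_1-y_2|_{\mathrm D(A)}^{\delta_{2j}}.$$ Projections: $\perp$ denotes orthogonal complement in $H$. If $H=F\oplus G$ with $F,G$ closed, $P_F^G$ is the (oblique) projection in $H$ onto $F$ along $G$.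
   Formalization: The nonlinearity is additionally assumed measurable in time: t ↦ N(t,u) is Lebesgue measurable for each u in D(A). Without this no solution need exist, e.g. N(t,y)=f(t)y with f=±1 non-measurable near t=0 and y_0 a multiple of e_{M+1}. *)

theory Defs
  imports "HOL-Analysis.Analysis"
begin

text \<open>
  The type \<open>'h\<close> is the pivot space \<open>H\<close>; the type \<open>'v\<close> is \<open>V\<close>, and the inclusion of \<open>V\<close> in \<open>H\<close>
  is an injective bounded linear map \<open>\<iota>\<close>. The type \<open>'v \<Rightarrow>\<^sub>L real\<close> is the dual \<open>V'\<close>, so that
  \<open>A u z\<close> is the duality bracket of \<open>A u\<close> and \<open>z\<close>. The inner product of the type \<open>'v\<close> is meant to be
  the scalar product \<open>(y, z) \<mapsto> A y z\<close> with which \<open>V\<close> is endowed; hence \<open>norm\<close> on \<open>'v\<close> is the norm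
  of \<open>V\<close>, and completeness of this scalar product is part of the sort of \<open>'v\<close>.
\<close>

definition symmetric_isomorphism ::
  "('v::{real_inner,banach} \<Rightarrow>\<^sub>L ('v \<Rightarrow>\<^sub>L real)) \<Rightarrow> bool" where
  "symmetric_isomorphism A \<longleftrightarrow>
     bij (blinfun_apply A) \<and> bounded_linear (inv (blinfun_apply A)) \<and>
     (\<forall>y z. blinfun_apply (blinfun_apply A y) z = blinfun_apply (blinfun_apply A z) y)"

definition compact_dense_inclusion ::
  "('v::real_normed_vector \<Rightarrow>\<^sub>L 'h::real_normed_vector) \<Rightarrow> bool" where
  "compact_dense_inclusion \<iota> \<longleftrightarrow>
     inj (blinfun_apply \<iota>) \<and> closure (range (blinfun_apply \<iota>)) = UNIV \<and>
     (\<forall>S. bounded S \<longrightarrow> compact (closure (blinfun_apply \<iota> ` S)))"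

text \<open>
  Because \<open>H\<close> is identified with its dual, an element \<open>h\<close> of \<open>H\<close> is the functional
  \<open>z \<mapsto> h \<bullet> \<iota> z\<close> on \<open>V\<close>. This gives the meaning of \<open>A u \<in> H\<close>, and \<open>AH \<iota> A u\<close> is then \<open>A u\<close>
  as an element of \<open>H\<close>; it is unique since the range of \<open>\<iota>\<close> is dense. Outside \<open>DA \<iota> A\<close> the value
  of \<open>AH\<close> is irrelevant.
\<close>

definition DA :: "('v::{real_inner,banach} \<Rightarrow>\<^sub>L 'h::{real_inner,banach}) \<Rightarrow>
    ('v \<Rightarrow>\<^sub>L ('v \<Rightarrow>\<^sub>L real)) \<Rightarrow> 'v set" where
  "DA \<iota> A = {u. \<exists>h. \<forall>z. blinfun_apply (blinfun_apply A u) z = h \<bullet> blinfun_apply \<iota> z}"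

definition AH :: "('v::{real_inner,banach} \<Rightarrow>\<^sub>L 'h::{real_inner,banach}) \<Rightarrow>
    ('v \<Rightarrow>\<^sub>L ('v \<Rightarrow>\<^sub>L real)) \<Rightarrow> 'v \<Rightarrow> 'h" where
  "AH \<iota> A u = (THE h. \<forall>z. blinfun_apply (blinfun_apply A u) z = h \<bullet> blinfun_apply \<iota> z)"

definition DA_norm :: "('v::{real_inner,banach} \<Rightarrow>\<^sub>L 'h::{real_inner,banach}) \<Rightarrow>
    ('v \<Rightarrow>\<^sub>L ('v \<Rightarrow>\<^sub>L real)) \<Rightarrow> 'v \<Rightarrow> real" where
  "DA_norm \<iota> A u = norm (AH \<iota> A u)"

text \<open>
  Indices start at 1; the values \<open>\<alpha> 0\<close> and \<open>e 0\<close> play no role. The eigenfunctions are elements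
  of \<open>V\<close>, and they are orthonormal and complete in \<open>H\<close>.
\<close>

definition eigenbasis :: "('v::{real_inner,banach} \<Rightarrow>\<^sub>L 'h::{real_inner,banach}) \<Rightarrow>
    ('v \<Rightarrow>\<^sub>L ('v \<Rightarrow>\<^sub>L real)) \<Rightarrow> (nat \<Rightarrow> real) \<Rightarrow> (nat \<Rightarrow> 'v) \<Rightarrow> bool" where
  "eigenbasis \<iota> A \<alpha> e \<longleftrightarrow>
     0 < \<alpha> 1 \<and> mono_on {1..} \<alpha> \<and> filterlim \<alpha> at_top sequentially \<and>
     (\<forall>i\<ge>1. e i \<in> DA \<iota> A \<and> AH \<iota> A (e i) = \<alpha> i *\<^sub>R blinfun_apply \<iota> (e i)) \<and>
     (\<forall>i\<ge>1. \<forall>j\<ge>1. blinfun_apply \<iota> (e i) \<bullet> blinfun_apply \<iota> (e j) = (if i = j then 1 else 0)) \<and>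
     closure (span ((\<lambda>i. blinfun_apply \<iota> (e i)) ` {1..})) = UNIV"

definition EM :: "('v::{real_inner,banach} \<Rightarrow>\<^sub>L 'h::{real_inner,banach}) \<Rightarrow>
    (nat \<Rightarrow> 'v) \<Rightarrow> nat \<Rightarrow> 'h set" where
  "EM \<iota> e M = span ((\<lambda>i. blinfun_apply \<iota> (e i)) ` {1..M})"

text \<open>The library has \<open>0 powr 0 = 0\<close>, but \<open>x\<close> to the power \<open>0\<close> has to be \<open>1\<close> also at \<open>x = 0\<close>.\<close>

definition rpow :: "real \<Rightarrow> real \<Rightarrow> real" where
  "rpow x a = (if a = 0 then 1 else x powr a)"

text \<open>
  The class of functions written C with index b,i in the literature. The normed space \<open>X\<close> is given
  by a carrier \<open>D\<close> and a norm \<open>nrm\<close> on it, because \<open>D(A)\<close> carries its own norm.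
\<close>

definition Cbi :: "'x::real_vector set \<Rightarrow> ('x \<Rightarrow> real) \<Rightarrow> ('x \<Rightarrow> 'y::real_normed_vector) \<Rightarrow> bool" where
  "Cbi D nrm f \<longleftrightarrow>
     (\<forall>x\<in>D. \<forall>\<epsilon>>0. \<exists>\<delta>>0. \<forall>z\<in>D. nrm (z - x) < \<delta> \<longrightarrow> norm (f z - f x) < \<epsilon>) \<and>
     (\<exists>\<nn>::real \<Rightarrow> real. continuous_on {0..} \<nn> \<and> mono_on {0..} \<nn> \<and> \<nn> 0 = 0 \<and>
        (\<forall>x\<in>D. norm (f x) \<le> \<nn> (nrm x)))"

text \<open>
  The operator is essentially bounded by \<open>C\<close> in the operator norm; measurability is
  required only pointwise on \<open>V\<close>, which is implied by strong measurability in the operator norm.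
\<close>

definition ess_bounded_operator ::
  "(real \<Rightarrow> ('v::real_normed_vector \<Rightarrow>\<^sub>L 'h::real_normed_vector)) \<Rightarrow> real \<Rightarrow> bool" where
  "ess_bounded_operator B C \<longleftrightarrow>
     (\<forall>v. (\<lambda>t. blinfun_apply (B t) v) \<in> borel_measurable (lebesgue_on {0<..})) \<and>
     (AE t in lebesgue_on {0<..}. norm (B t) \<le> C)"

definition direct_sum :: "'h::real_vector set \<Rightarrow> 'h set \<Rightarrow> bool" where
  "direct_sum F G \<longleftrightarrow> subspace F \<and> subspace G \<and> F \<inter> G = {0} \<and>
     (\<forall>h. \<exists>f\<in>F. \<exists>g\<in>G. h = f + g)"

definition oblique_proj :: "'h::real_vector set \<Rightarrow> 'h set \<Rightarrow> 'h \<Rightarrow> 'h" where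
  "oblique_proj F G h = (THE f. f \<in> F \<and> h - f \<in> G)"

definition L2_on :: "real \<Rightarrow> (real \<Rightarrow> 'h::{banach,second_countable_topology}) \<Rightarrow> bool" where
  "L2_on T f \<longleftrightarrow> f \<in> borel_measurable (lebesgue_on {0..T}) \<and>
     integrable (lebesgue_on {0..T}) (\<lambda>t. (norm (f t))\<^sup>2)"

text \<open>
  Strong solutions on \<open>[0,T]\<close> of \<open>y' + F(t,y) = 0\<close>, \<open>y(0) = y0\<close>: the function \<open>y\<close> is in
  \<open>L\<^sup>2((0,T),D(A))\<close> with weak derivative \<open>w\<close> in \<open>L\<^sup>2((0,T),H)\<close>, and is
  represented by a function continuous with values in \<open>V\<close>.
\<close>

definition strong_solution ::
  "('v::{real_inner,banach} \<Rightarrow>\<^sub>L 'h::{real_inner,banach,second_countable_topology}) \<Rightarrow>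
   ('v \<Rightarrow>\<^sub>L ('v \<Rightarrow>\<^sub>L real)) \<Rightarrow> (real \<Rightarrow> 'v \<Rightarrow> 'h) \<Rightarrow> 'v \<Rightarrow> real \<Rightarrow> (real \<Rightarrow> 'v) \<Rightarrow> bool" where
  "strong_solution \<iota> A F y0 T y \<longleftrightarrow>
     y 0 = y0 \<and> continuous_on {0..T} y \<and>
     (AE t in lebesgue_on {0..T}. y t \<in> DA \<iota> A) \<and> L2_on T (\<lambda>t. AH \<iota> A (y t)) \<and>
     (\<exists>w. L2_on T w \<and>
        (\<forall>t\<in>{0..T}. blinfun_apply \<iota> (y t) =
            blinfun_apply \<iota> y0 + (LINT s|lebesgue_on {0..t}. w s)) \<and>
        (AE t in lebesgue_on {0..T}. w t + F t (y t) = 0))"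

definition closed_loop ::
  "('v::{real_inner,banach} \<Rightarrow>\<^sub>L 'h::{real_inner,banach}) \<Rightarrow> ('v \<Rightarrow>\<^sub>L ('v \<Rightarrow>\<^sub>L real)) \<Rightarrow>
   (real \<Rightarrow> ('v \<Rightarrow>\<^sub>L 'h)) \<Rightarrow> (real \<Rightarrow> 'v \<Rightarrow> 'h) \<Rightarrow> real \<Rightarrow> ('h \<Rightarrow> 'h) \<Rightarrow> real \<Rightarrow> 'v \<Rightarrow> 'h" where
  "closed_loop \<iota> A Arc N lam P t v =
     AH \<iota> A v + blinfun_apply (Arc t) v + N t v
     - P (AH \<iota> A v + blinfun_apply (Arc t) v + N t v
          - (AH \<iota> A v + lam *\<^sub>R blinfun_apply \<iota> v))"

end

theory Submission
  imports Defs
begin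

text \<open>
  Applying the orthogonal projection onto the span of the first \<open>M\<close> eigenfunctions to the closed loop
  leaves \<open>q' = - A q - \<lambda> q\<close> for the component \<open>q\<close> of \<open>y\<close>, because the oblique projection
  subtracts exactly the low modes of the nonlinear terms. The remainder \<open>Q = y - q\<close> satisfies
  \<open>|A Q|\<^sup>2 \<ge> \<alpha>\<^sub>M\<^sub>+\<^sub>1 |Q|\<^sup>2\<close>, which dominates the nonlinearity for large \<open>M\<close>. By Young's inequality
  the nonlinearity is, on bounded sets of \<open>V\<close>, Lipschitz from \<open>D(A)\<close> to \<open>H\<close> with an arbitrarily
  small constant up to lower order terms. Together with maximal regularity of the linear equation this one
  estimate gives local existence by a contraction in \<open>L\<^sup>2\<close> of the forcing, uniqueness by Gronwall's
  inequality, and the decay of a Lyapunov function, hence also an a priori bound and global existence.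
\<close>

section \<open>Lebesgue integrals over intervals\<close>

text \<open>The Lipschitz constants depend on the radius \<open>K\<close> of a ball in V in which
  the solution has to stay, while staying there is to be proved with \<open>M\<close> chosen from
  these constants. The circle is broken by splitting the nonlinear term at q: since q decouples, its
  V norm never exceeds the initial bound \<open>R\<close>, so the value at q costs only constants
  depending on \<open>R\<close>. These fix the weight of q in the Lyapunov function and thereby
  \<open>K\<close>. Only the difference of the values at y and at q involves the constants at radius
  \<open>K\<close>, and its lower order part contains Q alone, where a large eigenvalue absorbs it.
  A second obstacle is regularity: y(t) lies in D(A) for almost every t only, and y' takes values in
  H, not in V. Hence |y|_V^2 is not differentiated directly; the calculus is done on scalar
  coordinates, which are absolutely continuous, and the energy estimates are kept in integrated
  form.\<close>

lemma AE_lebesgue_on_iff: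
  assumes "S \<in> sets lebesgue"
  shows "(AE t in lebesgue_on S. P t) \<longleftrightarrow> (AE t in lebesgue. t \<in> S \<longrightarrow> P t)"
  using assms by (subst AE_restrict_space_iff) auto

lemma AE_lebesgue_on_subset:
  assumes "AE t in lebesgue_on S. P t" "T \<subseteq> S" "S \<in> sets lebesgue" "T \<in> sets lebesgue"
  shows "AE t in lebesgue_on T. P t"
  using assms by (auto simp: AE_lebesgue_on_iff elim!: eventually_mono)

lemma borel_measurable_lebesgue_on_subset:
  assumes "f \<in> measurable (lebesgue_on S) N" "T \<subseteq> S"
  shows "f \<in> measurable (lebesgue_on T) N"
  using measurable_restrict_mono[OF assms] .

lemma integrable_lebesgue_on_subset:
  fixes f :: "real \<Rightarrow> 'a::{banach,second_countable_topology}"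
  assumes f: "integrable (lebesgue_on S) f" and "T \<subseteq> S" "S \<in> sets lebesgue" "T \<in> sets lebesgue"
  shows "integrable (lebesgue_on T) f"
proof -
  have "set_integrable lebesgue S f"
    using f assms by (simp add: integrable_restrict_space set_integrable_def)
  then have "set_integrable lebesgue T f"
    using assms set_integrable_subset by blast
  then show ?thesis using assms by (simp add: integrable_restrict_space set_integrable_def)
qed

lemma integral_lebesgue_on_combine:
  fixes f :: "real \<Rightarrow> 'a::{banach,second_countable_topology}"
  assumes f: "integrable (lebesgue_on {a..c}) f" and "a \<le> b" "b \<le> c"
  shows "(LINT t|lebesgue_on {a..c}. f t) = (LINT t|lebesgue_on {a..b}. f t) + (LINT t|lebesgue_on {b..c}. f t)"
proof -
  have i: "set_integrable lebesgue {a..b} f" "set_integrable lebesgue {b..c} f"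
    using integrable_lebesgue_on_subset[OF f, of "{a..b}"] integrable_lebesgue_on_subset[OF f, of "{b..c}"] assms
    by (simp_all add: integrable_restrict_space set_integrable_def)
  have "AE t in lebesgue. \<not> (t \<in> {a..b} \<and> t \<in> {b..c})"
    by (rule AE_I'[of "{b}"]) auto
  then have "set_lebesgue_integral lebesgue ({a..b} \<union> {b..c}) f
      = set_lebesgue_integral lebesgue {a..b} f + set_lebesgue_integral lebesgue {b..c} f"
    using i by (intro set_integral_Un_AE) auto
  moreover have "{a..b} \<union> {b..c} = {a..c}" using assms by auto
  ultimately show ?thesis
    by (simp add: integral_restrict_space set_lebesgue_integral_def)
qed

lemma integrable_lebesgue_on_combine:
  fixes f :: "real \<Rightarrow> 'a::{banach,second_countable_topology}"
  assumes f: "integrable (lebesgue_on {a..b}) f" "integrable (lebesgue_on {b..c}) f" and "a \<le> b" "b \<le> c"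
  shows "integrable (lebesgue_on {a..c}) f"
proof -
  have i: "set_integrable lebesgue {a..b} f" "set_integrable lebesgue {b..c} f"
    using f by (simp_all add: integrable_restrict_space set_integrable_def)
  then have "set_integrable lebesgue ({a..b} \<union> {b..c}) f"
    by (intro set_integrable_Un) auto
  moreover have "{a..b} \<union> {b..c} = {a..c}" using assms by auto
  ultimately show ?thesis
    by (simp add: integrable_restrict_space set_integrable_def)
qed

lemma measurable_lebesgue_on_iff:
  assumes S: "S \<in> sets lebesgue"
  shows "f \<in> borel_measurable (lebesgue_on S) \<longleftrightarrow> (\<forall>B\<in>sets borel. f -` B \<inter> S \<in> sets lebesgue)"
  using S by (auto simp: measurable_def sets_restrict_space_iff space_borel)

lemma borel_measurable_lebesgue_on_combine:
  fixes f :: "real \<Rightarrow> 'a::topological_space"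
  assumes f: "f \<in> borel_measurable (lebesgue_on {a..b})" "f \<in> borel_measurable (lebesgue_on {b..c})"
    and "a \<le> b" "b \<le> c"
  shows "f \<in> borel_measurable (lebesgue_on {a..c})"
proof -
  have "{a..c} = {a..b} \<union> {b..c}" using assms by auto
  then show ?thesis using f by (auto simp: measurable_lebesgue_on_iff Int_Un_distrib)
qed

lemma AE_lebesgue_on_combine:
  fixes a b c :: real
  assumes "AE t in lebesgue_on {a..b}. P t" "AE t in lebesgue_on {b..c}. P t"
  shows "AE t in lebesgue_on {a..c}. P t"
proof -
  have "AE t in lebesgue. t \<in> {a..b} \<longrightarrow> P t" "AE t in lebesgue. t \<in> {b..c} \<longrightarrow> P t"
    using assms by (simp_all add: AE_lebesgue_on_iff)
  then have "AE t in lebesgue. t \<in> {a..c} \<longrightarrow> P t" by eventually_elim auto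
  then show ?thesis by (simp add: AE_lebesgue_on_iff)
qed

text \<open>Rests on completeness of Lebesgue measure: preimages change by null sets only. It is
  used because \<open>L (y t)\<close> is meaningful only for almost every \<open>t\<close>.\<close>

lemma borel_measurable_lebesgue_on_AE:
  assumes f: "f \<in> borel_measurable (lebesgue_on S)" and S: "S \<in> sets lebesgue"
    and ae: "AE t in lebesgue_on S. f t = g t"
  shows "g \<in> borel_measurable (lebesgue_on S)"
  unfolding measurable_lebesgue_on_iff[OF S]
proof
  fix B :: "'b set" assume B: "B \<in> sets borel"
  have "f -` B \<inter> S \<in> sets lebesgue" using f B measurable_lebesgue_on_iff[OF S] by blast
  moreover have "AE t in lebesgue. t \<in> f -` B \<inter> S \<longleftrightarrow> t \<in> g -` B \<inter> S"
    using ae[unfolded AE_lebesgue_on_iff[OF S]] by eventually_elim auto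
  ultimately show "g -` B \<inter> S \<in> sets lebesgue"
    using completion.in_sets_AE[where A="f -` B \<inter> S" and B="g -` B \<inter> S"] by simp
qed

lemma borel_measurable_lebesgue_on_lim:
  fixes f :: "nat \<Rightarrow> 'c::euclidean_space \<Rightarrow> 'a::{banach,second_countable_topology}"
  assumes f: "\<And>n. f n \<in> borel_measurable (lebesgue_on S)" and S: "S \<in> sets lebesgue"
    and ae: "AE t in lebesgue_on S. (\<lambda>n. f n t) \<longlonglongrightarrow> g t"
  shows "g \<in> borel_measurable (lebesgue_on S)"
proof (rule borel_measurable_lebesgue_on_AE[OF _ S])
  show "(\<lambda>t. lim (\<lambda>n. f n t)) \<in> borel_measurable (lebesgue_on S)"
    by (rule borel_measurable_lim_metric) (rule f)
  show "AE t in lebesgue_on S. lim (\<lambda>n. f n t) = g t"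
    using ae by eventually_elim (rule limI)
qed

section \<open>Square integrable functions\<close>

text \<open>Beppo Levi: bounded partial integrals force the extended-valued sum to have a finite
  integral, hence to be finite almost everywhere. It serves twice, for completeness of L2 and for
  membership in D(A) at almost every time.\<close>

lemma integrable_AE_summable:
  fixes f :: "nat \<Rightarrow> 'a \<Rightarrow> real"
  assumes int: "\<And>i. integrable M (f i)" and nn: "\<And>i x. 0 \<le> f i x"
    and bd: "\<And>n. (\<Sum>i<n. integral\<^sup>L M (f i)) \<le> B"
  shows "AE x in M. summable (\<lambda>i. f i x)"
    and "integrable M (\<lambda>x. \<Sum>i. f i x)"
    and "(LINT x|M. (\<Sum>i. f i x)) \<le> B"
proof -
  have su: "summable (\<lambda>i. integral\<^sup>L M (f i))"
    using bd by (intro bounded_imp_summable[where B=B]) (auto simp: nn lessThan_Suc_atMost[symmetric] integral_nonneg_AE simp del: sum.lessThan_Suc)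
  have "(\<integral>\<^sup>+x. (\<Sum>i. ennreal (f i x)) \<partial>M) = (\<Sum>i. \<integral>\<^sup>+x. ennreal (f i x) \<partial>M)"
    using int by (intro nn_integral_suminf) auto
  also have "\<dots> = (\<Sum>i. ennreal (integral\<^sup>L M (f i)))"
    using int nn by (simp add: nn_integral_eq_integral)
  also have "\<dots> = ennreal (\<Sum>i. integral\<^sup>L M (f i))"
    using su nn by (intro suminf_ennreal2) (auto intro: integral_nonneg_AE)
  finally have fin: "(\<integral>\<^sup>+x. (\<Sum>i. ennreal (f i x)) \<partial>M) \<noteq> \<infinity>" by simp
  have "AE x in M. (\<Sum>i. ennreal (f i x)) \<noteq> \<infinity>"
    using fin int by (intro nn_integral_noteq_infinite) auto
  then show ae: "AE x in M. summable (\<lambda>i. f i x)"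
    by eventually_elim (auto intro: summable_suminf_not_top simp: nn)
  have ae': "AE x in M. summable (\<lambda>i. norm (f i x))" using ae nn by simp
  have su': "summable (\<lambda>i. LINT x|M. norm (f i x))" using su nn by simp
  show "integrable M (\<lambda>x. \<Sum>i. f i x)" by (rule integrable_suminf[OF int ae' su'])
  have "(LINT x|M. (\<Sum>i. f i x)) = (\<Sum>i. integral\<^sup>L M (f i))"
    by (rule integral_suminf[OF int ae' su'])
  also have "\<dots> \<le> B" by (rule suminf_le_const[OF su bd])
  finally show "(LINT x|M. (\<Sum>i. f i x)) \<le> B" .
qed

text \<open>\<open>L2_on\<close> for an arbitrary measure, since solutions are restarted at positive
  times and intervals need not begin at 0.\<close>

definition sqint :: "'a measure \<Rightarrow> ('a \<Rightarrow> 'b::{banach,second_countable_topology}) \<Rightarrow> bool" where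
  "sqint M f \<longleftrightarrow> f \<in> borel_measurable M \<and> integrable M (\<lambda>x. (norm (f x))\<^sup>2)"

lemma sqint_meas: "sqint M f \<Longrightarrow> f \<in> borel_measurable M"
  and sqint_int: "sqint M f \<Longrightarrow> integrable M (\<lambda>x. (norm (f x))\<^sup>2)"
  by (auto simp: sqint_def)

lemma sqint_bound:
  assumes "f \<in> borel_measurable M" "integrable M g" "AE x in M. (norm (f x))\<^sup>2 \<le> g x"
  shows "sqint M f"
  unfolding sqint_def
proof
  show "integrable M (\<lambda>x. (norm (f x))\<^sup>2)"
    using assms(1,3) by (intro Bochner_Integration.integrable_bound[OF assms(2)]) (auto elim!: eventually_mono)
qed fact

lemma norm_add_sq_le: "(norm (a + b :: 'a::real_normed_vector))\<^sup>2 \<le> 2 * (norm a)\<^sup>2 + 2 * (norm b)\<^sup>2"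
proof -
  have "(norm (a+b))\<^sup>2 \<le> (norm a + norm b)\<^sup>2" by (simp add: norm_triangle_ineq power_mono)
  also have "\<dots> \<le> 2 * (norm a)\<^sup>2 + 2 * (norm b)\<^sup>2"
    using sum_squares_bound[of "norm a" "norm b"] by (simp add: power2_sum)
  finally show ?thesis .
qed

lemma norm_diff_sq_le: "(norm (a - b :: 'a::real_normed_vector))\<^sup>2 \<le> 2 * (norm a)\<^sup>2 + 2 * (norm b)\<^sup>2"
  using norm_add_sq_le[of a "-b"] by simp

lemma sqint_add:
  assumes f: "sqint M f" and g: "sqint M g"
  shows "sqint M (\<lambda>x. f x + g x)"
proof (rule sqint_bound)
  show "(\<lambda>x. f x + g x) \<in> borel_measurable M"
    using f g by (intro borel_measurable_add sqint_meas)
  show "integrable M (\<lambda>x. 2 * (norm (f x))\<^sup>2 + 2 * (norm (g x))\<^sup>2)"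
    using sqint_int[OF f] sqint_int[OF g] by simp
qed (simp add: norm_add_sq_le)

lemma sqint_diff:
  assumes f: "sqint M f" and g: "sqint M g"
  shows "sqint M (\<lambda>x. f x - g x)"
proof (rule sqint_bound)
  show "(\<lambda>x. f x - g x) \<in> borel_measurable M"
    using f g by (intro borel_measurable_diff sqint_meas)
  show "integrable M (\<lambda>x. 2 * (norm (f x))\<^sup>2 + 2 * (norm (g x))\<^sup>2)"
    using sqint_int[OF f] sqint_int[OF g] by simp
qed (simp add: norm_diff_sq_le)

lemma integrable_inner_sqint:
  fixes f g :: "'a \<Rightarrow> 'b::{real_inner,banach,second_countable_topology}"
  assumes "sqint M f" "sqint M g"
  shows "integrable M (\<lambda>x. f x \<bullet> g x)"
proof (rule Bochner_Integration.integrable_bound[where f="\<lambda>x. (norm (f x))\<^sup>2 + (norm (g x))\<^sup>2"])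
  show "integrable M (\<lambda>x. (norm (f x))\<^sup>2 + (norm (g x))\<^sup>2)" using assms by (auto simp: sqint_int)
  show "(\<lambda>x. f x \<bullet> g x) \<in> borel_measurable M" using assms by (intro borel_measurable_inner sqint_meas)
  have "\<bar>f x \<bullet> g x\<bar> \<le> (norm (f x))\<^sup>2 + (norm (g x))\<^sup>2" for x
  proof -
    have "\<bar>f x \<bullet> g x\<bar> \<le> norm (f x) * norm (g x)" by (rule Cauchy_Schwarz_ineq2)
    moreover have "0 \<le> norm (f x) * norm (g x)" by simp
    ultimately show ?thesis using sum_squares_bound[of "norm (f x)" "norm (g x)"] by linarith
  qed
  then show "AE x in M. norm (f x \<bullet> g x) \<le> norm ((norm (f x))\<^sup>2 + (norm (g x))\<^sup>2)" by simp
qed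

lemma sqint_AE:
  fixes f g :: "'c::euclidean_space \<Rightarrow> 'a::{banach,second_countable_topology}"
  assumes f: "sqint (lebesgue_on S) f" and S: "S \<in> sets lebesgue" and ae: "AE t in lebesgue_on S. f t = g t"
  shows "sqint (lebesgue_on S) g"
proof (rule sqint_bound)
  show "g \<in> borel_measurable (lebesgue_on S)"
    by (rule borel_measurable_lebesgue_on_AE[OF sqint_meas[OF f] S ae])
  show "AE t in lebesgue_on S. (norm (g t))\<^sup>2 \<le> (norm (f t))\<^sup>2"
    using ae by eventually_elim simp
qed (rule sqint_int[OF f])

lemma sqint_lebesgue_on_subset:
  fixes f :: "real \<Rightarrow> 'a::{banach,second_countable_topology}"
  assumes "sqint (lebesgue_on S) f" "T \<subseteq> S" "S \<in> sets lebesgue" "T \<in> sets lebesgue"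
  shows "sqint (lebesgue_on T) f"
  unfolding sqint_def
  using borel_measurable_lebesgue_on_subset[OF sqint_meas[OF assms(1)] assms(2)]
    integrable_lebesgue_on_subset[OF sqint_int[OF assms(1)] assms(2-)] by (rule conjI)

lemma sqint_lebesgue_on_combine:
  fixes f :: "real \<Rightarrow> 'a::{banach,second_countable_topology}"
  assumes f: "sqint (lebesgue_on {a..b}) f" and g: "sqint (lebesgue_on {b..c}) f" and "a \<le> b" "b \<le> c"
  shows "sqint (lebesgue_on {a..c}) f"
  unfolding sqint_def
  using borel_measurable_lebesgue_on_combine[OF sqint_meas[OF f] sqint_meas[OF g] assms(3,4)]
    integrable_lebesgue_on_combine[OF sqint_int[OF f] sqint_int[OF g] assms(3,4)] by (rule conjI)

lemma sqint_integrable: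
  fixes f :: "real \<Rightarrow> 'a::{banach,second_countable_topology}"
  assumes "sqint (lebesgue_on {a..b}) f"
  shows "integrable (lebesgue_on {a..b}) f"
proof (rule Bochner_Integration.integrable_bound[where f="\<lambda>x. 1 + (norm (f x))\<^sup>2"])
  show "integrable (lebesgue_on {a..b}) (\<lambda>x. 1 + (norm (f x))\<^sup>2)"
    using assms by (intro Bochner_Integration.integrable_add sqint_int) auto
  have "norm (f x) \<le> 1 + (norm (f x))\<^sup>2" for x
    using sum_squares_bound[of 1 "norm (f x)"] norm_ge_zero[of "f x"] unfolding one_power2 mult_1_right
    by linarith
  then show "AE x in lebesgue_on {a..b}. norm (f x) \<le> norm (1 + (norm (f x))\<^sup>2)" by simp
qed (use assms sqint_meas in auto)

text \<open>Riesz-Fischer for a sequence with geometric rate. The weight 2^k still leaves the series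
  of integrals convergent, with ratio 1/2, and its pointwise sum \<open>S\<close> bounds each
  increment by \<open>sqrt (S x) * r^k\<close> with r^2 = 1/2. So the sequence is Cauchy wherever
  the weighted series converges, and \<open>S\<close> also dominates the errors, which gives
  convergence in L2.\<close>

lemma sqint_Cauchy_limit:
  fixes f :: "nat \<Rightarrow> 'a \<Rightarrow> 'b::{banach,second_countable_topology}"
  assumes sq: "\<And>k. sqint M (f k)"
    and diff: "\<And>k. (LINT x|M. (norm (f (Suc k) x - f k x))\<^sup>2) \<le> c * (1/4)^k"
  shows "\<exists>g. sqint M g \<and> (\<lambda>k. LINT x|M. (norm (g x - f k x))\<^sup>2) \<longlonglongrightarrow> 0"
proof -
  define d where "d k x = 2^k * (norm (f (Suc k) x - f k x))\<^sup>2" for k x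
  define S where "S x = (\<Sum>k. d k x)" for x
  define r :: real where "r = sqrt (1/2)"
  define g where "g x = lim (\<lambda>n. f n x)" for x
  have r: "0 < r" "r < 1" "r^2 = 1/2" by (auto simp: r_def real_sqrt_lt_1_iff)
  have dint: "integrable M (d k)" and dnn: "0 \<le> d k x" for k x
    unfolding d_def using sqint_int[OF sqint_diff[OF sq sq]] by auto
  have c: "0 \<le> c"
  proof -
    have "0 \<le> (LINT x|M. (norm (f (Suc 0) x - f 0 x))\<^sup>2)" by simp
    also have "\<dots> \<le> c" using diff[of 0] by simp
    finally show ?thesis .
  qed
  have bd: "(\<Sum>k<n. integral\<^sup>L M (d k)) \<le> 2 * c" for n
  proof -
    have "(\<Sum>k<n. integral\<^sup>L M (d k)) \<le> (\<Sum>k<n. c * (1/2)^k)"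
    proof (rule sum_mono)
      fix k
      have "integral\<^sup>L M (d k) \<le> 2^k * (c * (1/4)^k)"
        unfolding d_def using diff[of k] by simp
      also have "\<dots> = c * (1/2)^k" by (simp add: power_divide power_mult_distrib[symmetric] flip: power_mult_distrib)
         (simp add: field_simps flip: power_mult_distrib)
      finally show "integral\<^sup>L M (d k) \<le> c * (1/2)^k" .
    qed
    also have "\<dots> = c * (2 - 2 * (1/2)^n)" by (simp add: sum_distrib_left[symmetric] geometric_sum sum_gp_strict)
    also have "\<dots> \<le> 2 * c" using c by (simp add: algebra_simps)
    finally show ?thesis .
  qed
  note S = integrable_AE_summable[of M d, OF dint dnn bd, folded S_def]
  \<comment> \<open>The squared sum of the geometric series with ratio \<open>r\<close>; it turns
    the bound on one increment into a bound on the whole tail.\<close>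
  define C where "C = (1 / (1-r))\<^sup>2"
  have ptw: "(\<lambda>n. f n x) \<longlonglongrightarrow> g x \<and> (\<forall>k. (norm (g x - f k x))\<^sup>2 \<le> C * S x * (1/2)^k)"
    if su: "summable (\<lambda>k. d k x)" for x
  proof -
    have S0: "0 \<le> S x" unfolding S_def by (rule suminf_nonneg[OF su dnn])
    have d1: "norm (f (Suc k) x - f k x) \<le> sqrt (S x) * r^k" for k
    proof (rule power2_le_imp_le)
      have "d k x \<le> S x" unfolding S_def by (rule sum_le_suminf[OF su, of "{k}", simplified]) (simp add: dnn)
      then have "(norm (f (Suc k) x - f k x))\<^sup>2 \<le> S x / 2^k" by (simp add: d_def field_simps)
      also have "\<dots> = (sqrt (S x) * r^k)\<^sup>2"
      proof -
        have "(r^k)\<^sup>2 = (r\<^sup>2)^k" by (simp only: power_mult[symmetric] mult.commute)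
        then show ?thesis using S0 by (simp add: power_mult_distrib r(3) power_divide)
      qed
      finally show "(norm (f (Suc k) x - f k x))\<^sup>2 \<le> (sqrt (S x) * r^k)\<^sup>2" .
    qed (use S0 r in auto)
    have d2: "norm (f (k+m) x - f k x) \<le> sqrt (S x) * r^k * ((1 - r^m) / (1-r))" for k m
    proof (induction m)
      case (Suc m)
      have "norm (f (k + Suc m) x - f k x) \<le> norm (f (Suc (k+m)) x - f (k+m) x) + norm (f (k+m) x - f k x)"
        using norm_triangle_ineq[of "f (Suc (k+m)) x - f (k+m) x" "f (k+m) x - f k x"]
        by (simp only: diff_add_cancel diff_add_eq add_Suc_right add_diff_eq)
      also have "\<dots> \<le> sqrt (S x) * r^(k+m) + sqrt (S x) * r^k * ((1 - r^m) / (1-r))"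
        by (intro add_mono Suc d1)
      also have "\<dots> = sqrt (S x) * r^k * (r^m + (1 - r^m) / (1-r))" by (simp add: power_add algebra_simps)
      also have "r^m + (1 - r^m) / (1-r) = (1 - r^Suc m) / (1-r)" using r by (simp add: field_simps)
      finally show ?case .
    qed simp
    have d3: "norm (f n x - f k x) \<le> sqrt (S x) * r^k * (1 / (1-r))" if "k \<le> n" for k n
    proof -
      have "norm (f n x - f k x) \<le> sqrt (S x) * r^k * ((1 - r^(n-k)) / (1-r))" using d2[of k "n-k"] that by simp
      also have "\<dots> \<le> sqrt (S x) * r^k * (1 / (1-r))"
        using r S0 by (intro mult_left_mono divide_right_mono) auto
      finally show ?thesis .
    qed
    have "(\<lambda>k. sqrt (S x) * r^k * (1 / (1-r))) \<longlonglongrightarrow> sqrt (S x) * 0 * (1 / (1-r))"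
      using r by (intro tendsto_intros LIMSEQ_realpow_zero) auto
    then have lim0: "(\<lambda>k. sqrt (S x) * r^k * (1 / (1-r))) \<longlonglongrightarrow> 0" by simp
    have "Cauchy (\<lambda>n. f n x)"
    proof (rule metric_CauchyI)
      fix e :: real assume "0 < e"
      have "\<exists>k0. \<forall>k\<ge>k0. norm (sqrt (S x) * r^k * (1 / (1-r)) - 0) < e/2"
        by (rule LIMSEQ_D[OF lim0]) (use \<open>0 < e\<close> in simp)
      then obtain k where k: "norm (sqrt (S x) * r^k * (1 / (1-r)) - 0) < e/2" by blast
      have *: "dist (f n x) (f k x) < e/2" if "n \<ge> k" for n using d3[OF that] k unfolding dist_norm real_norm_def by linarith
      have "dist (f m x) (f n x) < e" if "m \<ge> k" "n \<ge> k" for m n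
        using dist_triangle2[of "f m x" "f n x" "f k x"] *[OF that(1)] *[OF that(2)] by linarith
      then show "\<exists>N. \<forall>m\<ge>N. \<forall>n\<ge>N. dist (f m x) (f n x) < e" by blast
    qed
    then have lim: "(\<lambda>n. f n x) \<longlonglongrightarrow> g x"
      unfolding g_def by (simp add: Cauchy_convergent_iff convergent_LIMSEQ_iff)
    have "(norm (g x - f k x))\<^sup>2 \<le> C * S x * (1/2)^k" for k
    proof -
      have "(\<lambda>n. norm (f n x - f k x)) \<longlonglongrightarrow> norm (g x - f k x)" by (intro tendsto_intros lim)
      then have "norm (g x - f k x) \<le> sqrt (S x) * r^k * (1 / (1-r))"
        by (rule LIMSEQ_le_const2) (use d3 in blast)
      then have "(norm (g x - f k x))\<^sup>2 \<le> (sqrt (S x) * r^k * (1 / (1-r)))\<^sup>2" by (rule power_mono) simp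
      also have "\<dots> = S x * (r^2)^k * C"
      proof -
        have "(r^k)\<^sup>2 = (r\<^sup>2)^k" by (simp only: power_mult[symmetric] mult.commute)
        then show ?thesis using S0 by (simp add: power_mult_distrib r(3) power_divide C_def)
      qed
      finally show ?thesis by (simp add: r(3) mult_ac)
    qed
    then show ?thesis using lim by (intro conjI allI)
  qed
  have gm: "g \<in> borel_measurable M" unfolding g_def by (intro borel_measurable_lim_metric sqint_meas sq)
  have ae: "AE x in M. (norm (g x - f k x))\<^sup>2 \<le> C * S x * (1/2)^k" for k
    using S(1) by eventually_elim (use ptw in blast)
  have iS: "integrable M (\<lambda>x. C * S x * (1/2)^k)" for k using S(2) by simp
  have sqk: "sqint M (\<lambda>x. g x - f k x)" for k
    by (rule sqint_bound[OF _ iS ae]) (intro borel_measurable_diff gm sqint_meas sq)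
  have "sqint M (\<lambda>x. (g x - f 0 x) + f 0 x)" by (intro sqint_add sqk sq)
  then have "sqint M g" by simp
  moreover have "(\<lambda>k. LINT x|M. (norm (g x - f k x))\<^sup>2) \<longlonglongrightarrow> 0"
  proof (rule tendsto_sandwich[OF _ _ tendsto_const])
    show "\<forall>\<^sub>F k in sequentially. (LINT x|M. (norm (g x - f k x))\<^sup>2) \<le> C * (LINT x|M. S x) * (1/2)^k"
    proof (rule always_eventually, rule allI)
      fix k
      have "(LINT x|M. (norm (g x - f k x))\<^sup>2) \<le> (LINT x|M. C * S x * (1/2)^k)"
        by (rule integral_mono_AE[OF sqint_int[OF sqk] iS ae])
      then show "(LINT x|M. (norm (g x - f k x))\<^sup>2) \<le> C * (LINT x|M. S x) * (1/2)^k" by simp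
    qed
    have "(\<lambda>k. C * (LINT x|M. S x) * (1/2)^k) \<longlonglongrightarrow> C * (LINT x|M. S x) * 0"
      by (intro tendsto_intros LIMSEQ_realpow_zero) auto
    then show "(\<lambda>k. C * (LINT x|M. S x) * (1/2)^k) \<longlonglongrightarrow> 0" by simp
  qed simp
  ultimately show ?thesis by blast
qed

section \<open>Absolutely continuous functions and a Gronwall lemma\<close>

text \<open>Integration by parts from Fubini: the product of the integrals is the integral of u(s)
  v(r) over a square, which is cut along its diagonal into two triangles; each triangle is one of
  the iterated integrals.\<close>

lemma indefinite_integral_mult:
  fixes u v :: "real \<Rightarrow> real"
  assumes u: "integrable (lebesgue_on {a..t}) u" and v: "integrable (lebesgue_on {a..t}) v" and "a \<le> t"
  shows "(LINT s|lebesgue_on {a..t}. u s) * (LINT s|lebesgue_on {a..t}. v s)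
    = (LINT s|lebesgue_on {a..t}. u s * (LINT r|lebesgue_on {a..s}. v r))
    + (LINT s|lebesgue_on {a..t}. v s * (LINT r|lebesgue_on {a..s}. u r))"
    and "integrable (lebesgue_on {a..t}) (\<lambda>s. u s * (LINT r|lebesgue_on {a..s}. v r))"
proof -
  define M where "M = lebesgue_on {a..t}"
  interpret finite_measure M unfolding M_def by (rule finite_measure_lebesgue_on) auto
  interpret pair_sigma_finite M M ..
  have [measurable]: "u \<in> borel_measurable M" "v \<in> borel_measurable M"
    using u v by (auto simp: M_def)
  have spM: "space M = {a..t}" by (simp add: M_def)
  have [measurable]: "(\<lambda>x. x) \<in> borel_measurable M" unfolding M_def
    using id_borel_measurable_lebesgue_on by (simp add: id_def)
  have prod: "integrable (M \<Otimes>\<^sub>M M) (\<lambda>(s,r). u s * v r)"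
  proof (rule Fubini_integrable)
    show "integrable M (\<lambda>x. LINT y|M. norm (case (x, y) of (s, r) \<Rightarrow> u s * v r))"
      using u v by (simp add: M_def abs_mult)
    show "AE x in M. integrable M (\<lambda>y. case (x, y) of (s, r) \<Rightarrow> u s * v r)"
      using v by (simp add: M_def)
  qed measurable
  have i1: "integrable (M \<Otimes>\<^sub>M M) (\<lambda>(s,r). if r \<le> s then u s * v r else 0)"
    by (rule Bochner_Integration.integrable_bound[OF prod]) (auto simp: split_beta)
  have i2: "integrable (M \<Otimes>\<^sub>M M) (\<lambda>(s,r). if s < r then u s * v r else 0)"
    by (rule Bochner_Integration.integrable_bound[OF prod]) (auto simp: split_beta)
  have e1: "(LINT r|M. (if r \<le> s then u s * v r else 0)) = u s * (LINT r|lebesgue_on {a..s}. v r)"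
    if "s \<in> {a..t}" for s
  proof -
    have "(LINT r|M. (if r \<le> s then u s * v r else 0)) = (LINT r|M. (if r \<in> {a..s} then u s * v r else 0))"
      by (rule Bochner_Integration.integral_cong) (auto simp: M_def)
    also have "\<dots> = (LINT r|lebesgue_on {a..s}. u s * v r)"
      unfolding M_def using that by (subst Lebesgue_Measure.integral_restrict) auto
    finally show ?thesis by simp
  qed
  have e2: "(LINT s|M. (if s < r then u s * v r else 0)) = v r * (LINT s|lebesgue_on {a..r}. u s)"
    if "r \<in> {a..t}" for r
  proof -
    \<comment> \<open>This triangle leaves out the diagonal, whereas the inner integral runs over
      the closed interval; the two differ at a single point.\<close>
    have "AE s in M. s \<noteq> r" unfolding M_def
      by (subst AE_lebesgue_on_iff) (auto intro!: AE_I'[of "{r}"])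
    moreover have "AE s in M. a \<le> s" by (rule AE_I2) (simp add: spM)
    ultimately have "AE s in M. (if s < r then u s * v r else 0) = (if s \<in> {a..r} then u s * v r else 0)"
      by eventually_elim auto
    moreover have "(\<lambda>s. if s < r then u s * v r else 0) \<in> borel_measurable M"
        "(\<lambda>s. if s \<in> {a..r} then u s * v r else 0) \<in> borel_measurable M" by simp_all
    ultimately have "(LINT s|M. (if s < r then u s * v r else 0)) = (LINT s|M. (if s \<in> {a..r} then u s * v r else 0))"
      by (intro integral_cong_AE)
    also have "\<dots> = (LINT s|lebesgue_on {a..r}. u s * v r)"
      unfolding M_def using that by (subst Lebesgue_Measure.integral_restrict) auto
    finally show ?thesis by simp
  qed
  have "(LINT s|M. u s) * (LINT s|M. v s) = (LINT s|M. LINT r|M. u s * v r)" by simp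
  also have "\<dots> = integral\<^sup>L (M \<Otimes>\<^sub>M M) (\<lambda>(s,r). u s * v r)"
    by (rule integral_fst[OF prod])
  also have "\<dots> = integral\<^sup>L (M \<Otimes>\<^sub>M M) (\<lambda>x. (case x of (s,r) \<Rightarrow> if r \<le> s then u s * v r else 0) + (case x of (s,r) \<Rightarrow> if s < r then u s * v r else 0))"
    by (rule Bochner_Integration.integral_cong) auto
  also have "\<dots> = integral\<^sup>L (M \<Otimes>\<^sub>M M) (\<lambda>(s,r). if r \<le> s then u s * v r else 0)
     + integral\<^sup>L (M \<Otimes>\<^sub>M M) (\<lambda>(s,r). if s < r then u s * v r else 0)"
    by (rule Bochner_Integration.integral_add[OF i1 i2])
  also have "integral\<^sup>L (M \<Otimes>\<^sub>M M) (\<lambda>(s,r). if r \<le> s then u s * v r else 0) = (LINT s|M. LINT r|M. (if r \<le> s then u s * v r else 0))"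
    by (rule integral_fst[OF i1, symmetric])
  also have "\<dots> = (LINT s|M. u s * (LINT r|lebesgue_on {a..s}. v r))"
    by (rule Bochner_Integration.integral_cong) (auto simp: spM e1)
  also have "integral\<^sup>L (M \<Otimes>\<^sub>M M) (\<lambda>(s,r). if s < r then u s * v r else 0) = (LINT r|M. LINT s|M. (if s < r then u s * v r else 0))"
    by (rule integral_snd[OF i2, symmetric])
  also have "\<dots> = (LINT r|M. v r * (LINT s|lebesgue_on {a..r}. u s))"
    by (rule Bochner_Integration.integral_cong) (auto simp: spM e2)
  finally show "(LINT s|lebesgue_on {a..t}. u s) * (LINT s|lebesgue_on {a..t}. v s)
    = (LINT s|lebesgue_on {a..t}. u s * (LINT r|lebesgue_on {a..s}. v r))
    + (LINT s|lebesgue_on {a..t}. v s * (LINT r|lebesgue_on {a..s}. u r))" by (simp add: M_def)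
  have "integrable M (\<lambda>s. LINT r|M. (if r \<le> s then u s * v r else 0))"
    by (rule integrable_fst[OF i1])
  then have "integrable M (\<lambda>s. u s * (LINT r|lebesgue_on {a..s}. v r))"
    by (rule iffD1[OF Bochner_Integration.integrable_cong, rotated 2]) (auto simp: spM e1)
  then show "integrable (lebesgue_on {a..t}) (\<lambda>s. u s * (LINT r|lebesgue_on {a..s}. v r))" by (simp add: M_def)
qed

text \<open>Absolute continuity taken as being the indefinite integral of \<open>u\<close>, so that
  the product rule needs no differentiation almost everywhere.\<close>

definition ac_with_deriv :: "real \<Rightarrow> real \<Rightarrow> (real \<Rightarrow> real) \<Rightarrow> (real \<Rightarrow> real) \<Rightarrow> bool" where
  "ac_with_deriv a b c u \<longleftrightarrow> integrable (lebesgue_on {a..b}) u \<and>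
     (\<forall>t\<in>{a..b}. c t = c a + (LINT s|lebesgue_on {a..t}. u s))"

lemma ac_mult:
  assumes "ac_with_deriv a b c u" "ac_with_deriv a b d v" "a \<le> b"
  shows "ac_with_deriv a b (\<lambda>t. c t * d t) (\<lambda>t. u t * d t + c t * v t)"
proof -
  note iu = assms(1)[unfolded ac_with_deriv_def, THEN conjunct1] and iv = assms(2)[unfolded ac_with_deriv_def, THEN conjunct1]
  have c: "c t = c a + (LINT s|lebesgue_on {a..t}. u s)" and d: "d t = d a + (LINT s|lebesgue_on {a..t}. v s)"
    if "t \<in> {a..b}" for t using assms that unfolding ac_with_deriv_def by blast+
  have I1: "integrable (lebesgue_on {a..t}) (\<lambda>s. u s * d s)"
    and I2: "integrable (lebesgue_on {a..t}) (\<lambda>s. c s * v s)"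
    and E: "c t * d t = c a * d a + (LINT s|lebesgue_on {a..t}. u s * d s + c s * v s)"
    if t: "t \<in> {a..b}" for t
  proof -
    have u: "integrable (lebesgue_on {a..t}) u" and v: "integrable (lebesgue_on {a..t}) v"
      using t by (auto intro!: integrable_lebesgue_on_subset[OF iu] integrable_lebesgue_on_subset[OF iv])
    have at: "a \<le> t" using t by auto
    have J1: "integrable (lebesgue_on {a..t}) (\<lambda>s. u s * d a + u s * (LINT r|lebesgue_on {a..s}. v r))"
      using indefinite_integral_mult(2)[OF u v at] u by simp
    have J2: "integrable (lebesgue_on {a..t}) (\<lambda>s. c a * v s + v s * (LINT r|lebesgue_on {a..s}. u r))"
      using indefinite_integral_mult(2)[OF v u at] v by simp
    have X1: "s \<in> space (lebesgue_on {a..t}) \<Longrightarrow> u s * d s = u s * d a + u s * (LINT r|lebesgue_on {a..s}. v r)" for s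
      using t by (subst d) (auto simp: algebra_simps)
    have X2: "s \<in> space (lebesgue_on {a..t}) \<Longrightarrow> c s * v s = c a * v s + v s * (LINT r|lebesgue_on {a..s}. u r)" for s
      using t by (subst c) (auto simp: algebra_simps)
    show I1: "integrable (lebesgue_on {a..t}) (\<lambda>s. u s * d s)"
      using J1 by (subst Bochner_Integration.integrable_cong[OF refl X1])
    show I2: "integrable (lebesgue_on {a..t}) (\<lambda>s. c s * v s)"
      using J2 by (subst Bochner_Integration.integrable_cong[OF refl X2])
    have "(LINT s|lebesgue_on {a..t}. u s * d s + c s * v s) =
      (LINT s|lebesgue_on {a..t}. u s * d a + u s * (LINT r|lebesgue_on {a..s}. v r)) +
      (LINT s|lebesgue_on {a..t}. c a * v s + v s * (LINT r|lebesgue_on {a..s}. u r))"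
      unfolding Bochner_Integration.integral_add[OF I1 I2]
      by (intro arg_cong2[where f="(+)"] Bochner_Integration.integral_cong refl X1 X2)
    also have "\<dots> = (LINT s|lebesgue_on {a..t}. u s * d a) + (LINT s|lebesgue_on {a..t}. c a * v s)
       + (LINT s|lebesgue_on {a..t}. u s) * (LINT s|lebesgue_on {a..t}. v s)"
      unfolding indefinite_integral_mult(1)[OF u v at]
      using Bochner_Integration.integral_add[OF integrable_mult_left[OF u] indefinite_integral_mult(2)[OF u v at], of "d a"]
        Bochner_Integration.integral_add[OF integrable_mult_right[OF v] indefinite_integral_mult(2)[OF v u at], of "c a"]
      by linarith
    finally show "c t * d t = c a * d a + (LINT s|lebesgue_on {a..t}. u s * d s + c s * v s)"
      unfolding c[OF t] d[OF t] integral_mult_right_zero integral_mult_left_zero by (simp add: algebra_simps)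
  qed
  show ?thesis unfolding ac_with_deriv_def
  proof
    show "integrable (lebesgue_on {a..b}) (\<lambda>t. u t * d t + c t * v t)"
      by (rule Bochner_Integration.integrable_add[OF I1 I2]) (use \<open>a \<le> b\<close> in auto)
  qed (intro ballI E)
qed

lemma ac_D: "ac_with_deriv a b c u \<Longrightarrow> t \<in> {a..b} \<Longrightarrow> c t = c a + (LINT s|lebesgue_on {a..t}. u s)"
  and ac_int: "ac_with_deriv a b c u \<Longrightarrow> integrable (lebesgue_on {a..b}) u"
  unfolding ac_with_deriv_def by blast+

lemma ac_continuous:
  assumes "ac_with_deriv a b c u"
  shows "continuous_on {a..b} c"
proof -
  have "continuous_on {a..b} (\<lambda>x. c a + integral\<^sup>L (lebesgue_on {a..x}) u)"
    by (intro continuous_intros indefinite_integral_continuous_real ac_int[OF assms])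
  then show ?thesis by (rule continuous_on_eq) (rule ac_D[OF assms, symmetric])
qed

lemma ac_C1:
  assumes d: "\<And>t. (c has_real_derivative u t) (at t)" and "continuous_on UNIV u" "a \<le> b"
  shows "ac_with_deriv a b c u"
  unfolding ac_with_deriv_def
proof
  have cu: "continuous_on {a..t} u" for t by (rule continuous_on_subset[OF assms(2) subset_UNIV])
  show "integrable (lebesgue_on {a..b}) u"
    using continuous_imp_integrable_real[OF cu] .
  show "\<forall>t\<in>{a..b}. c t = c a + (LINT s|lebesgue_on {a..t}. u s)"
  proof
    fix t assume t: "t \<in> {a..b}"
    have "(u has_integral (c t - c a)) {a..t}"
      using t d by (intro fundamental_theorem_of_calculus)
        (auto simp: has_real_derivative_iff_has_vector_derivative[symmetric] intro: has_field_derivative_at_within)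
    moreover have "(LINT s|lebesgue_on {a..t}. u s) = integral {a..t} u"
      by (rule lebesgue_integral_eq_integral) (auto intro: continuous_imp_integrable_real[OF cu])
    ultimately show "c t = c a + (LINT s|lebesgue_on {a..t}. u s)" by (simp add: integral_unique)
  qed
qed

lemma borel_measurable_continuous_on_lebesgue_on:
  fixes f :: "real \<Rightarrow> 'a::topological_space"
  assumes "continuous_on {a..b} f"
  shows "f \<in> borel_measurable (lebesgue_on {a..b})"
proof -
  have "f \<in> borel_measurable (restrict_space borel {a..b})"
    by (rule borel_measurable_continuous_on_restrict[OF assms])
  moreover have "(\<lambda>x. x) \<in> measurable (lebesgue_on {a..b}) (restrict_space borel {a..b})"
    by (intro measurable_restrict_space3 measurable_completion) auto
  ultimately show ?thesis using measurable_compose by blast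
qed

lemma integrable_mult_continuous:
  fixes k f :: "real \<Rightarrow> real"
  assumes k: "integrable (lebesgue_on {a..b}) k" and f: "continuous_on {a..b} f"
  shows "integrable (lebesgue_on {a..b}) (\<lambda>t. k t * f t)"
proof -
  obtain B where B: "\<And>t. t \<in> {a..b} \<Longrightarrow> \<bar>f t\<bar> \<le> B"
    using compact_imp_bounded[OF compact_continuous_image[OF f compact_Icc]]
    unfolding bounded_iff by (metis imageI real_norm_def)
  have iB: "integrable (lebesgue_on {a..b}) (\<lambda>t. B * k t)" using k by simp
  show ?thesis
  proof (rule Bochner_Integration.integrable_bound[OF iB])
    show "(\<lambda>t. k t * f t) \<in> borel_measurable (lebesgue_on {a..b})"
      by (intro borel_measurable_times borel_measurable_integrable k borel_measurable_continuous_on_lebesgue_on f)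
    show "AE t in lebesgue_on {a..b}. norm (k t * f t) \<le> norm (B * k t)"
    proof (rule AE_I2)
      fix t assume "t \<in> space (lebesgue_on {a..b})"
      then have "\<bar>f t\<bar> \<le> B" using B by simp
      then have "\<bar>k t\<bar> * \<bar>f t\<bar> \<le> \<bar>k t\<bar> * \<bar>B\<bar>" by (intro mult_left_mono) auto
      then show "norm (k t * f t) \<le> norm (B * k t)" by (simp add: abs_mult mult.commute)
    qed
  qed
qed

text \<open>The weight \<open>k\<close> is only integrable, so a short interval does not make
  \<open>k\<close> small, but it makes the increment of its primitive small, uniformly by uniform
  continuity. Over a step on which the primitive grows by less than 1/2, the maximum of \<phi> is at
  most half of itself, hence zero. Finitely many steps cover the interval.\<close>

lemma gronwall_zero:
  fixes k \<phi> :: "real \<Rightarrow> real"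
  assumes k: "integrable (lebesgue_on {a..b}) k" and k0: "\<And>t. 0 \<le> k t"
    and \<phi>: "continuous_on {a..b} \<phi>" and \<phi>0: "\<And>t. t \<in> {a..b} \<Longrightarrow> 0 \<le> \<phi> t"
    and le: "\<And>t. t \<in> {a..b} \<Longrightarrow> \<phi> t \<le> (LINT s|lebesgue_on {a..t}. k s * \<phi> s)"
    and t: "t \<in> {a..b}"
  shows "\<phi> t = 0"
proof -
  define K where "K t = (LINT s|lebesgue_on {a..t}. k s)" for t
  have "continuous_on {a..b} K" unfolding K_def by (rule indefinite_integral_continuous_real[OF k])
  then have "uniformly_continuous_on {a..b} K" by (rule compact_uniformly_continuous) auto
  then obtain h where h: "h > 0" "\<And>s t. s \<in> {a..b} \<Longrightarrow> t \<in> {a..b} \<Longrightarrow> dist s t < h \<Longrightarrow> dist (K s) (K t) < 1/2"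
    unfolding uniformly_continuous_on_def by (metis zero_less_divide_1_iff zero_less_numeral)
  have k\<phi>: "integrable (lebesgue_on {a..b}) (\<lambda>t. k t * \<phi> t)" by (rule integrable_mult_continuous[OF k \<phi>])
  \<comment> \<open>Steps have length \<open>h/2\<close> because the modulus of continuity asks for
    a distance strictly below \<open>h\<close>.\<close>
  have main: "\<forall>t\<in>{a..b}. t \<le> a + real n * (h/2) \<longrightarrow> \<phi> t = 0" for n
  proof (induction n)
    case 0
    show ?case
    proof (intro ballI impI)
      fix t assume t: "t \<in> {a..b}" "t \<le> a + real 0 * (h/2)"
      then have "{a..t} = {a}" "t = a" by auto
      moreover have "(LINT s|lebesgue_on {a}. k s * \<phi> s) = 0"
        by (rule integral_eq_zero_null_sets) simp
      ultimately show "\<phi> t = 0" using le[OF t(1)] \<phi>0[OF t(1)] by simp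
    qed
  next
    case (Suc n)
    define s where "s = a + real n * (h/2)"
    have as: "a \<le> s" using h by (simp add: s_def)
    show ?case
    proof (cases "s < b")
      case False
      then show ?thesis using Suc by (auto simp: s_def)
    next
      case True
      define J where "J = {s..min b (s + h/2)}"
      have J: "compact J" "J \<noteq> {}" "J \<subseteq> {a..b}" using True h as by (auto simp: J_def)
      obtain t1 where t1: "t1 \<in> J" "\<And>t. t \<in> J \<Longrightarrow> \<phi> t \<le> \<phi> t1"
        using continuous_attains_sup[OF J(1,2) continuous_on_subset[OF \<phi> J(3)]] by blast
      have t1ab: "t1 \<in> {a..b}" "s \<le> t1" "t1 \<le> s + h/2" using t1 J by (auto simp: J_def)
      have i1: "integrable (lebesgue_on {a..t1}) (\<lambda>t. k t * \<phi> t)" "integrable (lebesgue_on {s..t1}) (\<lambda>t. k t * \<phi> t)"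
        "integrable (lebesgue_on {s..t1}) k" "integrable (lebesgue_on {a..t1}) k"
        using t1ab as by (auto intro!: integrable_lebesgue_on_subset[OF k\<phi>] integrable_lebesgue_on_subset[OF k])
      have "\<phi> t1 \<le> (LINT s|lebesgue_on {a..t1}. k s * \<phi> s)" using le t1ab by auto
      also have "\<dots> = (LINT s|lebesgue_on {a..s}. k s * \<phi> s) + (LINT s|lebesgue_on {s..t1}. k s * \<phi> s)"
        using i1 as t1ab by (intro integral_lebesgue_on_combine)
      also have "(LINT s|lebesgue_on {a..s}. k s * \<phi> s) = (LINT s|lebesgue_on {a..s}. 0)"
        by (rule Bochner_Integration.integral_cong) (use Suc True in \<open>auto simp: s_def\<close>)
      also have "(LINT s|lebesgue_on {s..t1}. k s * \<phi> s) \<le> (LINT s|lebesgue_on {s..t1}. k s * \<phi> t1)"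
        using i1 t1ab t1(2) k0 by (intro integral_mono) (auto intro!: mult_left_mono simp: J_def)
      also have "\<dots> = (K t1 - K s) * \<phi> t1"
        using integral_lebesgue_on_combine[OF i1(4) as t1ab(2)] by (simp add: K_def)
      finally have *: "\<phi> t1 \<le> (K t1 - K s) * \<phi> t1" by simp
      have "dist (K t1) (K s) < 1/2" using h t1ab as True by (intro h(2)) (auto simp: dist_real_def)
      then have "(K t1 - K s) * \<phi> t1 \<le> (1/2) * \<phi> t1"
        using \<phi>0[OF t1ab(1)] unfolding dist_real_def by (intro mult_right_mono) linarith+
      with * have "\<phi> t1 \<le> 0" by simp
      show ?thesis
      proof (intro ballI impI)
        fix t assume t: "t \<in> {a..b}" "t \<le> a + real (Suc n) * (h/2)"
        show "\<phi> t = 0"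
        proof (cases "t \<le> s")
          case True then show ?thesis using Suc t by (auto simp: s_def)
        next
          case False
          then have "t \<in> J" using t by (auto simp: J_def s_def field_simps)
          from t1(2)[OF this] \<open>\<phi> t1 \<le> 0\<close> \<phi>0[OF t(1)] show ?thesis by simp
        qed
      qed
    qed
  qed
  obtain n where "(b - a) / (h/2) < real n" using reals_Archimedean2 by blast
  then have "b \<le> a + real n * (h/2)" using h by (simp add: field_simps)
  then show ?thesis using main[of n] t by auto
qed

section \<open>Expansion in eigenfunctions\<close>

text \<open>By Pythagoras the squared distance of two partial sums is the difference of the partial
  sums of squared norms, and these form a bounded monotone, hence Cauchy, real sequence.\<close>

lemma orthogonal_series_convergent:
  fixes b :: "nat \<Rightarrow> 'a::{real_inner,banach}"
  assumes orth: "\<And>i j. 1 \<le> i \<Longrightarrow> 1 \<le> j \<Longrightarrow> i \<noteq> j \<Longrightarrow> b i \<bullet> b j = 0"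
    and bd: "\<And>m. (\<Sum>i=1..m. (norm (b i))\<^sup>2) \<le> B"
  shows "convergent (\<lambda>m. \<Sum>i=1..m. b i)"
proof -
  define T where "T m = (\<Sum>i=1..m. (norm (b i))\<^sup>2)" for m
  have diff: "(norm ((\<Sum>i=1..n. b i) - (\<Sum>i=1..m. b i)))\<^sup>2 = T n - T m" if "m \<le> n" for m n
  proof -
    have eq: "{1..n} = {1..m} \<union> {m<..n}" using that by auto
    have "(\<Sum>i=1..n. b i) - (\<Sum>i=1..m. b i) = (\<Sum>i\<in>{m<..n}. b i)" "T n - T m = (\<Sum>i\<in>{m<..n}. (norm (b i))\<^sup>2)"
      unfolding T_def eq by (subst sum.union_disjoint; auto)+
    moreover have "(norm (\<Sum>i\<in>{m<..n}. b i))\<^sup>2 = (\<Sum>i\<in>{m<..n}. (norm (b i))\<^sup>2)"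
      by (intro norm_sum_Pythagorean) (auto simp: pairwise_def orthogonal_def intro!: orth)
    ultimately show ?thesis by simp
  qed
  have "mono T" unfolding T_def by (intro monoI sum_mono2) auto
  then have "convergent T"
    using bd by (intro Bseq_mono_convergent BseqI'[of _ B]) (auto simp: T_def sum_nonneg mono_def)
  then have CT: "Cauchy T" by (rule convergent_Cauchy)
  have "Cauchy (\<lambda>m. \<Sum>i=1..m. b i)"
  proof (rule CauchyI')
    fix r :: real assume r: "r > 0"
    obtain M where M: "\<And>m n. m \<ge> M \<Longrightarrow> n \<ge> M \<Longrightarrow> dist (T m) (T n) < r\<^sup>2"
      using metric_CauchyD[OF CT, of "r\<^sup>2"] r by auto
    show "\<exists>M. \<forall>m\<ge>M. \<forall>n>m. dist (\<Sum>i=1..m. b i) (\<Sum>i=1..n. b i) < r"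
    proof (intro exI allI impI)
      fix m n assume mn: "M \<le> m" "m < n"
      have "(dist (\<Sum>i=1..m. b i) (\<Sum>i=1..n. b i))\<^sup>2 = T n - T m"
        using diff[of m n] mn by (subst dist_commute) (simp add: dist_norm)
      also have "\<dots> < r\<^sup>2" using M[of m n] mn by (simp add: dist_real_def)
      finally show "dist (\<Sum>i=1..m. b i) (\<Sum>i=1..n. b i) < r" using r by (simp add: power_less_imp_less_base)
    qed
  qed
  then show ?thesis by (simp add: Cauchy_convergent_iff)
qed

lemma inner_dense_eq_0:
  fixes x :: "'a::real_inner"
  assumes "closure S = UNIV" and "\<And>y. y \<in> S \<Longrightarrow> x \<bullet> y = 0"
  shows "x = 0"
proof -
  have "closed {y. x \<bullet> y = 0}" by (intro closed_Collect_eq continuous_intros)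
  then have "closure S \<subseteq> {y. x \<bullet> y = 0}" by (rule closure_minimal[rotated]) (use assms in auto)
  then have "x \<in> {y. x \<bullet> y = 0}" using assms(1) by blast
  then show ?thesis by simp
qed

section \<open>The operator, its domain and its eigenbasis\<close>

locale spectral =
  fixes \<iota> :: "'v::{real_inner,banach,second_countable_topology} \<Rightarrow>\<^sub>L 'h::{real_inner,banach,second_countable_topology}"
    and A :: "'v \<Rightarrow>\<^sub>L ('v \<Rightarrow>\<^sub>L real)"
    and \<alpha> :: "nat \<Rightarrow> real" and e :: "nat \<Rightarrow> 'v"
  assumes A_iso: "symmetric_isomorphism A"
    and V_inner: "\<forall>y z. y \<bullet> z = blinfun_apply (blinfun_apply A y) z"
    and incl: "compact_dense_inclusion \<iota>"
    and eig: "eigenbasis \<iota> A \<alpha> e"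
begin

abbreviation "D \<equiv> DA \<iota> A"
abbreviation "L \<equiv> AH \<iota> A"
text \<open>Coordinates in H. The squared norms of H, V and D(A) are sums of squared coordinates
  with weights 1, \<alpha> i and the square of \<alpha> i, so comparing these norms amounts to
  comparing eigenvalues.\<close>

definition "coord u i = \<iota> u \<bullet> \<iota> (e i)"

lemma iota_inj: "\<iota> u = \<iota> v \<Longrightarrow> u = v"
  using incl by (auto simp: compact_dense_inclusion_def dest: injD)

lemma iota_dense: "(\<And>z. x \<bullet> \<iota> z = 0) \<Longrightarrow> x = 0"
  using incl by (intro inner_dense_eq_0[of "range \<iota>"]) (auto simp: compact_dense_inclusion_def)

lemma L_eqI: "(\<And>z. u \<bullet> z = h \<bullet> \<iota> z) \<Longrightarrow> L u = h"
  unfolding AH_def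
proof (rule the_equality)
  assume u: "\<And>z. u \<bullet> z = h \<bullet> \<iota> z"
  then show "\<forall>z. blinfun_apply (blinfun_apply A u) z = h \<bullet> \<iota> z" using V_inner by simp
  fix h' assume "\<forall>z. blinfun_apply (blinfun_apply A u) z = h' \<bullet> \<iota> z"
  then have "(h' - h) \<bullet> \<iota> z = 0" for z using u V_inner by (simp add: inner_diff_left)
  then show "h' = h" using iota_dense[of "h' - h"] by simp
qed

lemma D_I: "(\<And>z. u \<bullet> z = h \<bullet> \<iota> z) \<Longrightarrow> u \<in> D"
  using V_inner unfolding DA_def by auto

lemma inner_L: assumes "u \<in> D" shows "u \<bullet> z = L u \<bullet> \<iota> z"
proof -
  obtain h where h: "\<And>z. u \<bullet> z = h \<bullet> \<iota> z" using assms V_inner unfolding DA_def by auto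
  from L_eqI[OF this] h show ?thesis by simp
qed

lemma D_0 [simp]: "0 \<in> D" and L_0 [simp]: "L 0 = 0"
  by (rule D_I[of _ 0], simp, rule L_eqI, simp)

lemma D_add: "u \<in> D \<Longrightarrow> v \<in> D \<Longrightarrow> u + v \<in> D" and L_add: "u \<in> D \<Longrightarrow> v \<in> D \<Longrightarrow> L (u + v) = L u + L v"
  by (rule D_I[of _ "L u + L v"] L_eqI; simp add: inner_add_left inner_L)+

lemma D_diff: "u \<in> D \<Longrightarrow> v \<in> D \<Longrightarrow> u - v \<in> D" and L_diff: "u \<in> D \<Longrightarrow> v \<in> D \<Longrightarrow> L (u - v) = L u - L v"
  by (rule D_I[of _ "L u - L v"] L_eqI; simp add: inner_diff_left inner_L)+

lemma D_scaleR: "u \<in> D \<Longrightarrow> c *\<^sub>R u \<in> D" and L_scaleR: "u \<in> D \<Longrightarrow> L (c *\<^sub>R u) = c *\<^sub>R L u"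
  by (rule D_I[of _ "c *\<^sub>R L u"] L_eqI; simp add: inner_L)+

lemma D_sum: "(\<And>i. i \<in> I \<Longrightarrow> f i \<in> D) \<Longrightarrow> sum f I \<in> D"
  and L_sum: "(\<And>i. i \<in> I \<Longrightarrow> f i \<in> D) \<Longrightarrow> L (sum f I) = (\<Sum>i\<in>I. L (f i))"
proof -
  assume f: "\<And>i. i \<in> I \<Longrightarrow> f i \<in> D"
  have "sum f I \<bullet> z = (\<Sum>i\<in>I. L (f i)) \<bullet> \<iota> z" for z
    using f by (simp add: inner_sum_left inner_L)
  then show "sum f I \<in> D" "L (sum f I) = (\<Sum>i\<in>I. L (f i))" by (blast intro: D_I L_eqI)+
qed

text \<open>The functional given by \<open>h\<close> belongs to V', so surjectivity of
  \<open>A\<close> onto V' produces a preimage; it lies in D(A) because the functional comes from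
  H.\<close>

lemma L_surj: "\<exists>u\<in>D. L u = h"
proof -
  have bl: "bounded_linear (\<lambda>z. h \<bullet> \<iota> z)" by (intro bounded_linear_intros)
  have "surj (blinfun_apply A)" using A_iso by (simp add: symmetric_isomorphism_def bij_def)
  then obtain u where "Blinfun (\<lambda>z. h \<bullet> \<iota> z) = A u" by (meson surjD)
  then have "u \<bullet> z = h \<bullet> \<iota> z" for z using V_inner bounded_linear_Blinfun_apply[OF bl] by metis
  then show ?thesis using D_I L_eqI by blast
qed

lemma alpha_pos: "1 \<le> i \<Longrightarrow> 0 < \<alpha> i"
proof -
  assume i: "1 \<le> i"
  have "0 < \<alpha> 1" "\<alpha> 1 \<le> \<alpha> i" using eig i by (auto simp: eigenbasis_def mono_on_def)
  then show ?thesis by simp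
qed

lemma alpha_mono: "1 \<le> i \<Longrightarrow> i \<le> j \<Longrightarrow> \<alpha> i \<le> \<alpha> j"
  using eig by (auto simp: eigenbasis_def mono_on_def)

lemma e_D: "1 \<le> i \<Longrightarrow> e i \<in> D" and L_e: "1 \<le> i \<Longrightarrow> L (e i) = \<alpha> i *\<^sub>R \<iota> (e i)"
  and e_orth: "1 \<le> i \<Longrightarrow> 1 \<le> j \<Longrightarrow> \<iota> (e i) \<bullet> \<iota> (e j) = (if i = j then 1 else 0)"
  using eig by (auto simp: eigenbasis_def)

lemma e_complete:
  assumes "\<And>i. 1 \<le> i \<Longrightarrow> x \<bullet> \<iota> (e i) = 0" shows "x = 0"
proof (rule inner_dense_eq_0)
  show "closure (span ((\<lambda>i. \<iota> (e i)) ` {1..})) = UNIV" using eig by (simp add: eigenbasis_def)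
  fix y assume "y \<in> span ((\<lambda>i. \<iota> (e i)) ` {1..})"
  then show "x \<bullet> y = 0"
    by (induction rule: span_induct_alt) (use assms in \<open>auto simp: inner_add_right\<close>)
qed

lemma co_eqI: assumes "\<And>i. 1 \<le> i \<Longrightarrow> coord u i = coord v i" shows "u = v"
proof -
  have "\<iota> u - \<iota> v = 0" by (rule e_complete) (use assms in \<open>simp add: coord_def inner_diff_left\<close>)
  then show ?thesis using iota_inj by simp
qed

lemma inner_e: "1 \<le> i \<Longrightarrow> u \<bullet> e i = \<alpha> i * coord u i"
  by (subst inner_commute, subst inner_L) (auto simp: e_D L_e coord_def inner_commute)

lemma L_inner_e: "u \<in> D \<Longrightarrow> 1 \<le> i \<Longrightarrow> L u \<bullet> \<iota> (e i) = \<alpha> i * coord u i"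
  using inner_L[of u "e i"] inner_e by simp

lemma co_diff: "coord (u - v) i = coord u i - coord v i"
  by (simp add: coord_def blinfun.diff_right inner_diff_left)

lemma e_inner: "1 \<le> i \<Longrightarrow> 1 \<le> j \<Longrightarrow> e i \<bullet> e j = (if i = j then \<alpha> i else 0)"
  by (simp add: inner_e coord_def e_orth)

lemma norm_scaleR_e: "1 \<le> i \<Longrightarrow> (norm (c *\<^sub>R e i))\<^sup>2 = \<alpha> i * c\<^sup>2"
  unfolding power2_norm_eq_inner by (simp add: e_inner power2_eq_square)

lemma norm_scaleR_iota_e: "1 \<le> i \<Longrightarrow> (norm (c *\<^sub>R \<iota> (e i)))\<^sup>2 = c\<^sup>2"
  unfolding power2_norm_eq_inner by (simp add: e_orth power2_eq_square)

section \<open>Finite sums of eigenfunctions\<close>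

context
  fixes I :: "nat set" and c :: "nat \<Rightarrow> real"
  assumes I: "I \<subseteq> {1..}" and fin: "finite I"
begin

lemma esum_D: "(\<Sum>i\<in>I. c i *\<^sub>R e i) \<in> D"
  using I by (intro D_sum D_scaleR e_D) auto

lemma L_esum: "L (\<Sum>i\<in>I. c i *\<^sub>R e i) = (\<Sum>i\<in>I. (\<alpha> i * c i) *\<^sub>R \<iota> (e i))"
proof -
  have 1: "1 \<le> i" if "i \<in> I" for i using I that by auto
  then have "L (\<Sum>i\<in>I. c i *\<^sub>R e i) = (\<Sum>i\<in>I. L (c i *\<^sub>R e i))" by (intro L_sum D_scaleR e_D)
  also have "\<dots> = (\<Sum>i\<in>I. (\<alpha> i * c i) *\<^sub>R \<iota> (e i))"
    using 1 by (intro sum.cong refl) (auto simp: L_scaleR e_D L_e)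
  finally show ?thesis .
qed

lemma norm_esum: "(norm (\<Sum>i\<in>I. c i *\<^sub>R e i))\<^sup>2 = (\<Sum>i\<in>I. \<alpha> i * (c i)\<^sup>2)"
proof -
  have "(norm (\<Sum>i\<in>I. c i *\<^sub>R e i))\<^sup>2 = (\<Sum>i\<in>I. (norm (c i *\<^sub>R e i))\<^sup>2)"
    using I by (intro norm_sum_Pythagorean fin) (auto simp: pairwise_def orthogonal_def subset_eq e_inner)
  also have "\<dots> = (\<Sum>i\<in>I. \<alpha> i * (c i)\<^sup>2)"
    using I by (intro sum.cong) (auto simp: norm_scaleR_e subset_eq simp del: norm_scaleR)
  finally show ?thesis .
qed

lemma norm_hsum: "(norm (\<Sum>i\<in>I. c i *\<^sub>R \<iota> (e i)))\<^sup>2 = (\<Sum>i\<in>I. (c i)\<^sup>2)"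
proof -
  have "(norm (\<Sum>i\<in>I. c i *\<^sub>R \<iota> (e i)))\<^sup>2 = (\<Sum>i\<in>I. (norm (c i *\<^sub>R \<iota> (e i)))\<^sup>2)"
    using I by (intro norm_sum_Pythagorean fin) (auto simp: pairwise_def orthogonal_def subset_eq e_orth)
  also have "\<dots> = (\<Sum>i\<in>I. (c i)\<^sup>2)"
    using I by (intro sum.cong) (auto simp: norm_scaleR_iota_e subset_eq simp del: norm_scaleR)
  finally show ?thesis .
qed

lemma hsum_inner: "1 \<le> j \<Longrightarrow> (\<Sum>i\<in>I. c i *\<^sub>R \<iota> (e i)) \<bullet> \<iota> (e j) = (if j \<in> I then c j else 0)"
proof -
  assume j: "1 \<le> j"
  have "(\<Sum>i\<in>I. c i *\<^sub>R \<iota> (e i)) \<bullet> \<iota> (e j) = (\<Sum>i\<in>I. if i = j then c i else 0)"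
    using I j by (auto simp: inner_sum_left e_orth subset_eq intro!: sum.cong)
  also have "\<dots> = (if j \<in> I then c j else 0)" using fin by simp
  finally show ?thesis .
qed

lemma co_esum: "1 \<le> j \<Longrightarrow> coord (\<Sum>i\<in>I. c i *\<^sub>R e i) j = (if j \<in> I then c j else 0)"
  using hsum_inner[of j] by (simp add: coord_def blinfun.sum_right blinfun.scaleR_right)

lemma inner_esum: "u \<bullet> (\<Sum>i\<in>I. c i *\<^sub>R e i) = (\<Sum>i\<in>I. \<alpha> i * coord u i * c i)"
  using I by (auto simp: inner_sum_right inner_e subset_eq intro!: sum.cong)

end

text \<open>One spectral projection in two copies, on the type of V and on that of H. It is
  orthogonal for both scalar products and commutes with \<open>L\<close> (see \<open>L_PV\<close>),
  so truncation increases none of the norms.\<close>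

definition "PV m u = (\<Sum>i=1..m. coord u i *\<^sub>R e i)"
definition "PH m h = (\<Sum>i=1..m. (h \<bullet> \<iota> (e i)) *\<^sub>R \<iota> (e i))"

lemma atLeastAtMost_subset_atLeast: "{1..m} \<subseteq> {1..}" for m :: nat by auto

lemma PV_D: "PV m u \<in> D" unfolding PV_def by (rule esum_D[OF atLeastAtMost_subset_atLeast]) simp

lemma norm_PV: "(norm (PV m u))\<^sup>2 = (\<Sum>i=1..m. \<alpha> i * (coord u i)\<^sup>2)"
  unfolding PV_def by (rule norm_esum[OF atLeastAtMost_subset_atLeast]) simp

lemma norm_PH: "(norm (PH m h))\<^sup>2 = (\<Sum>i=1..m. (h \<bullet> \<iota> (e i))\<^sup>2)"
  unfolding PH_def by (rule norm_hsum[OF atLeastAtMost_subset_atLeast]) simp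

lemma inner_PV: "u \<bullet> PV m u = (norm (PV m u))\<^sup>2"
  unfolding norm_PV unfolding PV_def by (subst inner_esum[OF atLeastAtMost_subset_atLeast]) (auto simp: power2_eq_square intro!: sum.cong)

lemma inner_PH: "h \<bullet> PH m h = (norm (PH m h))\<^sup>2"
  unfolding norm_PH unfolding PH_def by (auto simp: inner_sum_right power2_eq_square intro!: sum.cong)

lemma norm_PV_split: "(norm u)\<^sup>2 = (norm (PV m u))\<^sup>2 + (norm (u - PV m u))\<^sup>2"
  using inner_PV[of u m] unfolding power2_norm_eq_inner by (simp add: inner_diff_left inner_diff_right inner_commute)

lemma norm_PH_split: "(norm h)\<^sup>2 = (norm (PH m h))\<^sup>2 + (norm (h - PH m h))\<^sup>2"
  using inner_PH[of h m] unfolding power2_norm_eq_inner by (simp add: inner_diff_left inner_diff_right inner_commute)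

lemma norm_PV_le: "norm (PV m u) \<le> norm u"
  by (rule power2_le_imp_le) (use norm_PV_split[of u m] in auto)

lemma norm_PH_le: "norm (PH m h) \<le> norm h"
  by (rule power2_le_imp_le) (use norm_PH_split[of h m] in auto)

lemma L_PV: "u \<in> D \<Longrightarrow> L (PV m u) = PH m (L u)"
  unfolding PV_def PH_def by (subst L_esum[OF atLeastAtMost_subset_atLeast]) (auto simp: L_inner_e intro!: sum.cong)

lemma co_PV: "1 \<le> i \<Longrightarrow> coord (PV m u) i = (if i \<le> m then coord u i else 0)"
  unfolding PV_def by (subst co_esum[OF atLeastAtMost_subset_atLeast]) auto

lemma esum_convergent:
  assumes "\<And>m. (\<Sum>i=1..m. \<alpha> i * (c i)\<^sup>2) \<le> B"
  shows "\<exists>u. (\<lambda>m. \<Sum>i=1..m. c i *\<^sub>R e i) \<longlonglongrightarrow> u \<and> (\<forall>i\<ge>1. coord u i = c i)"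
proof -
  have "convergent (\<lambda>m. \<Sum>i=1..m. c i *\<^sub>R e i)"
  proof (rule orthogonal_series_convergent)
    fix m
    have "(\<Sum>i=1..m. (norm (c i *\<^sub>R e i))\<^sup>2) = (\<Sum>i=1..m. \<alpha> i * (c i)\<^sup>2)"
      by (intro sum.cong) (auto simp: norm_scaleR_e simp del: norm_scaleR)
    with assms show "(\<Sum>i=1..m. (norm (c i *\<^sub>R e i))\<^sup>2) \<le> B" by simp
  qed (simp add: e_inner)
  then obtain u where u: "(\<lambda>m. \<Sum>i=1..m. c i *\<^sub>R e i) \<longlonglongrightarrow> u" by (auto simp: convergent_def)
  have "coord u i = c i" if i: "1 \<le> i" for i
  proof -
    have "(\<lambda>m. coord (\<Sum>i=1..m. c i *\<^sub>R e i) i) \<longlonglongrightarrow> coord u i"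
      unfolding coord_def by (intro tendsto_intros u)
    moreover have "\<forall>\<^sub>F m in sequentially. coord (\<Sum>i=1..m. c i *\<^sub>R e i) i = c i"
      using eventually_ge_at_top[of i] by eventually_elim (subst co_esum[OF atLeastAtMost_subset_atLeast], use i in auto)
    ultimately show ?thesis by (rule LIMSEQ_unique[OF _ tendsto_eventually])
  qed
  with u show ?thesis by blast
qed

lemma hsum_convergent:
  assumes "\<And>m. (\<Sum>i=1..m. (c i)\<^sup>2) \<le> B"
  shows "\<exists>h. (\<lambda>m. \<Sum>i=1..m. c i *\<^sub>R \<iota> (e i)) \<longlonglongrightarrow> h \<and> (\<forall>i\<ge>1. h \<bullet> \<iota> (e i) = c i)"
proof -
  have "convergent (\<lambda>m. \<Sum>i=1..m. c i *\<^sub>R \<iota> (e i))"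
  proof (rule orthogonal_series_convergent)
    fix m
    have "(\<Sum>i=1..m. (norm (c i *\<^sub>R \<iota> (e i)))\<^sup>2) = (\<Sum>i=1..m. (c i)\<^sup>2)"
      by (intro sum.cong) (auto simp: norm_scaleR_iota_e simp del: norm_scaleR)
    with assms show "(\<Sum>i=1..m. (norm (c i *\<^sub>R \<iota> (e i)))\<^sup>2) \<le> B" by simp
  qed (simp add: e_orth)
  then obtain h where u: "(\<lambda>m. \<Sum>i=1..m. c i *\<^sub>R \<iota> (e i)) \<longlonglongrightarrow> h" by (auto simp: convergent_def)
  have "h \<bullet> \<iota> (e i) = c i" if i: "1 \<le> i" for i
  proof -
    have "(\<lambda>m. (\<Sum>i=1..m. c i *\<^sub>R \<iota> (e i)) \<bullet> \<iota> (e i)) \<longlonglongrightarrow> h \<bullet> \<iota> (e i)"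
      by (intro tendsto_intros u)
    moreover have "\<forall>\<^sub>F m in sequentially. (\<Sum>i=1..m. c i *\<^sub>R \<iota> (e i)) \<bullet> \<iota> (e i) = c i"
      using eventually_ge_at_top[of i] by eventually_elim (subst hsum_inner[OF atLeastAtMost_subset_atLeast], use i in auto)
    ultimately show ?thesis by (rule LIMSEQ_unique[OF _ tendsto_eventually])
  qed
  with u show ?thesis by blast
qed

text \<open>Bessel's inequality makes the series converge in V; its limit has the coordinates of
  \<open>u\<close>, and completeness of the eigenbasis in H identifies it with
  \<open>u\<close>.\<close>

lemma PV_tendsto: "(\<lambda>m. PV m u) \<longlonglongrightarrow> u"
proof -
  have "(\<Sum>i=1..m. \<alpha> i * (coord u i)\<^sup>2) \<le> (norm u)\<^sup>2" for m
    using norm_PV[of m u] power_mono[OF norm_PV_le[of m u], of 2] by simp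
  from esum_convergent[OF this] obtain v where v: "(\<lambda>m. PV m u) \<longlonglongrightarrow> v" "\<And>i. 1 \<le> i \<Longrightarrow> coord v i = coord u i"
    by (auto simp: PV_def)
  with co_eqI[of v u] show ?thesis by simp
qed

lemma PH_tendsto: "(\<lambda>m. PH m h) \<longlonglongrightarrow> h"
proof -
  have "(\<Sum>i=1..m. (h \<bullet> \<iota> (e i))\<^sup>2) \<le> (norm h)\<^sup>2" for m
    using norm_PH[of m h] power_mono[OF norm_PH_le[of m h], of 2] by simp
  from hsum_convergent[OF this] obtain g where g: "(\<lambda>m. PH m h) \<longlonglongrightarrow> g" "\<And>i. 1 \<le> i \<Longrightarrow> g \<bullet> \<iota> (e i) = h \<bullet> \<iota> (e i)"
    by (auto simp: PH_def)
  have "g - h = 0" by (rule e_complete) (use g in \<open>simp add: inner_diff_left\<close>)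
  with g show ?thesis by simp
qed

text \<open>\<open>L\<close> is closed: the bound makes the truncations \<open>L (PV m u)\<close>
  converge in H to some \<open>h\<close>, and the limit of the weak identities for
  \<open>PV m u\<close> is the identity that puts \<open>u\<close> into D(A).\<close>

lemma D_criterion:
  assumes "\<And>m. (\<Sum>i=1..m. (\<alpha> i * coord u i)\<^sup>2) \<le> B"
  shows "u \<in> D" "(\<lambda>m. L (PV m u)) \<longlonglongrightarrow> L u"
proof -
  obtain h where h: "(\<lambda>m. \<Sum>i=1..m. (\<alpha> i * coord u i) *\<^sub>R \<iota> (e i)) \<longlonglongrightarrow> h" using hsum_convergent[OF assms] by blast
  have LP: "L (PV m u) = (\<Sum>i=1..m. (\<alpha> i * coord u i) *\<^sub>R \<iota> (e i))" for m
    unfolding PV_def by (rule L_esum[OF atLeastAtMost_subset_atLeast]) simp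
  have "u \<bullet> z = h \<bullet> \<iota> z" for z
  proof (rule LIMSEQ_unique)
    show "(\<lambda>m. PV m u \<bullet> z) \<longlonglongrightarrow> u \<bullet> z" by (intro tendsto_intros PV_tendsto)
    have "(\<lambda>m. L (PV m u) \<bullet> \<iota> z) \<longlonglongrightarrow> h \<bullet> \<iota> z" unfolding LP by (intro tendsto_intros h)
    then show "(\<lambda>m. PV m u \<bullet> z) \<longlonglongrightarrow> h \<bullet> \<iota> z" by (simp add: inner_L PV_D)
  qed
  then show "u \<in> D" "(\<lambda>m. L (PV m u)) \<longlonglongrightarrow> L u"
    using h by (auto intro: D_I simp: L_eqI LP)
qed

lemma norm_sq_tendsto: "(\<lambda>m. \<Sum>i=1..m. \<alpha> i * (coord u i)\<^sup>2) \<longlonglongrightarrow> (norm u)\<^sup>2"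
  unfolding norm_PV[symmetric] by (intro tendsto_intros PV_tendsto)

lemma norm_L_sq_tendsto: "u \<in> D \<Longrightarrow> (\<lambda>m. \<Sum>i=1..m. (\<alpha> i * coord u i)\<^sup>2) \<longlonglongrightarrow> (norm (L u))\<^sup>2"
proof -
  assume u: "u \<in> D"
  have "(\<lambda>m. (norm (PH m (L u)))\<^sup>2) \<longlonglongrightarrow> (norm (L u))\<^sup>2" by (intro tendsto_intros PH_tendsto)
  moreover have "(norm (PH m (L u)))\<^sup>2 = (\<Sum>i=1..m. (\<alpha> i * coord u i)\<^sup>2)" for m
    unfolding norm_PH using u by (auto simp: L_inner_e intro!: sum.cong)
  ultimately show ?thesis by simp
qed

text \<open>Only modes whose eigenvalue is at least \<alpha> (Suc M) contribute, and each summand of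
  the D(A) norm is \<alpha> i times that of the V norm. The case \<open>M = 0\<close> is the
  Poincare inequality on all of D(A).\<close>

lemma poincare_tail:
  assumes u: "u \<in> D" and z: "\<And>i. 1 \<le> i \<Longrightarrow> i \<le> M \<Longrightarrow> coord u i = 0"
  shows "\<alpha> (Suc M) * (norm u)\<^sup>2 \<le> (norm (L u))\<^sup>2"
proof (rule LIMSEQ_le)
  show "(\<lambda>m. \<alpha> (Suc M) * (\<Sum>i=1..m. \<alpha> i * (coord u i)\<^sup>2)) \<longlonglongrightarrow> \<alpha> (Suc M) * (norm u)\<^sup>2"
    by (intro tendsto_intros norm_sq_tendsto)
  show "(\<lambda>m. \<Sum>i=1..m. (\<alpha> i * coord u i)\<^sup>2) \<longlonglongrightarrow> (norm (L u))\<^sup>2" by (rule norm_L_sq_tendsto[OF u])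
  have "\<alpha> (Suc M) * (\<Sum>i=1..m. \<alpha> i * (coord u i)\<^sup>2) \<le> (\<Sum>i=1..m. (\<alpha> i * coord u i)\<^sup>2)" for m
    unfolding sum_distrib_left
  proof (rule sum_mono)
    fix i assume i: "i \<in> {1..m}"
    show "\<alpha> (Suc M) * (\<alpha> i * (coord u i)\<^sup>2) \<le> (\<alpha> i * coord u i)\<^sup>2"
    proof (cases "i \<le> M")
      case True then show ?thesis using z i by simp
    next
      case False
      then have "\<alpha> (Suc M) \<le> \<alpha> i" by (intro alpha_mono) auto
      then have "\<alpha> (Suc M) * (\<alpha> i * (coord u i)\<^sup>2) \<le> \<alpha> i * (\<alpha> i * (coord u i)\<^sup>2)"
        using alpha_pos[of i] i by (intro mult_right_mono) auto
      then show ?thesis by (simp add: power_mult_distrib power2_eq_square mult_ac)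
    qed
  qed
  then show "\<exists>N. \<forall>m\<ge>N. \<alpha> (Suc M) * (\<Sum>i=1..m. \<alpha> i * (coord u i)\<^sup>2) \<le> (\<Sum>i=1..m. (\<alpha> i * coord u i)\<^sup>2)" by blast
qed

lemma poincare: "u \<in> D \<Longrightarrow> \<alpha> 1 * (norm u)\<^sup>2 \<le> (norm (L u))\<^sup>2"
  using poincare_tail[of u 0] by simp

end

section \<open>Energy identity and maximal regularity\<close>

context spectral begin

text \<open>The regularity class of strong solutions, with the weak derivative \<open>w\<close> as a
  parameter and no equation attached: the energy identity and differences of solutions can be
  treated before an equation links \<open>w\<close> to \<open>y\<close>. General endpoints allow
  restarts.\<close>

definition maxreg :: "real \<Rightarrow> real \<Rightarrow> (real \<Rightarrow> 'v) \<Rightarrow> (real \<Rightarrow> 'h) \<Rightarrow> bool" where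
  "maxreg a b y w \<longleftrightarrow> continuous_on {a..b} y \<and> (AE t in lebesgue_on {a..b}. y t \<in> D) \<and>
     sqint (lebesgue_on {a..b}) (\<lambda>t. L (y t)) \<and> sqint (lebesgue_on {a..b}) w \<and>
     (\<forall>t\<in>{a..b}. \<iota> (y t) = \<iota> (y a) + (LINT s|lebesgue_on {a..t}. w s))"

lemma reg_cont: "maxreg a b y w \<Longrightarrow> continuous_on {a..b} y"
  and reg_D: "maxreg a b y w \<Longrightarrow> AE t in lebesgue_on {a..b}. y t \<in> D"
  and reg_L: "maxreg a b y w \<Longrightarrow> sqint (lebesgue_on {a..b}) (\<lambda>t. L (y t))"
  and reg_w: "maxreg a b y w \<Longrightarrow> sqint (lebesgue_on {a..b}) w"
  and reg_eq: "maxreg a b y w \<Longrightarrow> t \<in> {a..b} \<Longrightarrow> \<iota> (y t) = \<iota> (y a) + (LINT s|lebesgue_on {a..t}. w s)"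
  unfolding maxreg_def by blast+

lemma reg_w_int: "maxreg a b y w \<Longrightarrow> a \<le> s \<Longrightarrow> t \<le> b \<Longrightarrow> integrable (lebesgue_on {s..t}) w"
  by (rule integrable_lebesgue_on_subset[OF sqint_integrable[OF reg_w]]) auto

lemma reg_subinterval:
  assumes "maxreg a b y w" "a \<le> a'" "a' \<le> b'" "b' \<le> b"
  shows "maxreg a' b' y w"
  unfolding maxreg_def
proof (intro conjI ballI)
  have sub: "{a'..b'} \<subseteq> {a..b}" using assms by auto
  show "continuous_on {a'..b'} y" by (rule continuous_on_subset[OF reg_cont[OF assms(1)] sub])
  show "AE t in lebesgue_on {a'..b'}. y t \<in> D" by (rule AE_lebesgue_on_subset[OF reg_D[OF assms(1)] sub]) auto
  show "sqint (lebesgue_on {a'..b'}) (\<lambda>t. L (y t))" "sqint (lebesgue_on {a'..b'}) w"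
    using sqint_lebesgue_on_subset[OF reg_L[OF assms(1)] sub] sqint_lebesgue_on_subset[OF reg_w[OF assms(1)] sub] by auto
  fix t assume t: "t \<in> {a'..b'}"
  have "\<iota> (y t) = \<iota> (y a) + (LINT s|lebesgue_on {a..t}. w s)" using t assms by (intro reg_eq) auto
  also have "(LINT s|lebesgue_on {a..t}. w s) = (LINT s|lebesgue_on {a..a'}. w s) + (LINT s|lebesgue_on {a'..t}. w s)"
    using t assms by (intro integral_lebesgue_on_combine reg_w_int) auto
  also have "(LINT s|lebesgue_on {a..a'}. w s) = \<iota> (y a') - \<iota> (y a)"
    using reg_eq[OF assms(1), of a'] assms(2-) by simp
  finally show "\<iota> (y t) = \<iota> (y a') + (LINT s|lebesgue_on {a'..t}. w s)" by simp
qed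

lemma reg_combine:
  assumes 1: "maxreg a b y w" and 2: "maxreg b c y w" and ab: "a \<le> b" "b \<le> c"
  shows "maxreg a c y w"
  unfolding maxreg_def
proof (intro conjI ballI)
  have "continuous_on ({a..b} \<union> {b..c}) y"
    by (rule continuous_on_closed_Un[OF _ _ reg_cont[OF 1] reg_cont[OF 2]]) auto
  moreover have "{a..b} \<union> {b..c} = {a..c}" using ab by auto
  ultimately show "continuous_on {a..c} y" by simp
  show "AE t in lebesgue_on {a..c}. y t \<in> D" by (rule AE_lebesgue_on_combine[OF reg_D[OF 1] reg_D[OF 2]])
  show "sqint (lebesgue_on {a..c}) (\<lambda>t. L (y t))" by (rule sqint_lebesgue_on_combine[OF reg_L[OF 1] reg_L[OF 2] ab])
  show w: "sqint (lebesgue_on {a..c}) w" by (rule sqint_lebesgue_on_combine[OF reg_w[OF 1] reg_w[OF 2] ab])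
  fix t assume t: "t \<in> {a..c}"
  show "\<iota> (y t) = \<iota> (y a) + (LINT s|lebesgue_on {a..t}. w s)"
  proof (cases "t \<le> b")
    case True then show ?thesis using t by (intro reg_eq[OF 1]) auto
  next
    case False
    then have "\<iota> (y t) = \<iota> (y b) + (LINT s|lebesgue_on {b..t}. w s)" using t by (intro reg_eq[OF 2]) auto
    also have "\<iota> (y b) = \<iota> (y a) + (LINT s|lebesgue_on {a..b}. w s)" using ab by (intro reg_eq[OF 1]) auto
    also have "\<iota> (y a) + (LINT s|lebesgue_on {a..b}. w s) + (LINT s|lebesgue_on {b..t}. w s)
       = \<iota> (y a) + (LINT s|lebesgue_on {a..t}. w s)"
      using integral_lebesgue_on_combine[of a t w b] False ab t
        integrable_lebesgue_on_subset[OF sqint_integrable[OF w], of "{a..t}"] by simp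
    finally show ?thesis .
  qed
qed

text \<open>For the derivative, equality almost everywhere suffices. This matters because
  \<open>L\<close> is additive only on D(A), so the derivative of a difference of solutions has the
  expected form only at almost every time.\<close>

lemma reg_cong:
  assumes r: "maxreg a b y w" and ab: "a \<le> b" and y: "\<And>t. t \<in> {a..b} \<Longrightarrow> y t = z t" and w: "AE t in lebesgue_on {a..b}. w t = v t"
  shows "maxreg a b z v"
  unfolding maxreg_def
proof (intro conjI ballI)
  show "continuous_on {a..b} z" by (rule continuous_on_eq[OF reg_cont[OF r] y])
  have "AE t in lebesgue_on {a..b}. t \<in> {a..b}" by (rule AE_I2) simp
  with reg_D[OF r] show "AE t in lebesgue_on {a..b}. z t \<in> D" by eventually_elim (simp add: y[symmetric])
  show "sqint (lebesgue_on {a..b}) (\<lambda>t. L (z t))"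
    by (rule sqint_AE[OF reg_L[OF r]]) (auto intro!: AE_I2 simp: y)
  show v: "sqint (lebesgue_on {a..b}) v" by (rule sqint_AE[OF reg_w[OF r] _ w]) simp
  fix t assume t: "t \<in> {a..b}"
  have "(LINT s|lebesgue_on {a..t}. w s) = (LINT s|lebesgue_on {a..t}. v s)"
  proof (rule integral_cong_AE)
    have sub: "{a..t} \<subseteq> {a..b}" using t by auto
    show "w \<in> borel_measurable (lebesgue_on {a..t})" "v \<in> borel_measurable (lebesgue_on {a..t})"
      by (rule borel_measurable_lebesgue_on_subset[OF sqint_meas[OF reg_w[OF r]] sub]
           borel_measurable_lebesgue_on_subset[OF sqint_meas[OF v] sub])+
    show "AE t in lebesgue_on {a..t}. w t = v t" by (rule AE_lebesgue_on_subset[OF w sub]) auto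
  qed
  then show "\<iota> (z t) = \<iota> (z a) + (LINT s|lebesgue_on {a..t}. v s)"
    using reg_eq[OF r t] y[OF t] y[of a] ab by simp
qed

lemma reg_diff:
  assumes 1: "maxreg a b y w" and 2: "maxreg a b z v"
  shows "maxreg a b (\<lambda>t. y t - z t) (\<lambda>t. w t - v t)"
  unfolding maxreg_def
proof (intro conjI ballI)
  show "continuous_on {a..b} (\<lambda>t. y t - z t)" by (intro continuous_intros reg_cont[OF 1] reg_cont[OF 2])
  show "AE t in lebesgue_on {a..b}. y t - z t \<in> D"
    using reg_D[OF 1] reg_D[OF 2] by eventually_elim (rule D_diff)
  have ae: "AE t in lebesgue_on {a..b}. L (y t) - L (z t) = L (y t - z t)"
    using reg_D[OF 1] reg_D[OF 2] by eventually_elim (simp add: L_diff)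
  show "sqint (lebesgue_on {a..b}) (\<lambda>t. L (y t - z t))"
    by (rule sqint_AE[OF sqint_diff[OF reg_L[OF 1] reg_L[OF 2]] _ ae]) simp
  show "sqint (lebesgue_on {a..b}) (\<lambda>t. w t - v t)" by (rule sqint_diff[OF reg_w[OF 1] reg_w[OF 2]])
  fix t assume t: "t \<in> {a..b}"
  have "integrable (lebesgue_on {a..t}) w" "integrable (lebesgue_on {a..t}) v"
    using reg_w_int[OF 1] reg_w_int[OF 2] t by auto
  then show "\<iota> (y t - z t) = \<iota> (y a - z a) + (LINT s|lebesgue_on {a..t}. w s - v s)"
    using reg_eq[OF 1 t] reg_eq[OF 2 t] by (simp add: blinfun.diff_right)
qed

lemma reg_ac:
  assumes "maxreg a b y w" "a \<le> b"
  shows "ac_with_deriv a b (\<lambda>t. coord (y t) i) (\<lambda>t. w t \<bullet> \<iota> (e i))"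
  unfolding ac_with_deriv_def
proof (intro conjI ballI)
  show "integrable (lebesgue_on {a..b}) (\<lambda>t. w t \<bullet> \<iota> (e i))"
    using reg_w_int[OF assms(1)] by auto
  fix t assume t: "t \<in> {a..b}"
  have "integrable (lebesgue_on {a..t}) w" using reg_w_int[OF assms(1)] t by auto
  then show "coord (y t) i = coord (y a) i + (LINT s|lebesgue_on {a..t}. w s \<bullet> \<iota> (e i))"
    unfolding coord_def using reg_eq[OF assms(1) t] by (simp add: inner_add_left)
qed

lemma reg_ac_sq:
  assumes "maxreg a b y w" "a \<le> b"
  shows "ac_with_deriv a b (\<lambda>t. (coord (y t) i)\<^sup>2) (\<lambda>t. 2 * (coord (y t) i * (w t \<bullet> \<iota> (e i))))"
  using ac_mult[OF reg_ac[OF assms, of i] reg_ac[OF assms, of i] assms(2)] by (simp add: power2_eq_square mult.commute)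

lemma energy_PV:
  assumes r: "maxreg a b y w" and st: "a \<le> s" "s \<le> t" "t \<le> b"
  shows "integrable (lebesgue_on {s..t}) (\<lambda>r. \<Sum>i=1..m. \<alpha> i * (coord (y r) i * (w r \<bullet> \<iota> (e i))))"
    and "(norm (PV m (y t)))\<^sup>2 = (norm (PV m (y s)))\<^sup>2
      + 2 * (LINT r|lebesgue_on {s..t}. (\<Sum>i=1..m. \<alpha> i * (coord (y r) i * (w r \<bullet> \<iota> (e i)))))"
proof -
  have r': "maxreg s t y w" by (rule reg_subinterval[OF r st])
  have i1: "integrable (lebesgue_on {s..t}) (\<lambda>r. \<alpha> i * (coord (y r) i * (w r \<bullet> \<iota> (e i))))" for i
  proof -
    have "integrable (lebesgue_on {s..t}) (\<lambda>r. (\<alpha> i / 2) * (2 * (coord (y r) i * (w r \<bullet> \<iota> (e i)))))"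
      by (intro Bochner_Integration.integrable_mult_right ac_int[OF reg_ac_sq[OF r' st(2)]])
    then show ?thesis by simp
  qed
  then show "integrable (lebesgue_on {s..t}) (\<lambda>r. \<Sum>i=1..m. \<alpha> i * (coord (y r) i * (w r \<bullet> \<iota> (e i))))"
    by (intro Bochner_Integration.integrable_sum)
  have "\<alpha> i * (coord (y t) i)\<^sup>2 = \<alpha> i * (coord (y s) i)\<^sup>2 + 2 * (LINT r|lebesgue_on {s..t}. \<alpha> i * (coord (y r) i * (w r \<bullet> \<iota> (e i))))" for i
  proof -
    have "(coord (y t) i)\<^sup>2 = (coord (y s) i)\<^sup>2 + (LINT r|lebesgue_on {s..t}. 2 * (coord (y r) i * (w r \<bullet> \<iota> (e i))))"
      by (rule ac_D[OF reg_ac_sq[OF r' st(2)]]) (use st in auto)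
    then show ?thesis by (simp add: algebra_simps)
  qed
  then show "(norm (PV m (y t)))\<^sup>2 = (norm (PV m (y s)))\<^sup>2
      + 2 * (LINT r|lebesgue_on {s..t}. (\<Sum>i=1..m. \<alpha> i * (coord (y r) i * (w r \<bullet> \<iota> (e i)))))"
    unfolding norm_PV using i1 by (simp add: sum.distrib Bochner_Integration.integral_sum sum_distrib_left)
qed

text \<open>Formally the derivative of |y|_V^2 is twice the product of Ay and y', but
  \<open>w\<close> takes values in H only. For the truncation \<open>PV m (y t)\<close> the identity
  is a finite sum of scalar product rules, in which \<open>w r\<close> appears as
  \<open>PH m (w r)\<close>; since \<open>PH m\<close> does not increase norms, dominated
  convergence removes the truncation.\<close>

lemma energy:
  assumes r: "maxreg a b y w" and st: "a \<le> s" "s \<le> t" "t \<le> b"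
  shows "(norm (y t))\<^sup>2 = (norm (y s))\<^sup>2 + 2 * (LINT r|lebesgue_on {s..t}. L (y r) \<bullet> w r)"
proof -
  define F where "F m r = (\<Sum>i=1..m. \<alpha> i * (coord (y r) i * (w r \<bullet> \<iota> (e i))))" for m r
  have r': "maxreg s t y w" by (rule reg_subinterval[OF r st])
  have step: "(norm (PV m (y t)))\<^sup>2 = (norm (PV m (y s)))\<^sup>2 + 2 * (LINT r|lebesgue_on {s..t}. F m r)" for m
    unfolding F_def by (rule energy_PV(2)[OF r st])
  have FL: "F m r = L (y r) \<bullet> PH m (w r)" if "y r \<in> D" for m r
    unfolding F_def PH_def using that by (auto simp: inner_sum_right L_inner_e intro!: sum.cong)
  have "(\<lambda>m. LINT r|lebesgue_on {s..t}. F m r) \<longlonglongrightarrow> (LINT r|lebesgue_on {s..t}. L (y r) \<bullet> w r)"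
  proof (rule integral_dominated_convergence)
    show "(\<lambda>r. L (y r) \<bullet> w r) \<in> borel_measurable (lebesgue_on {s..t})"
      by (rule borel_measurable_integrable[OF integrable_inner_sqint[OF reg_L[OF r'] reg_w[OF r']]])
    show "F m \<in> borel_measurable (lebesgue_on {s..t})" for m
      unfolding F_def by (intro borel_measurable_integrable energy_PV(1)[OF r st])
    show "integrable (lebesgue_on {s..t}) (\<lambda>r. (norm (L (y r)))\<^sup>2 + (norm (w r))\<^sup>2)"
      by (intro Bochner_Integration.integrable_add sqint_int reg_L[OF r'] reg_w[OF r'])
    show "AE r in lebesgue_on {s..t}. (\<lambda>m. F m r) \<longlonglongrightarrow> L (y r) \<bullet> w r"
      using reg_D[OF r'] by eventually_elim (simp add: FL, intro tendsto_intros PH_tendsto)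
    show "AE r in lebesgue_on {s..t}. norm (F m r) \<le> (norm (L (y r)))\<^sup>2 + (norm (w r))\<^sup>2" for m
      using reg_D[OF r']
    proof eventually_elim
      case (elim r)
      have "\<bar>F m r\<bar> \<le> norm (L (y r)) * norm (PH m (w r))" unfolding FL[OF elim] by (rule Cauchy_Schwarz_ineq2)
      also have "\<dots> \<le> norm (L (y r)) * norm (w r)" by (intro mult_left_mono norm_PH_le) simp
      finally show ?case using sum_squares_bound[of "norm (L (y r))" "norm (w r)"]
          zero_le_mult_iff[of "norm (L (y r))" "norm (w r)"] by simp
    qed
  qed
  then have lim: "(\<lambda>m. (norm (PV m (y s)))\<^sup>2 + 2 * (LINT r|lebesgue_on {s..t}. F m r)) \<longlonglongrightarrow> (norm (y s))\<^sup>2 + 2 * (LINT r|lebesgue_on {s..t}. L (y r) \<bullet> w r)"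
    by (intro tendsto_intros PV_tendsto)
  have "(\<lambda>m. (norm (PV m (y t)))\<^sup>2) \<longlonglongrightarrow> (norm (y t))\<^sup>2" by (intro tendsto_intros PV_tendsto)
  then show ?thesis by (rule LIMSEQ_unique) (rule lim[folded step])
qed

text \<open>Expanding the square of the derivative f - Ly bounds twice its product with Ly by |f|^2
  - |Ly|^2, so no constant appears. This sharp form is what lets \<open>sol_unique\<close> absorb
  its top order term completely.\<close>

lemma energy_le:
  assumes r: "maxreg a b y (\<lambda>t. f t - L (y t))" and t: "t \<in> {a..b}"
  shows "(norm (y t))\<^sup>2 + (LINT s|lebesgue_on {a..t}. (norm (L (y s)))\<^sup>2) \<le> (norm (y a))\<^sup>2 + (LINT s|lebesgue_on {a..t}. (norm (f s))\<^sup>2)"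
proof -
  have r': "maxreg a t y (\<lambda>t. f t - L (y t))" by (rule reg_subinterval[OF r]) (use t in auto)
  have f: "sqint (lebesgue_on {a..t}) f" using sqint_add[OF reg_w[OF r'] reg_L[OF r']] by simp
  have "2 * (LINT s|lebesgue_on {a..t}. L (y s) \<bullet> (f s - L (y s))) = (LINT s|lebesgue_on {a..t}. 2 * (L (y s) \<bullet> (f s - L (y s))))"
    by simp
  also have "\<dots> \<le> (LINT s|lebesgue_on {a..t}. (norm (f s))\<^sup>2 - (norm (L (y s)))\<^sup>2)"
  proof (rule integral_mono)
    show "integrable (lebesgue_on {a..t}) (\<lambda>s. 2 * (L (y s) \<bullet> (f s - L (y s))))"
      by (intro Bochner_Integration.integrable_mult_right integrable_inner_sqint reg_L[OF r'] reg_w[OF r'])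
    show "integrable (lebesgue_on {a..t}) (\<lambda>s. (norm (f s))\<^sup>2 - (norm (L (y s)))\<^sup>2)"
      by (intro Bochner_Integration.integrable_diff sqint_int reg_L[OF r'] f)
    show "2 * (L (y s) \<bullet> (f s - L (y s))) \<le> (norm (f s))\<^sup>2 - (norm (L (y s)))\<^sup>2" for s
      using zero_le_power2[of "norm (f s - L (y s))"] unfolding power2_norm_eq_inner
      by (simp add: inner_diff_left inner_diff_right inner_commute)
  qed
  also have "\<dots> = (LINT s|lebesgue_on {a..t}. (norm (f s))\<^sup>2) - (LINT s|lebesgue_on {a..t}. (norm (L (y s)))\<^sup>2)"
    by (intro Bochner_Integration.integral_diff sqint_int reg_L[OF r'] f)
  finally show ?thesis using energy[OF r, of a t] t by simp
qed

text \<open>The coordinates of the solution of the linear equation are given by Duhamel's formula.\<close>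

lemma linear_coordinate:
  assumes ab: "a \<le> b" and f: "sqint (lebesgue_on {a..b}) f" and i: "1 \<le> i"
  shows "\<exists>c. c a = c0 \<and> ac_with_deriv a b c (\<lambda>t. f t - \<alpha> i * c t) \<and>
    (\<forall>t\<in>{a..b}. \<alpha> i * (c t)\<^sup>2 + (LINT s|lebesgue_on {a..t}. (\<alpha> i * c s)\<^sup>2) \<le> \<alpha> i * c0\<^sup>2 + (LINT s|lebesgue_on {a..b}. (f s)\<^sup>2))"
proof -
  \<comment> \<open>\<open>E\<close> is the homogeneous solution and \<open>G\<close> integrates the
    forcing against its reciprocal, so that \<open>c\<close> is a product to which
    \<open>ac_mult\<close> applies.\<close>
  define E where "E t = exp (- \<alpha> i * (t - a))" for t
  define G where "G t = c0 + (LINT s|lebesgue_on {a..t}. f s * exp (\<alpha> i * (s - a)))" for t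
  define c where "c t = E t * G t" for t
  have cE: "continuous_on UNIV (\<lambda>t. - \<alpha> i * E t)" unfolding E_def by (intro continuous_intros)
  have E: "ac_with_deriv a b E (\<lambda>t. - \<alpha> i * E t)"
    by (rule ac_C1[OF _ cE ab]) (auto simp: E_def[abs_def] intro!: derivative_eq_intros)
  have z: "(LINT s|lebesgue_on {a}. g s) = 0" for g :: "real \<Rightarrow> real"
    by (rule integral_eq_zero_null_sets) simp
  have G: "ac_with_deriv a b G (\<lambda>s. f s * exp (\<alpha> i * (s - a)))"
    unfolding ac_with_deriv_def
  proof
    show "integrable (lebesgue_on {a..b}) (\<lambda>s. f s * exp (\<alpha> i * (s - a)))"
      by (intro integrable_mult_continuous sqint_integrable f continuous_intros)
  qed (simp add: G_def z)
  have "ac_with_deriv a b c (\<lambda>t. - \<alpha> i * E t * G t + E t * (f t * exp (\<alpha> i * (t - a))))"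
    using ac_mult[OF E G ab] by (simp add: c_def[abs_def])
  moreover have "- \<alpha> i * E t * G t + E t * (f t * exp (\<alpha> i * (t - a))) = f t - \<alpha> i * c t" for t
    by (simp add: c_def E_def mult_exp_exp)
  ultimately have c: "ac_with_deriv a b c (\<lambda>t. f t - \<alpha> i * c t)" by simp
  have ca: "c a = c0" by (simp add: c_def E_def G_def z)
  have cc: "continuous_on {a..b} c" by (rule ac_continuous[OF c])
  show ?thesis
  proof (intro exI[of _ c] conjI ballI c ca)
    fix t assume t: "t \<in> {a..b}"
    have sub: "{a..t} \<subseteq> {a..b}" using t by auto
    have i1: "integrable (lebesgue_on {a..t}) (\<lambda>s. (\<alpha> i * c s)\<^sup>2)"
      by (intro continuous_imp_integrable_real continuous_intros continuous_on_subset[OF cc sub])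
    have fb: "integrable (lebesgue_on {a..b}) (\<lambda>s. (f s)\<^sup>2)" using sqint_int[OF f] by simp
    have i2: "integrable (lebesgue_on {a..t}) (\<lambda>s. (f s)\<^sup>2)"
      by (rule integrable_lebesgue_on_subset[OF fb sub]) auto
    have sq: "ac_with_deriv a b (\<lambda>t. c t * c t) (\<lambda>t. (f t - \<alpha> i * c t) * c t + c t * (f t - \<alpha> i * c t))"
      by (rule ac_mult[OF c c ab])
    have i3: "integrable (lebesgue_on {a..t}) (\<lambda>t. (f t - \<alpha> i * c t) * c t + c t * (f t - \<alpha> i * c t))"
      by (rule integrable_lebesgue_on_subset[OF ac_int[OF sq] sub]) auto
    \<comment> \<open>The factor \<alpha> i makes the sum of these scalar estimates over
      \<open>i\<close> control the V norm and the L2 norm in D(A).\<close>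
    have "\<alpha> i * (c t)\<^sup>2 = \<alpha> i * c0\<^sup>2 + \<alpha> i * (LINT s|lebesgue_on {a..t}. (f s - \<alpha> i * c s) * c s + c s * (f s - \<alpha> i * c s))"
      using ac_D[OF sq t] ca by (simp add: power2_eq_square algebra_simps)
    also have "\<alpha> i * (LINT s|lebesgue_on {a..t}. (f s - \<alpha> i * c s) * c s + c s * (f s - \<alpha> i * c s))
       = (LINT s|lebesgue_on {a..t}. \<alpha> i * ((f s - \<alpha> i * c s) * c s + c s * (f s - \<alpha> i * c s)))"
      by simp
    also have "\<dots> \<le> (LINT s|lebesgue_on {a..t}. (f s)\<^sup>2 - (\<alpha> i * c s)\<^sup>2)"
    proof (rule integral_mono)
      show "\<alpha> i * ((f s - \<alpha> i * c s) * c s + c s * (f s - \<alpha> i * c s)) \<le> (f s)\<^sup>2 - (\<alpha> i * c s)\<^sup>2" for s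
        using zero_le_power2[of "f s - \<alpha> i * c s"] by (simp add: power2_eq_square algebra_simps)
    qed (use i1 i2 i3 in auto)
    also have "\<dots> = (LINT s|lebesgue_on {a..t}. (f s)\<^sup>2) - (LINT s|lebesgue_on {a..t}. (\<alpha> i * c s)\<^sup>2)"
      using i1 i2 by simp
    also have "(LINT s|lebesgue_on {a..t}. (f s)\<^sup>2) \<le> (LINT s|lebesgue_on {a..b}. (f s)\<^sup>2)"
      by (rule integral_mono_lebesgue_on_AE[OF fb]) (use sub in auto)
    finally show "\<alpha> i * (c t)\<^sup>2 + (LINT s|lebesgue_on {a..t}. (\<alpha> i * c s)\<^sup>2) \<le> \<alpha> i * c0\<^sup>2 + (LINT s|lebesgue_on {a..b}. (f s)\<^sup>2)"
      by simp
  qed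
qed

text \<open>The solution is assembled from its coordinates. Their bounds \<open>\<beta> i\<close> do
  not depend on time and are summable by Bessel's inequality, which yields uniform convergence in V
  and hence continuity. They also bound the integrals of the squares of
  \<open>\<alpha> i * c i s\<close>, which yields membership in D(A) at almost every time.\<close>

lemma linear_solution:
  assumes ab: "a \<le> b" and f: "sqint (lebesgue_on {a..b}) f"
  shows "\<exists>y. y a = ya \<and> maxreg a b y (\<lambda>t. f t - L (y t))"
proof -
  define M where "M = lebesgue_on {a..b}"
  define fi where "fi i t = f t \<bullet> \<iota> (e i)" for i t
  have fm: "f \<in> borel_measurable M" using sqint_meas[OF f] by (simp add: M_def)
  have fi_le: "(fi i t)\<^sup>2 \<le> (norm (f t))\<^sup>2" if "1 \<le> i" for i t
    using norm_PH[of i "f t"] power_mono[OF norm_PH_le[of i "f t"], of 2] that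
      member_le_sum[of i "{1..i}" "\<lambda>i. (fi i t)\<^sup>2"] by (simp add: fi_def)
  have fi: "sqint M (fi i)" if "1 \<le> i" for i
    using sqint_bound[of "fi i" M "\<lambda>t. (norm (f t))\<^sup>2"] sqint_int[OF f] fi_le[OF that] fm
    by (simp add: fi_def[abs_def] M_def)
  have "\<forall>i\<in>{1..}. \<exists>c. c a = coord ya i \<and> ac_with_deriv a b c (\<lambda>t. fi i t - \<alpha> i * c t) \<and>
    (\<forall>t\<in>{a..b}. \<alpha> i * (c t)\<^sup>2 + (LINT s|lebesgue_on {a..t}. (\<alpha> i * c s)\<^sup>2) \<le> \<alpha> i * (coord ya i)\<^sup>2 + (LINT s|lebesgue_on {a..b}. (fi i s)\<^sup>2))"
    using fi unfolding M_def by (intro ballI linear_coordinate ab) auto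
  then obtain c where c: "\<forall>i\<in>{1..}. c i a = coord ya i \<and> ac_with_deriv a b (c i) (\<lambda>t. fi i t - \<alpha> i * c i t) \<and>
    (\<forall>t\<in>{a..b}. \<alpha> i * (c i t)\<^sup>2 + (LINT s|lebesgue_on {a..t}. (\<alpha> i * c i s)\<^sup>2) \<le> \<alpha> i * (coord ya i)\<^sup>2 + (LINT s|lebesgue_on {a..b}. (fi i s)\<^sup>2))"
    unfolding bchoice_iff by blast
  have ca: "c i a = coord ya i" and cac: "ac_with_deriv a b (c i) (\<lambda>t. fi i t - \<alpha> i * c i t)" if "1 \<le> i" for i
    using c that by auto
  define \<beta> where "\<beta> i = \<alpha> i * (coord ya i)\<^sup>2 + (LINT s|M. (fi i s)\<^sup>2)" for i
  have cb: "\<alpha> i * (c i t)\<^sup>2 + (LINT s|lebesgue_on {a..t}. (\<alpha> i * c i s)\<^sup>2) \<le> \<beta> i" if "1 \<le> i" "t \<in> {a..b}" for i t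
    using c that unfolding \<beta>_def M_def by auto
  have cont: "continuous_on {a..b} (c i)" if "1 \<le> i" for i by (rule ac_continuous[OF cac[OF that]])
  define B where "B = (norm ya)\<^sup>2 + (LINT s|M. (norm (f s))\<^sup>2)"
  have \<beta>0: "0 \<le> \<beta> i" if "1 \<le> i" for i using alpha_pos[OF that] by (simp add: \<beta>_def)
  have \<beta>B: "(\<Sum>i=1..m. \<beta> i) \<le> B" for m
  proof -
    have "(\<Sum>i=1..m. \<beta> i) = (norm (PV m ya))\<^sup>2 + (\<Sum>i=1..m. LINT s|M. (fi i s)\<^sup>2)"
      by (simp add: \<beta>_def sum.distrib norm_PV)
    also have "(\<Sum>i=1..m. LINT s|M. (fi i s)\<^sup>2) = (LINT s|M. (\<Sum>i=1..m. (fi i s)\<^sup>2))"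
      using sqint_int[OF fi] by (subst Bochner_Integration.integral_sum) auto
    also have "\<dots> \<le> (LINT s|M. (norm (f s))\<^sup>2)"
    proof (rule integral_mono)
      show "integrable M (\<lambda>s. \<Sum>i=1..m. (fi i s)\<^sup>2)"
        using sqint_int[OF fi] by (intro Bochner_Integration.integrable_sum) auto
      show "integrable M (\<lambda>s. (norm (f s))\<^sup>2)" using sqint_int[OF f] by (simp add: M_def)
      show "(\<Sum>i=1..m. (fi i s)\<^sup>2) \<le> (norm (f s))\<^sup>2" for s
        using norm_PH[of m "f s"] power_mono[OF norm_PH_le[of m "f s"], of 2] by (simp add: fi_def)
    qed
    also have "(norm (PV m ya))\<^sup>2 \<le> (norm ya)\<^sup>2" by (intro power_mono norm_PV_le) simp
    finally show ?thesis by (simp add: B_def)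
  qed
  have cb1: "\<alpha> i * (c i t)\<^sup>2 \<le> \<beta> i" if "1 \<le> i" "t \<in> {a..b}" for i t
  proof -
    have "0 \<le> (LINT s|lebesgue_on {a..t}. (\<alpha> i * c i s)\<^sup>2)" by simp
    with cb[OF that] show ?thesis by linarith
  qed
  have cb2: "(LINT s|M. (\<alpha> i * c i s)\<^sup>2) \<le> \<beta> i" if "1 \<le> i" for i
  proof -
    have "0 \<le> \<alpha> i * (c i b)\<^sup>2" using alpha_pos[OF that] by simp
    with cb[OF that, of b] ab show ?thesis unfolding M_def by simp
  qed
  define ym where "ym m t = (\<Sum>i=1..m. c i t *\<^sub>R e i)" for m t
  have "\<exists>u. (\<lambda>m. ym m t) \<longlonglongrightarrow> u \<and> (\<forall>i\<ge>1. coord u i = c i t)" if t: "t \<in> {a..b}" for t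
    unfolding ym_def
  proof (rule esum_convergent)
    fix m
    have "(\<Sum>i=1..m. \<alpha> i * (c i t)\<^sup>2) \<le> (\<Sum>i=1..m. \<beta> i)" by (intro sum_mono cb1 t) auto
    also have "\<dots> \<le> B" by (rule \<beta>B)
    finally show "(\<Sum>i=1..m. \<alpha> i * (c i t)\<^sup>2) \<le> B" .
  qed
  then obtain y where ylim: "\<And>t. t \<in> {a..b} \<Longrightarrow> (\<lambda>m. ym m t) \<longlonglongrightarrow> y t"
    and yco: "\<And>t i. t \<in> {a..b} \<Longrightarrow> 1 \<le> i \<Longrightarrow> coord (y t) i = c i t" by metis
  define T where "T m = (\<Sum>i=1..m. \<beta> i)" for m
  have monoT: "mono T" unfolding T_def by (intro monoI sum_mono2) (auto intro: \<beta>0)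
  moreover have "norm (T m) \<le> B" for m
    using \<beta>B[of m] sum_nonneg[of "{1..m}" \<beta>] \<beta>0 by (simp add: T_def)
  ultimately have "convergent T"
    by (intro Bseq_mono_convergent BseqI'[of _ B]) (auto simp: mono_def)
  then obtain T0 where T0: "T \<longlonglongrightarrow> T0" by (auto simp: convergent_def)
  have tail: "(norm (y t - ym m t))\<^sup>2 \<le> T0 - T m" if t: "t \<in> {a..b}" for m t
  proof -
    have step: "(norm (ym n t - ym m t))\<^sup>2 \<le> T n - T m" if "m \<le> n" for n
    proof -
      have eq: "{1..n} = {1..m} \<union> {m<..n}" using that by auto
      have "ym n t - ym m t = (\<Sum>i\<in>{m<..n}. c i t *\<^sub>R e i)" "T n - T m = (\<Sum>i\<in>{m<..n}. \<beta> i)"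
        unfolding T_def ym_def eq by (subst sum.union_disjoint; auto)+
      moreover have "(norm (\<Sum>i\<in>{m<..n}. c i t *\<^sub>R e i))\<^sup>2 = (\<Sum>i\<in>{m<..n}. \<alpha> i * (c i t)\<^sup>2)"
        by (rule norm_esum) auto
      moreover have "\<dots> \<le> (\<Sum>i\<in>{m<..n}. \<beta> i)" by (intro sum_mono cb1 t) auto
      ultimately show ?thesis by simp
    qed
    have "(\<lambda>n. (norm (ym n t - ym m t))\<^sup>2) \<longlonglongrightarrow> (norm (y t - ym m t))\<^sup>2" by (intro tendsto_intros ylim t)
    moreover have "(\<lambda>n. T n - T m) \<longlonglongrightarrow> T0 - T m" by (intro tendsto_intros T0)
    ultimately show ?thesis by (rule LIMSEQ_le) (use step in blast)
  qed
  have "uniform_limit {a..b} ym y sequentially"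
  proof (rule uniform_limitI)
    fix \<epsilon> :: real assume \<epsilon>: "0 < \<epsilon>"
    have "\<forall>\<^sub>F m in sequentially. dist (T m) T0 < \<epsilon>\<^sup>2" using T0 \<epsilon> by (intro tendstoD) auto
    then show "\<forall>\<^sub>F m in sequentially. \<forall>t\<in>{a..b}. dist (ym m t) (y t) < \<epsilon>"
    proof eventually_elim
      case (elim m)
      show ?case
      proof
        fix t assume t: "t \<in> {a..b}"
        have "(dist (ym m t) (y t))\<^sup>2 < \<epsilon>\<^sup>2" using tail[OF t, of m] elim
          by (simp add: dist_norm norm_minus_commute)
        then show "dist (ym m t) (y t) < \<epsilon>" using \<epsilon> by (simp add: power_less_imp_less_base)
      qed
    qed
  qed
  then have ycont: "continuous_on {a..b} y"
    by (rule uniform_limit_theorem[rotated]) (auto simp: ym_def intro!: always_eventually continuous_intros cont)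
  have icc: "integrable M (\<lambda>s. (\<alpha> i * c i s)\<^sup>2)" if "1 \<le> i" for i
    unfolding M_def by (intro continuous_imp_integrable_real continuous_intros cont that)
  \<comment> \<open>Index shift: coordinates start at 1, whereas the series lemma sums from
    0.\<close>
  define d where "d i s = (\<alpha> (Suc i) * c (Suc i) s)\<^sup>2" for i s
  have dint: "\<And>i. integrable M (d i)" and dnn: "\<And>i s. 0 \<le> d i s" unfolding d_def using icc by auto
  have "(\<Sum>i<n. integral\<^sup>L M (d i)) \<le> B" for n
  proof -
    have "(\<Sum>i<n. integral\<^sup>L M (d i)) \<le> (\<Sum>i<n. \<beta> (Suc i))"
      unfolding d_def by (intro sum_mono cb2) auto
    also have "\<dots> = (\<Sum>i=1..n. \<beta> i)" by (simp add: sum.atLeast1_atMost_eq)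
    also have "\<dots> \<le> B" by (rule \<beta>B)
    finally show ?thesis .
  qed
  note S = integrable_AE_summable[of M d, OF dint dnn this]
  have S': "y t \<in> D \<and> (\<lambda>m. L (PV m (y t))) \<longlonglongrightarrow> L (y t) \<and> (norm (L (y t)))\<^sup>2 \<le> (\<Sum>i. d i t)"
    if su: "summable (\<lambda>i. d i t)" and t: "t \<in> {a..b}" for t
  proof -
    have eq: "(\<Sum>i=1..m. (\<alpha> i * coord (y t) i)\<^sup>2) = (\<Sum>i<m. d i t)" for m
      by (simp add: sum.atLeast1_atMost_eq d_def yco[OF t])
    have bd: "(\<Sum>i=1..m. (\<alpha> i * coord (y t) i)\<^sup>2) \<le> (\<Sum>i. d i t)" for m
      unfolding eq by (rule sum_le_suminf[OF su]) (auto simp: dnn)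
    note * = D_criterion[OF bd]
    have "(norm (L (y t)))\<^sup>2 \<le> (\<Sum>i. d i t)"
      by (rule LIMSEQ_le_const2[OF norm_L_sq_tendsto[OF *(1)]]) (use bd in blast)
    with * show ?thesis by blast
  qed
  have "AE t in M. t \<in> {a..b}" unfolding M_def by (rule AE_I2) simp
  with S(1) have ae: "AE t in M. y t \<in> D \<and> (\<lambda>m. L (PV m (y t))) \<longlonglongrightarrow> L (y t) \<and> (norm (L (y t)))\<^sup>2 \<le> (\<Sum>i. d i t) \<and> t \<in> {a..b}"
    by eventually_elim (use S' in blast)
  have yD: "AE t in M. y t \<in> D" using ae by eventually_elim blast
  have yL: "sqint M (\<lambda>t. L (y t))"
  proof (rule sqint_bound[OF _ S(2)])
    show "AE t in M. (norm (L (y t)))\<^sup>2 \<le> (\<Sum>i. d i t)" using ae by eventually_elim blast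
    show "(\<lambda>t. L (y t)) \<in> borel_measurable M" unfolding M_def
    proof (rule borel_measurable_lebesgue_on_lim)
      show "(\<lambda>t. \<Sum>i=1..m. (\<alpha> i * c i t) *\<^sub>R \<iota> (e i)) \<in> borel_measurable (lebesgue_on {a..b})" for m
        by (intro borel_measurable_continuous_on_lebesgue_on continuous_intros cont) auto
      show "AE t in lebesgue_on {a..b}. (\<lambda>m. \<Sum>i=1..m. (\<alpha> i * c i t) *\<^sub>R \<iota> (e i)) \<longlonglongrightarrow> L (y t)"
        using ae unfolding M_def
      proof eventually_elim
        case (elim t)
        have "L (PV m (y t)) = (\<Sum>i=1..m. (\<alpha> i * c i t) *\<^sub>R \<iota> (e i))" for m
          unfolding PV_def using elim by (subst L_esum[OF atLeastAtMost_subset_atLeast]) (auto simp: yco intro!: sum.cong)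
        with elim show ?case by simp
      qed
    qed simp
  qed
  have ya: "y a = ya" by (rule co_eqI) (use ab in \<open>simp add: yco ca\<close>)
  have w: "sqint M (\<lambda>t. f t - L (y t))" using f yL unfolding M_def by (rule sqint_diff)
  have eq: "\<iota> (y t) = \<iota> (y a) + (LINT s|lebesgue_on {a..t}. f s - L (y s))" if t: "t \<in> {a..b}" for t
  proof -
    have sub: "{a..t} \<subseteq> {a..b}" using t by auto
    have wi: "integrable (lebesgue_on {a..t}) (\<lambda>t. f t - L (y t))"
      by (rule integrable_lebesgue_on_subset[OF sqint_integrable[OF w[unfolded M_def]] sub]) auto
    \<comment> \<open>The identity lives in H, so it may be tested on the eigenbasis, where it
      becomes the scalar equation of coordinate \<open>i\<close>.\<close>
    have "\<iota> (y t) - (\<iota> (y a) + (LINT s|lebesgue_on {a..t}. f s - L (y s))) = 0"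
    proof (rule e_complete)
      fix i :: nat assume i: "1 \<le> i"
      have "AE s in M. y s \<in> D \<and> s \<in> {a..b}" using ae by eventually_elim blast
      then have aet: "AE s in lebesgue_on {a..t}. y s \<in> D \<and> s \<in> {a..b}"
        unfolding M_def by (rule AE_lebesgue_on_subset[OF _ sub]) auto
      have "(LINT s|lebesgue_on {a..t}. f s - L (y s)) \<bullet> \<iota> (e i) = (LINT s|lebesgue_on {a..t}. (f s - L (y s)) \<bullet> \<iota> (e i))"
        using wi by simp
      also have "\<dots> = (LINT s|lebesgue_on {a..t}. fi i s - \<alpha> i * c i s)"
      proof (rule integral_cong_AE)
        show "(\<lambda>s. (f s - L (y s)) \<bullet> \<iota> (e i)) \<in> borel_measurable (lebesgue_on {a..t})"
          using wi by (intro borel_measurable_integrable integrable_inner_left)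
        show "(\<lambda>s. fi i s - \<alpha> i * c i s) \<in> borel_measurable (lebesgue_on {a..t})"
          by (rule borel_measurable_lebesgue_on_subset[OF borel_measurable_integrable[OF ac_int[OF cac[OF i]]] sub])
        show "AE s in lebesgue_on {a..t}. (f s - L (y s)) \<bullet> \<iota> (e i) = fi i s - \<alpha> i * c i s"
          using aet by eventually_elim (use i in \<open>simp add: inner_diff_left fi_def L_inner_e yco\<close>)
      qed
      also have "\<dots> = c i t - c i a" using ac_D[OF cac[OF i] t] by simp
      finally show "(\<iota> (y t) - (\<iota> (y a) + (LINT s|lebesgue_on {a..t}. f s - L (y s)))) \<bullet> \<iota> (e i) = 0"
        using yco[OF t i] yco[of a i] ab i by (simp add: inner_diff_left inner_add_left coord_def)
    qed
    then show ?thesis by simp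
  qed
  have "maxreg a b y (\<lambda>t. f t - L (y t))"
    unfolding maxreg_def using ycont yD yL w eq unfolding M_def by blast
  with ya show ?thesis by blast
qed

end

section \<open>Local well-posedness of semilinear equations\<close>

text \<open>The assumptions concern t > 0, while the intervals may contain the single further point
  0.\<close>

lemma AE_lebesgue_on_pos:
  assumes "AE t in lebesgue_on {0<..}. P t" "0 \<le> (a::real)"
  shows "AE t in lebesgue_on {a..b}. P t"
proof -
  have "AE t in lebesgue. t \<in> {0<..} \<longrightarrow> P t" using assms(1) by (simp add: AE_lebesgue_on_iff)
  moreover have "AE t in lebesgue. t \<noteq> (0::real)" by (rule AE_I'[of "{0}"]) auto
  ultimately have "AE t in lebesgue. t \<in> {a..b} \<longrightarrow> P t" by eventually_elim (use assms(2) in auto)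
  then show ?thesis by (simp add: AE_lebesgue_on_iff)
qed

context spectral begin

lemma reg_diff_forced:
  assumes 1: "maxreg a b y (\<lambda>t. f t - L (y t))" and 2: "maxreg a b z (\<lambda>t. g t - L (z t))" and "a \<le> b"
  shows "maxreg a b (\<lambda>t. y t - z t) (\<lambda>t. (f t - g t) - L (y t - z t))"
proof (rule reg_cong[OF reg_diff[OF 1 2] \<open>a \<le> b\<close>])
  show "AE t in lebesgue_on {a..b}. f t - L (y t) - (g t - L (z t)) = (f t - g t) - L (y t - z t)"
    using reg_D[OF 1] reg_D[OF 2] by eventually_elim (simp add: L_diff)
qed simp

lemma reg_forcing: "maxreg a b y (\<lambda>t. f t - L (y t)) \<Longrightarrow> sqint (lebesgue_on {a..b}) f"
  using sqint_add[OF reg_w[of a b y "\<lambda>t. f t - L (y t)"] reg_L[of a b y "\<lambda>t. f t - L (y t)"]] by simp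

end

text \<open>Squared, and with \<open>L\<close> entering only through squared norms: along
  trajectories of class \<open>maxreg\<close> every term is then integrable, the products being
  those of an integrable and a bounded function.\<close>

definition (in spectral) lip :: "real \<Rightarrow> real \<Rightarrow> real \<Rightarrow> ('v \<Rightarrow> 'h) \<Rightarrow> bool" where
  "lip \<epsilon> K C f \<longleftrightarrow> (\<forall>y\<in>D. \<forall>z\<in>D. norm y \<le> K \<longrightarrow> norm z \<le> K \<longrightarrow>
        (norm (f y - f z))\<^sup>2 \<le> \<epsilon> * ((norm (L (y - z)))\<^sup>2
          + ((norm (L y))\<^sup>2 + (norm (L z))\<^sup>2) * (norm (y - z))\<^sup>2) + C * (norm (y - z))\<^sup>2)"

lemma (in spectral) lip_D: "lip \<epsilon> K C f \<Longrightarrow> y \<in> D \<Longrightarrow> z \<in> D \<Longrightarrow> norm y \<le> K \<Longrightarrow> norm z \<le> K \<Longrightarrow>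
  (norm (f y - f z))\<^sup>2 \<le> \<epsilon> * ((norm (L (y - z)))\<^sup>2
          + ((norm (L y))\<^sup>2 + (norm (L z))\<^sup>2) * (norm (y - z))\<^sup>2) + C * (norm (y - z))\<^sup>2"
  unfolding lip_def by blast

text \<open>
  The factor in front of the top order terms is arbitrarily small; this is what the condition
  \<open>\<zeta>\<^sub>2 + \<delta>\<^sub>2 < 1\<close> provides.
\<close>

locale semilinear = spectral \<iota> A \<alpha> e
  for \<iota> :: "'v::{real_inner,banach,second_countable_topology} \<Rightarrow>\<^sub>L 'h::{real_inner,banach,second_countable_topology}"
    and A \<alpha> e +
  fixes G :: "real \<Rightarrow> 'v \<Rightarrow> 'h"
  assumes G_meas: "\<And>a b u. 0 \<le> a \<Longrightarrow> AE t in lebesgue_on {a..b}. u t \<in> D \<Longrightarrow>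
      (\<lambda>t. L (u t)) \<in> borel_measurable (lebesgue_on {a..b}) \<Longrightarrow>
      (\<lambda>t. G t (u t)) \<in> borel_measurable (lebesgue_on {a..b})"
    and G_bound: "\<And>\<epsilon> K. 0 < \<epsilon> \<Longrightarrow> 0 < K \<Longrightarrow> \<exists>C\<ge>0. AE t in lebesgue_on {0<..}. lip \<epsilon> K C (G t)"
    and G_0: "AE t in lebesgue_on {0<..}. G t 0 = 0"
begin

lemma G_lip:
  assumes "0 < \<epsilon>" "0 < K"
  shows "\<exists>C. 0 \<le> C \<and> (\<forall>a b. 0 \<le> a \<longrightarrow> (AE t in lebesgue_on {a..b}. lip \<epsilon> K C (G t)))"
proof -
  from G_bound[OF assms] obtain C where "0 \<le> C" "AE t in lebesgue_on {0<..}. lip \<epsilon> K C (G t)"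
    by (elim exE conjE)
  then show ?thesis by (intro exI[of _ C] conjI allI impI AE_lebesgue_on_pos)
qed

definition sol :: "real \<Rightarrow> real \<Rightarrow> (real \<Rightarrow> 'v) \<Rightarrow> bool" where
  "sol a b y \<longleftrightarrow> maxreg a b y (\<lambda>t. G t (y t) - L (y t))"

lemma G_meas_reg: "0 \<le> a \<Longrightarrow> maxreg a b y w \<Longrightarrow> (\<lambda>t. G t (y t)) \<in> borel_measurable (lebesgue_on {a..b})"
  by (intro G_meas reg_D sqint_meas[OF reg_L])

lemma reg_zero: "maxreg a b (\<lambda>_. 0) (\<lambda>_. 0)"
  by (simp add: maxreg_def sqint_def)

text \<open>A short interval makes only the \<open>C\<close> term small, through the factor
  \<open>b - a\<close>; the integrals of the squared norms of \<open>L\<close> are not uniformly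
  small on short intervals, and there \<epsilon> has to help. The single number \<rho> bounds both
  parts of the energy of the difference, as \<open>energy_le\<close> delivers it.\<close>

lemma G_difference:
  assumes a: "0 \<le> a" "a \<le> b" and Gb: "AE t in lebesgue_on {a..b}. lip \<epsilon> K C (G t)" and pos: "0 \<le> \<epsilon>" "0 \<le> C"
    and y: "maxreg a b y w" "\<And>t. t \<in> {a..b} \<Longrightarrow> norm (y t) \<le> K" "(LINT t|lebesgue_on {a..b}. (norm (L (y t)))\<^sup>2) \<le> E"
    and z: "maxreg a b z v" "\<And>t. t \<in> {a..b} \<Longrightarrow> norm (z t) \<le> K" "(LINT t|lebesgue_on {a..b}. (norm (L (z t)))\<^sup>2) \<le> E"
    and \<rho>: "\<And>t. t \<in> {a..b} \<Longrightarrow> (norm (y t - z t))\<^sup>2 \<le> \<rho>" "(LINT t|lebesgue_on {a..b}. (norm (L (y t - z t)))\<^sup>2) \<le> \<rho>"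
  shows "sqint (lebesgue_on {a..b}) (\<lambda>t. G t (y t) - G t (z t))"
    and "(LINT t|lebesgue_on {a..b}. (norm (G t (y t) - G t (z t)))\<^sup>2) \<le> \<rho> * (\<epsilon> + 2 * E * \<epsilon> + C * (b - a))"
proof -
  let ?M = "lebesgue_on {a..b}"
  let ?B = "\<lambda>t. \<epsilon> * (norm (L (y t - z t)))\<^sup>2 + \<epsilon> * \<rho> * (norm (L (y t)))\<^sup>2 + \<epsilon> * \<rho> * (norm (L (z t)))\<^sup>2 + C * \<rho>"
  have iy: "integrable ?M (\<lambda>t. (norm (L (y t)))\<^sup>2)" and iz: "integrable ?M (\<lambda>t. (norm (L (z t)))\<^sup>2)"
    and id: "integrable ?M (\<lambda>t. (norm (L (y t - z t)))\<^sup>2)"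
    using sqint_int reg_L y(1) z(1) reg_diff by blast+
  have iB: "integrable ?M ?B" using iy iz id by simp
  have "AE t in ?M. t \<in> {a..b}" by (rule AE_I2) simp
  with Gb reg_D[OF y(1)] reg_D[OF z(1)] have ae: "AE t in ?M. (norm (G t (y t) - G t (z t)))\<^sup>2 \<le> ?B t"
  proof eventually_elim
    case (elim t)
    have "(norm (G t (y t) - G t (z t)))\<^sup>2 \<le> \<epsilon> * ((norm (L (y t - z t)))\<^sup>2
          + ((norm (L (y t)))\<^sup>2 + (norm (L (z t)))\<^sup>2) * (norm (y t - z t))\<^sup>2) + C * (norm (y t - z t))\<^sup>2"
      using elim by (intro lip_D[OF elim(1)] y(2) z(2)) auto
    also have "\<dots> \<le> \<epsilon> * ((norm (L (y t - z t)))\<^sup>2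
          + ((norm (L (y t)))\<^sup>2 + (norm (L (z t)))\<^sup>2) * \<rho>) + C * \<rho>"
      using \<rho>(1)[OF elim(4)] pos by (intro add_mono mult_left_mono order_refl) auto
    also have "\<dots> = ?B t" by (simp add: algebra_simps)
    finally show ?case .
  qed
  show sq: "sqint ?M (\<lambda>t. G t (y t) - G t (z t))"
    by (rule sqint_bound[OF _ iB ae]) (intro borel_measurable_diff G_meas_reg[OF a(1) y(1)] G_meas_reg[OF a(1) z(1)])
  have \<rho>0: "0 \<le> \<rho>" using \<rho>(1)[of a] a zero_le_power2[of "norm (y a - z a)"] by (meson atLeastAtMost_iff order_refl order_trans)
  have "(LINT t|?M. (norm (G t (y t) - G t (z t)))\<^sup>2) \<le> (LINT t|?M. ?B t)"
    by (rule integral_mono_AE[OF sqint_int[OF sq] iB ae])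
  also have "\<dots> = \<epsilon> * (LINT t|?M. (norm (L (y t - z t)))\<^sup>2) + \<epsilon> * \<rho> * (LINT t|?M. (norm (L (y t)))\<^sup>2)
      + \<epsilon> * \<rho> * (LINT t|?M. (norm (L (z t)))\<^sup>2) + C * \<rho> * (b - a)"
    using iy iz id a by (simp add: measure_restrict_space)
  also have "\<dots> \<le> \<epsilon> * \<rho> + \<epsilon> * \<rho> * E + \<epsilon> * \<rho> * E + C * \<rho> * (b - a)"
    using pos \<rho>0 y(3) z(3) \<rho>(2) by (intro add_mono mult_left_mono order_refl) auto
  also have "\<dots> = \<rho> * (\<epsilon> + 2 * E * \<epsilon> + C * (b - a))" by (simp add: algebra_simps)
  finally show "(LINT t|?M. (norm (G t (y t) - G t (z t)))\<^sup>2) \<le> \<rho> * (\<epsilon> + 2 * E * \<epsilon> + C * (b - a))" .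
qed

text \<open>The case \<open>z = 0\<close> of \<open>G_difference\<close>, with
  \<open>K\<^sup>2\<close> in the roles of both \<rho> and \<open>E\<close>.\<close>

lemma G_sqint:
  assumes a: "0 \<le> a" "a \<le> b" and Gb: "AE t in lebesgue_on {a..b}. lip \<epsilon> K C (G t)" and pos: "0 \<le> \<epsilon>" "0 \<le> C"
    and y: "maxreg a b y w" "\<And>t. t \<in> {a..b} \<Longrightarrow> norm (y t) \<le> K" "(LINT t|lebesgue_on {a..b}. (norm (L (y t)))\<^sup>2) \<le> K\<^sup>2"
  shows "sqint (lebesgue_on {a..b}) (\<lambda>t. G t (y t))"
    and "(LINT t|lebesgue_on {a..b}. (norm (G t (y t)))\<^sup>2) \<le> K\<^sup>2 * (\<epsilon> + 2 * K\<^sup>2 * \<epsilon> + C * (b - a))"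
proof -
  have K: "0 \<le> K" using y(2)[of a] a norm_ge_zero[of "y a"] by (meson atLeastAtMost_iff order_refl order_trans)
  have "(norm (y t))\<^sup>2 \<le> K\<^sup>2" if "t \<in> {a..b}" for t using y(2)[OF that] by (intro power_mono) auto
  then have z: "sqint (lebesgue_on {a..b}) (\<lambda>t. G t (y t) - G t 0)"
     "(LINT t|lebesgue_on {a..b}. (norm (G t (y t) - G t 0))\<^sup>2) \<le> K\<^sup>2 * (\<epsilon> + 2 * K\<^sup>2 * \<epsilon> + C * (b - a))"
    using G_difference[OF a Gb pos y reg_zero, of "K\<^sup>2"] K y(3) by auto
  have g0: "AE t in lebesgue_on {a..b}. G t 0 = 0" by (rule AE_lebesgue_on_pos[OF G_0 a(1)])
  then have eq: "AE t in lebesgue_on {a..b}. G t (y t) - G t 0 = G t (y t)" by eventually_elim simp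
  show s: "sqint (lebesgue_on {a..b}) (\<lambda>t. G t (y t))" by (rule sqint_AE[OF z(1) _ eq]) simp
  have "(LINT t|lebesgue_on {a..b}. (norm (G t (y t)))\<^sup>2) = (LINT t|lebesgue_on {a..b}. (norm (G t (y t) - G t 0))\<^sup>2)"
    by (rule integral_cong_AE)
      (use eq in \<open>auto elim!: eventually_mono intro: borel_measurable_integrable[OF sqint_int[OF z(1)]] borel_measurable_integrable[OF sqint_int[OF s]]\<close>)
  with z(2) show "(LINT t|lebesgue_on {a..b}. (norm (G t (y t)))\<^sup>2) \<le> K\<^sup>2 * (\<epsilon> + 2 * K\<^sup>2 * \<epsilon> + C * (b - a))" by simp
qed

text \<open>The fixed point is sought among forcings: \<open>S f\<close> solves the linear equation
  with forcing \<open>f\<close>, and \<open>T f\<close> is the nonlinearity along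
  \<open>S f\<close>. The energy inequality keeps \<open>S f\<close> within \<open>2 * K\<close> and
  makes \<open>T\<close> contract squared L2 distances by 1/4. The length \<tau> depends on
  \<open>K\<close> only, not on the initial time or value, as continuation requires.\<close>

lemma local_existence:
  assumes K: "0 < K"
  shows "\<exists>\<tau>>0. \<forall>a\<ge>0. \<forall>ya. norm ya \<le> K \<longrightarrow> (\<exists>y. y a = ya \<and> sol a (a + \<tau>) y)"
proof -
  \<comment> \<open>Chosen so that the factor of \<rho> in \<open>G_difference\<close> with
    \<open>E = (2 * K)\<^sup>2\<close> is 1/8 apart from the time term; \<tau> is chosen to make
    that term at most another 1/8.\<close>
  define \<epsilon> where "\<epsilon> = 1 / (8 * (1 + 8 * K\<^sup>2))"
  have \<epsilon>: "0 < \<epsilon>" "\<epsilon> + 2 * (2 * K)\<^sup>2 * \<epsilon> = 1/8"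
  proof -
    have p: "0 < 1 + 8 * K\<^sup>2" by (simp add: add_pos_nonneg)
    then show "0 < \<epsilon>" by (simp add: \<epsilon>_def)
    have "\<epsilon> + 2 * (2 * K)\<^sup>2 * \<epsilon> = \<epsilon> * (1 + 8 * K\<^sup>2)" by (simp add: algebra_simps power_mult_distrib)
    also have "\<dots> = 1/8" using p by (simp add: \<epsilon>_def)
    finally show "\<epsilon> + 2 * (2 * K)\<^sup>2 * \<epsilon> = 1/8" .
  qed
  have K2: "0 < 2 * K" using K by simp
  from G_lip[OF \<epsilon>(1) K2] obtain C where C0: "0 \<le> C"
    and "\<forall>a b. 0 \<le> a \<longrightarrow> (AE t in lebesgue_on {a..b}. lip \<epsilon> (2 * K) C (G t))" by (elim exE conjE)
  then have C: "0 \<le> C" "0 \<le> a \<Longrightarrow> AE t in lebesgue_on {a..b}. lip \<epsilon> (2 * K) C (G t)" for a b by simp_all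
  define \<tau> where "\<tau> = 1 / (8 * (C + 1))"
  have \<tau>: "0 < \<tau>" "C * \<tau> \<le> 1/8" using C by (auto simp: \<tau>_def field_simps)
  have "\<exists>y. y a = ya \<and> sol a (a + \<tau>) y" if a: "0 \<le> a" and ya: "norm ya \<le> K" for a ya
  proof -
    define b where "b = a + \<tau>"
    have ab: "a \<le> b" "b - a = \<tau>" using \<tau> by (auto simp: b_def)
    let ?M = "lebesgue_on {a..b}"
    note Gb = C(2)[OF a, of b]
    define good where "good y w \<longleftrightarrow> maxreg a b y w \<and> (\<forall>t\<in>{a..b}. norm (y t) \<le> 2 * K) \<and> (LINT t|?M. (norm (L (y t)))\<^sup>2) \<le> (2 * K)\<^sup>2" for y w
    \<comment> \<open>In the energy inequality this radius gives
      \<open>K\<^sup>2 + 3 * K\<^sup>2 = (2 * K)\<^sup>2\<close>. The image of \<open>T\<close>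
      obeys the smaller bound \<open>K\<^sup>2\<close>, and the slack absorbs the factor 2 lost in
      \<open>norm_add_sq_le\<close> when the limit of the iterates is shown to be
      admissible.\<close>
    define adm where "adm f \<longleftrightarrow> sqint ?M f \<and> (LINT t|?M. (norm (f t))\<^sup>2) \<le> 3 * K\<^sup>2" for f :: "real \<Rightarrow> 'h"
    define S where "S f = (SOME y. y a = ya \<and> maxreg a b y (\<lambda>t. f t - L (y t)))" for f
    have S: "S f a = ya" "maxreg a b (S f) (\<lambda>t. f t - L (S f t))" if "adm f" for f
      using someI_ex[OF linear_solution[OF ab(1), of f ya]] that unfolding S_def adm_def by auto
    have mono: "(LINT s|lebesgue_on {a..t}. (norm (f s))\<^sup>2) \<le> (LINT s|?M. (norm (f s))\<^sup>2)"
      if "sqint ?M f" "t \<in> {a..b}" for f :: "real \<Rightarrow> 'h" and t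
      by (rule integral_mono_lebesgue_on_AE[OF sqint_int[OF that(1)]]) (use that(2) in auto)
    have good: "good (S f) (\<lambda>t. f t - L (S f t))" if f: "adm f" for f
    proof -
      have sf: "sqint ?M f" and f3: "(LINT t|?M. (norm (f t))\<^sup>2) \<le> 3 * K\<^sup>2" using f by (auto simp: adm_def)
      have K2: "(norm (S f a))\<^sup>2 \<le> K\<^sup>2" using ya S(1)[OF f] by (simp add: power_mono)
      have *: "(norm (S f t))\<^sup>2 + (LINT s|lebesgue_on {a..t}. (norm (L (S f s)))\<^sup>2) \<le> (2 * K)\<^sup>2" if t: "t \<in> {a..b}" for t
        using energy_le[OF S(2)[OF f] t] mono[OF sf t] f3 K2 by (simp add: power_mult_distrib)
      have "norm (S f t) \<le> 2 * K" if t: "t \<in> {a..b}" for t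
      proof (rule power2_le_imp_le)
        have "0 \<le> (LINT s|lebesgue_on {a..t}. (norm (L (S f s)))\<^sup>2)" by simp
        with *[OF t] show "(norm (S f t))\<^sup>2 \<le> (2 * K)\<^sup>2" by linarith
      qed (use K in simp)
      moreover have "(LINT s|?M. (norm (L (S f s)))\<^sup>2) \<le> (2 * K)\<^sup>2"
      proof -
        have "0 \<le> (norm (S f b))\<^sup>2" by simp
        moreover have "b \<in> {a..b}" using ab(1) by simp
        note *[OF this]
        ultimately show ?thesis by linarith
      qed
      ultimately show ?thesis using S(2)[OF f] by (simp add: good_def)
    qed
    define T where "T f t = G t (S f t)" for f t
    have T: "sqint ?M (T f)" "(LINT t|?M. (norm (T f t))\<^sup>2) \<le> K\<^sup>2" if f: "adm f" for f
    proof -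
      note g = good[OF f, unfolded good_def]
      have \<epsilon>0: "0 \<le> \<epsilon>" using \<epsilon>(1) by simp
      have g2: "\<And>t. t \<in> {a..b} \<Longrightarrow> norm (S f t) \<le> 2 * K" using g by blast
      note * = G_sqint[OF a ab(1) Gb \<epsilon>0 C(1) g[THEN conjunct1] g2 g[THEN conjunct2, THEN conjunct2]]
      show "sqint ?M (T f)" using *(1) by (simp add: T_def[abs_def])
      have "(LINT t|?M. (norm (T f t))\<^sup>2) \<le> (2 * K)\<^sup>2 * (1/8 + C * \<tau>)"
        using *(2) unfolding \<epsilon>(2) ab(2) T_def .
      also have "\<dots> \<le> (2 * K)\<^sup>2 * (1/4)" using \<tau>(2) by (intro mult_left_mono) auto
      finally show "(LINT t|?M. (norm (T f t))\<^sup>2) \<le> K\<^sup>2" by (simp add: power_mult_distrib)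
    qed
    have admT: "adm (T f)" if "adm f" for f using T[OF that] zero_le_power2[of K] unfolding adm_def by linarith
    have contr: "(LINT t|?M. (norm (T f t - T g t))\<^sup>2) \<le> (1/4) * (LINT t|?M. (norm (f t - g t))\<^sup>2)"
      if f: "adm f" and g: "adm g" for f g
    proof -
      define \<rho> where "\<rho> = (LINT t|?M. (norm (f t - g t))\<^sup>2)"
      have sfg: "sqint ?M (\<lambda>t. f t - g t)" using f g by (auto simp: adm_def intro: sqint_diff)
      have *: "(norm (S f t - S g t))\<^sup>2 + (LINT s|lebesgue_on {a..t}. (norm (L (S f s - S g s)))\<^sup>2) \<le> \<rho>" if t: "t \<in> {a..b}" for t
        using energy_le[OF reg_diff_forced[OF S(2)[OF f] S(2)[OF g] ab(1)] t] mono[OF sfg t] S(1)[OF f] S(1)[OF g]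
        by (simp add: \<rho>_def)
      have r1: "(norm (S f t - S g t))\<^sup>2 \<le> \<rho>" if t: "t \<in> {a..b}" for t
      proof -
        have "0 \<le> (LINT s|lebesgue_on {a..t}. (norm (L (S f s - S g s)))\<^sup>2)" by simp
        with *[OF t] show ?thesis by linarith
      qed
      have r2: "(LINT s|?M. (norm (L (S f s - S g s)))\<^sup>2) \<le> \<rho>"
      proof -
        have "0 \<le> (norm (S f b - S g b))\<^sup>2" by simp
        moreover have "b \<in> {a..b}" using ab(1) by simp
        note *[OF this]
        ultimately show ?thesis by linarith
      qed
      have \<epsilon>0: "0 \<le> \<epsilon>" using \<epsilon>(1) by simp
      note gf = good[OF f, unfolded good_def] and gg = good[OF g, unfolded good_def]
      have "(LINT t|?M. (norm (T f t - T g t))\<^sup>2) \<le> \<rho> * (\<epsilon> + 2 * (2 * K)\<^sup>2 * \<epsilon> + C * (b - a))"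
        unfolding T_def
        by (rule G_difference(2)[OF a ab(1) Gb \<epsilon>0 C(1) gf[THEN conjunct1] _ gf[THEN conjunct2, THEN conjunct2]
             gg[THEN conjunct1] _ gg[THEN conjunct2, THEN conjunct2] r1 r2]) (use gf gg in blast)+
      also have "\<dots> = \<rho> * (1/8 + C * \<tau>)" unfolding \<epsilon>(2) ab(2) ..
      also have "\<dots> \<le> \<rho> * (1/4)" using \<tau>(2) by (intro mult_left_mono) (auto simp: \<rho>_def)
      finally show ?thesis by (simp add: \<rho>_def)
    qed
    define F where "F k = (T ^^ k) (\<lambda>_. 0)" for k
    have F0: "adm (F 0)" by (simp add: F_def adm_def sqint_def)
    have FS: "F (Suc k) = T (F k)" for k by (simp add: F_def)
    have admF: "adm (F k)" for k by (induction k) (auto simp: F0 FS admT)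
    define c where "c = (LINT t|?M. (norm (F (Suc 0) t - F 0 t))\<^sup>2)"
    have geo: "(LINT t|?M. (norm (F (Suc k) t - F k t))\<^sup>2) \<le> c * (1/4)^k" for k
    proof (induction k)
      case (Suc k)
      have "(LINT t|?M. (norm (F (Suc (Suc k)) t - F (Suc k) t))\<^sup>2) \<le> (1/4) * (LINT t|?M. (norm (F (Suc k) t - F k t))\<^sup>2)"
        unfolding FS[of "Suc k"] using contr[OF admF admF, of "Suc k" k] by (simp add: FS)
      with Suc show ?case by simp
    qed (simp add: c_def)
    have sqF: "sqint ?M (F k)" for k using admF by (simp add: adm_def)
    obtain f where f: "sqint ?M f" and flim: "(\<lambda>k. LINT t|?M. (norm (f t - F k t))\<^sup>2) \<longlonglongrightarrow> 0"
      using sqint_Cauchy_limit[OF sqF geo] by blast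
    have "(LINT t|?M. (norm (f t))\<^sup>2) \<le> 2 * K\<^sup>2 + 2 * 0"
    proof (rule LIMSEQ_le_const[OF tendsto_add[OF tendsto_const tendsto_mult[OF tendsto_const LIMSEQ_Suc[OF flim]]]])
      have "(LINT t|?M. (norm (f t))\<^sup>2) \<le> 2 * K\<^sup>2 + 2 * (LINT t|?M. (norm (f t - F (Suc k) t))\<^sup>2)" for k
      proof -
        note i = sqint_int[OF sqint_diff[OF f sqF[of "Suc k"]]] sqint_int[OF sqF[of "Suc k"]]
        have "(LINT t|?M. (norm (f t))\<^sup>2) \<le> (LINT t|?M. 2 * (norm (F (Suc k) t))\<^sup>2 + 2 * (norm (f t - F (Suc k) t))\<^sup>2)"
        proof (rule integral_mono[OF sqint_int[OF f]])
          show "(norm (f t))\<^sup>2 \<le> 2 * (norm (F (Suc k) t))\<^sup>2 + 2 * (norm (f t - F (Suc k) t))\<^sup>2" for t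
            using norm_add_sq_le[of "F (Suc k) t" "f t - F (Suc k) t"] by simp
        qed (use i in simp)
        also have "\<dots> = 2 * (LINT t|?M. (norm (F (Suc k) t))\<^sup>2) + 2 * (LINT t|?M. (norm (f t - F (Suc k) t))\<^sup>2)"
          using i by simp
        also have "(LINT t|?M. (norm (F (Suc k) t))\<^sup>2) \<le> K\<^sup>2" unfolding FS by (rule T(2)[OF admF])
        finally show ?thesis by simp
      qed
      then show "\<exists>N. \<forall>k\<ge>N. (LINT t|?M. (norm (f t))\<^sup>2) \<le> 2 * K\<^sup>2 + 2 * (LINT t|?M. (norm (f t - F (Suc k) t))\<^sup>2)" by blast
    qed
    then have "(LINT t|?M. (norm (f t))\<^sup>2) \<le> 3 * K\<^sup>2" using zero_le_power2[of K] by linarith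
    then have admf: "adm f" using f by (simp add: adm_def)
    have sqT: "sqint ?M (T f)" by (rule T(1)[OF admf])
    note dT = sqint_int[OF sqint_diff[OF sqT f]]
    \<comment> \<open>Both \<open>f\<close> and \<open>T f\<close> are compared with the iterate
      \<open>F (Suc k)\<close>, whose distance to \<open>T f\<close> is controlled by the
      contraction.\<close>
    have "(LINT t|?M. (norm (T f t - f t))\<^sup>2) \<le> 2 * 0 + (1/2) * 0"
    proof (rule LIMSEQ_le_const[OF tendsto_add[OF tendsto_mult[OF tendsto_const LIMSEQ_Suc[OF flim]] tendsto_mult[OF tendsto_const flim]]])
      have "(LINT t|?M. (norm (T f t - f t))\<^sup>2) \<le> 2 * (LINT t|?M. (norm (f t - F (Suc k) t))\<^sup>2) + (1/2) * (LINT t|?M. (norm (f t - F k t))\<^sup>2)" for k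
      proof -
        note i = sqint_int[OF sqint_diff[OF f sqF[of "Suc k"]]] sqint_int[OF sqint_diff[OF sqT sqF[of "Suc k"]]]
        have "(LINT t|?M. (norm (T f t - f t))\<^sup>2) \<le> (LINT t|?M. 2 * (norm (f t - F (Suc k) t))\<^sup>2 + 2 * (norm (T f t - F (Suc k) t))\<^sup>2)"
        proof (rule integral_mono[OF dT])
          show "(norm (T f t - f t))\<^sup>2 \<le> 2 * (norm (f t - F (Suc k) t))\<^sup>2 + 2 * (norm (T f t - F (Suc k) t))\<^sup>2" for t
            using norm_diff_sq_le[of "T f t - F (Suc k) t" "f t - F (Suc k) t"] by simp
        qed (use i in simp)
        also have "\<dots> = 2 * (LINT t|?M. (norm (f t - F (Suc k) t))\<^sup>2) + 2 * (LINT t|?M. (norm (T f t - F (Suc k) t))\<^sup>2)"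
          using i by simp
        also have "(LINT t|?M. (norm (T f t - F (Suc k) t))\<^sup>2) \<le> (1/4) * (LINT t|?M. (norm (f t - F k t))\<^sup>2)"
          unfolding FS by (rule contr[OF admf admF])
        finally show ?thesis by simp
      qed
      then show "\<exists>N. \<forall>k\<ge>N. (LINT t|?M. (norm (T f t - f t))\<^sup>2) \<le> 2 * (LINT t|?M. (norm (f t - F (Suc k) t))\<^sup>2) + (1/2) * (LINT t|?M. (norm (f t - F k t))\<^sup>2)" by blast
    qed
    then have "(LINT t|?M. (norm (T f t - f t))\<^sup>2) = 0" by (intro antisym) auto
    then have "AE t in ?M. (norm (T f t - f t))\<^sup>2 = 0"
      by (subst (asm) integral_nonneg_eq_0_iff_AE[OF dT]) auto
    then have "AE t in ?M. f t - L (S f t) = G t (S f t) - L (S f t)"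
      by eventually_elim (simp add: T_def)
    then have "sol a b (S f)"
      unfolding sol_def by (intro reg_cong[OF S(2)[OF admf] ab(1)]) auto
    then show ?thesis using S(1)[OF admf] unfolding b_def by blast
  qed
  then show ?thesis using \<tau>(1) by blast
qed

text \<open>With \<epsilon> = 1 the term |L(y - z)|^2 cancels against the left side of
  \<open>energy_le\<close>. What remains carries the weight |Ly|^2 + |Lz|^2 + C, which is integrable
  but not bounded in time; hence the form of \<open>gronwall_zero\<close>.\<close>

lemma sol_unique:
  assumes y: "sol a b y" and z: "sol a b z" and yz: "y a = z a" and a: "0 \<le> a" and t: "t \<in> {a..b}"
  shows "y t = z t"
proof -
  have ab: "a \<le> b" using t by simp
  note ry = y[unfolded sol_def] and rz = z[unfolded sol_def]
  obtain K1 where K1: "\<forall>t\<in>{a..b}. norm (y t) \<le> K1"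
    using compact_imp_bounded[OF compact_continuous_image[OF reg_cont[OF ry] compact_Icc]] unfolding bounded_iff by auto
  obtain K2 where K2: "\<forall>t\<in>{a..b}. norm (z t) \<le> K2"
    using compact_imp_bounded[OF compact_continuous_image[OF reg_cont[OF rz] compact_Icc]] unfolding bounded_iff by auto
  define K where "K = max 1 (max K1 K2)"
  have "0 < K" by (simp add: K_def)
  from G_lip[OF zero_less_one this] obtain C where "0 \<le> C"
    and "\<forall>a b. 0 \<le> a \<longrightarrow> (AE t in lebesgue_on {a..b}. lip 1 K C (G t))" by (elim exE conjE)
  then have C: "0 \<le> C" "AE t in lebesgue_on {a..b}. lip 1 K C (G t)" using a by simp_all
  define \<kappa> where "\<kappa> t = (norm (L (y t)))\<^sup>2 + (norm (L (z t)))\<^sup>2 + C" for t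
  have d: "maxreg a b (\<lambda>t. y t - z t) (\<lambda>t. (G t (y t) - G t (z t)) - L (y t - z t))"
    by (rule reg_diff_forced[OF ry rz ab])
  have "(norm (y t - z t))\<^sup>2 = 0"
  proof (rule gronwall_zero[OF _ _ _ _ _ t])
    show \<kappa>: "integrable (lebesgue_on {a..b}) \<kappa>"
      unfolding \<kappa>_def using sqint_int[OF reg_L[OF ry]] sqint_int[OF reg_L[OF rz]] by simp
    show "0 \<le> \<kappa> t" for t using C by (simp add: \<kappa>_def)
    show cd: "continuous_on {a..b} (\<lambda>t. (norm (y t - z t))\<^sup>2)" by (intro continuous_intros reg_cont[OF d])
    fix t assume t: "t \<in> {a..b}"
    have sub: "{a..t} \<subseteq> {a..b}" using t by auto
    have d': "maxreg a t (\<lambda>t. y t - z t) (\<lambda>t. (G t (y t) - G t (z t)) - L (y t - z t))"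
      by (rule reg_subinterval[OF d]) (use t in auto)
    have i1: "integrable (lebesgue_on {a..t}) (\<lambda>s. (norm (L (y s - z s)))\<^sup>2)" by (rule sqint_int[OF reg_L[OF d']])
    have i2: "integrable (lebesgue_on {a..t}) (\<lambda>s. \<kappa> s * (norm (y s - z s))\<^sup>2)"
      by (rule integrable_mult_continuous[OF integrable_lebesgue_on_subset[OF \<kappa> sub] continuous_on_subset[OF cd sub]]) auto
    have "AE s in lebesgue_on {a..t}. lip 1 K C (G s) \<and> y s \<in> D \<and> z s \<in> D"
      by (intro AE_conjI AE_lebesgue_on_subset[OF C(2) sub] AE_lebesgue_on_subset[OF reg_D[OF ry] sub] AE_lebesgue_on_subset[OF reg_D[OF rz] sub]) auto
    moreover have "AE s in lebesgue_on {a..t}. s \<in> {a..b}" by (rule AE_I2) (use t in auto)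
    ultimately have ae: "AE s in lebesgue_on {a..t}. (norm (G s (y s) - G s (z s)))\<^sup>2 \<le> (norm (L (y s - z s)))\<^sup>2 + \<kappa> s * (norm (y s - z s))\<^sup>2"
    proof eventually_elim
      case (elim s)
      then have "norm (y s) \<le> K" "norm (z s) \<le> K" using K1 K2 by (auto simp: K_def le_max_iff_disj)
      with elim have "(norm (G s (y s) - G s (z s)))\<^sup>2 \<le> 1 * ((norm (L (y s - z s)))\<^sup>2
          + ((norm (L (y s)))\<^sup>2 + (norm (L (z s)))\<^sup>2) * (norm (y s - z s))\<^sup>2) + C * (norm (y s - z s))\<^sup>2"
        by (intro lip_D) auto
      then show ?case by (simp add: \<kappa>_def algebra_simps)
    qed
    have "(LINT s|lebesgue_on {a..t}. (norm (G s (y s) - G s (z s)))\<^sup>2) \<le> (LINT s|lebesgue_on {a..t}. (norm (L (y s - z s)))\<^sup>2 + \<kappa> s * (norm (y s - z s))\<^sup>2)"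
      by (rule integral_mono_AE[OF sqint_int[OF reg_forcing[OF d']] _ ae]) (use i1 i2 in simp)
    also have "\<dots> = (LINT s|lebesgue_on {a..t}. (norm (L (y s - z s)))\<^sup>2) + (LINT s|lebesgue_on {a..t}. \<kappa> s * (norm (y s - z s))\<^sup>2)"
      using i1 i2 by simp
    finally show "(norm (y t - z t))\<^sup>2 \<le> (LINT s|lebesgue_on {a..t}. \<kappa> s * (norm (y s - z s))\<^sup>2)"
      using energy_le[OF d t] yz by simp
  qed simp
  then show ?thesis by simp
qed

lemma sol_subinterval: "sol a b y \<Longrightarrow> a \<le> a' \<Longrightarrow> a' \<le> b' \<Longrightarrow> b' \<le> b \<Longrightarrow> sol a' b' y"
  unfolding sol_def by (rule reg_subinterval)

lemma sol_cong: "sol a b y \<Longrightarrow> a \<le> b \<Longrightarrow> (\<And>t. t \<in> {a..b} \<Longrightarrow> y t = z t) \<Longrightarrow> sol a b z"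
  unfolding sol_def by (erule reg_cong) (auto intro!: AE_I2)

lemma sol_combine: "sol a b y \<Longrightarrow> sol b c y \<Longrightarrow> a \<le> b \<Longrightarrow> b \<le> c \<Longrightarrow> sol a c y"
  unfolding sol_def by (rule reg_combine)

text \<open>The bound by \<open>K\<close> holds on every interval of existence, so each restart
  gains the same length \<tau>; uniqueness makes the solutions on growing intervals
  consistent.\<close>

lemma global_existence:
  assumes K: "0 < K" "norm y0 \<le> K"
    and bd: "\<And>b y t. 0 \<le> b \<Longrightarrow> sol 0 b y \<Longrightarrow> y 0 = y0 \<Longrightarrow> t \<in> {0..b} \<Longrightarrow> norm (y t) \<le> K"
  shows "\<exists>y. y 0 = y0 \<and> (\<forall>T>0. sol 0 T y)"
proof -
  from local_existence[OF K(1)] obtain \<tau> where \<tau>0: "\<tau> > 0"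
    and \<tau>1: "\<forall>a\<ge>0. \<forall>ya. norm ya \<le> K \<longrightarrow> (\<exists>y. y a = ya \<and> sol a (a + \<tau>) y)" by (elim exE conjE)
  have \<tau>: "\<tau> > 0" "0 \<le> a \<Longrightarrow> norm ya \<le> K \<Longrightarrow> \<exists>y. y a = ya \<and> sol a (a + \<tau>) y" for a ya
    using \<tau>0 \<tau>1[rule_format, of a ya] by simp_all
  have "\<exists>y. y 0 = y0 \<and> sol 0 (real (Suc n) * \<tau>) y" for n
  proof (induction n)
    case 0 show ?case using \<tau>(2)[of 0 y0] K by simp
  next
    case (Suc n)
    define b where "b = real (Suc n) * \<tau>"
    have b: "0 \<le> b" "b + \<tau> = real (Suc (Suc n)) * \<tau>" using \<tau>(1) by (auto simp: b_def algebra_simps)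
    obtain y where y: "y 0 = y0" "sol 0 b y" using Suc by (auto simp: b_def)
    obtain z where z: "z b = y b" "sol b (b + \<tau>) z" using \<tau>(2)[OF b(1) bd[OF b(1) y(2,1), of b]] b(1) by auto
    define x where "x t = (if t \<le> b then y t else z t)" for t
    have x1: "sol 0 b x" by (rule sol_cong[OF y(2) b(1)]) (simp add: x_def)
    have x2: "sol b (b + \<tau>) x" by (rule sol_cong[OF z(2)]) (use \<tau>(1) z(1) in \<open>auto simp: x_def\<close>)
    have "sol 0 (b + \<tau>) x" by (rule sol_combine[OF x1 x2]) (use b(1) \<tau>(1) in auto)
    moreover have "x 0 = y0" using b(1) y(1) by (simp add: x_def)
    ultimately show ?case unfolding b(2) by blast
  qed
  then obtain Y where Y: "\<And>n. Y n 0 = y0" "\<And>n. sol 0 (real (Suc n) * \<tau>) (Y n)" by metis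
  \<comment> \<open>\<open>Y n\<close> lives up to time (n + 1) \<tau>, so the rounded-up quotient
    is a large enough index; any other valid index gives the same value by uniqueness.\<close>
  define y where "y t = Y (nat \<lceil>t / \<tau>\<rceil>) t" for t
  have eq: "Y n t = y t" if t: "t \<in> {0..real (Suc n) * \<tau>}" for n t
  proof -
    define m where "m = nat \<lceil>t / \<tau>\<rceil>"
    have "t / \<tau> \<le> real m" unfolding m_def by linarith
    then have tm: "t \<le> real (Suc m) * \<tau>" using \<tau>(1) t by (simp add: field_simps)
    have "sol 0 t (Y n)" "sol 0 t (Y m)"
      using t tm by (auto intro!: sol_subinterval[OF Y(2)[of n]] sol_subinterval[OF Y(2)[of m]])
    then have "Y n t = Y m t" by (rule sol_unique) (use t Y in auto)
    then show ?thesis by (simp add: y_def m_def)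
  qed
  have "sol 0 T y" if T: "T > 0" for T
  proof -
    obtain n where "T / \<tau> < real n" using reals_Archimedean2 by blast
    then have Tn: "T \<le> real (Suc n) * \<tau>" using \<tau>(1) by (simp add: field_simps)
    have "sol 0 T (Y n)" by (rule sol_subinterval[OF Y(2)[of n]]) (use T Tn in auto)
    then show ?thesis by (rule sol_cong) (use T Tn eq in auto)
  qed
  moreover have "y 0 = y0" using eq[of 0 0] Y(1) \<tau>(1) by simp
  ultimately show ?thesis by blast
qed

end

section \<open>Estimate of the nonlinearity\<close>

lemma rpow_nonneg: "0 \<le> rpow x a"
  by (simp add: rpow_def)

lemma rpow_le_powr: "0 \<le> x \<Longrightarrow> x \<le> m \<Longrightarrow> 0 < m \<Longrightarrow> 0 \<le> a \<Longrightarrow> rpow x a \<le> m powr a"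
  by (auto simp: rpow_def intro: powr_mono2)

text \<open>\<open>X\<close> is the point where \<open>x powr \<theta>\<close> equals
  \<open>\<beta> * x\<close>: below it the power is bounded by its value at \<open>X\<close>, above
  it the linear function dominates since \<theta> < 1.\<close>

lemma powr_le_linear:
  fixes \<theta> \<beta> :: real
  assumes "0 \<le> \<theta>" "\<theta> < 1" "0 < \<beta>"
  shows "\<exists>C\<ge>0. \<forall>x>0. x powr \<theta> \<le> \<beta> * x + C"
proof (intro exI conjI allI impI)
  define X where "X = (1/\<beta>) powr (1 / (1-\<theta>))"
  show "0 \<le> X powr \<theta>" by simp
  fix x :: real assume x: "x > 0"
  show "x powr \<theta> \<le> \<beta> * x + X powr \<theta>"
  proof (cases "x \<le> X")
    case True
    then have "x powr \<theta> \<le> X powr \<theta>" using x assms by (intro powr_mono2) auto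
    moreover have "0 \<le> \<beta> * x" using x assms by simp
    ultimately show ?thesis by linarith
  next
    case False
    have "1/\<beta> = X powr (1-\<theta>)" using assms by (simp add: X_def powr_powr)
    also have "\<dots> \<le> x powr (1-\<theta>)" using False assms by (intro powr_mono2) (auto simp: X_def)
    finally have "1 \<le> \<beta> * x powr (1-\<theta>)" using assms by (simp add: field_simps)
    then have "x powr \<theta> * 1 \<le> x powr \<theta> * (\<beta> * x powr (1-\<theta>))" by (intro mult_left_mono) auto
    also have "\<dots> = \<beta> * x" using x by (simp add: powr_add[symmetric])
    finally show ?thesis by (simp add: add_increasing2)
  qed
qed

text \<open>Scaling by \<open>d\<close>: the maximum \<open>m\<close> dominates 1,
  \<open>q1\<close>, \<open>q2\<close> and \<open>l / d\<close>, so a summand is at most a constant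
  times m to the power \<zeta>2 + \<delta>2 and d to the power \<delta>1 + \<delta>2. As \<delta>1 +
  \<delta>2 is at least 1, one factor \<open>d\<close> splits off and the surplus is bounded by a
  power of \<open>K\<close>; the exponent of \<open>m\<close> stays at most the largest \<zeta>2 +
  \<delta>2, which is below 1.\<close>

lemma holder_sum_bound:
  fixes \<zeta>1 \<zeta>2 \<delta>1 \<delta>2 :: "nat \<Rightarrow> real"
  assumes n: "n \<ge> 1" and ex: "\<forall>j\<in>{1..n}. \<zeta>1 j \<ge> 0 \<and> \<zeta>2 j \<ge> 0 \<and> \<delta>1 j \<ge> 0 \<and> \<delta>2 j \<ge> 0 \<and>
                   \<zeta>2 j + \<delta>2 j < 1 \<and> \<delta>1 j + \<delta>2 j \<ge> 1"
    and K: "1 \<le> K"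
  shows "\<exists>C\<ge>0. \<exists>\<theta>\<ge>0. \<theta> < 1 \<and> (\<forall>p1 p2 q1 q2 d l. 0 \<le> p1 \<longrightarrow> p1 \<le> K \<longrightarrow> 0 \<le> p2 \<longrightarrow> p2 \<le> K \<longrightarrow> 0 \<le> q1 \<longrightarrow> 0 \<le> q2 \<longrightarrow>
     0 < d \<longrightarrow> d \<le> K \<longrightarrow> 0 \<le> l \<longrightarrow>
      (\<Sum>j=1..n. (rpow p1 (\<zeta>1 j) * rpow q1 (\<zeta>2 j) + rpow p2 (\<zeta>1 j) * rpow q2 (\<zeta>2 j))
          * rpow d (\<delta>1 j) * rpow l (\<delta>2 j)) \<le> C * max (max 1 q1) (max q2 (l / d)) powr \<theta> * d)"
proof -
  define \<theta> where "\<theta> = Max ((\<lambda>j. \<zeta>2 j + \<delta>2 j) ` {1..n})"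
  define cc where "cc j = 2 * K powr (\<zeta>1 j) * K powr (\<delta>1 j + \<delta>2 j - 1)" for j
  have le\<theta>: "\<zeta>2 j + \<delta>2 j \<le> \<theta>" if "j \<in> {1..n}" for j unfolding \<theta>_def using that by (intro Max_ge) auto
  have "\<theta> \<in> (\<lambda>j. \<zeta>2 j + \<delta>2 j) ` {1..n}" unfolding \<theta>_def using n by (intro Max_in) auto
  then have \<theta>: "0 \<le> \<theta>" "\<theta> < 1" using ex by force+
  show ?thesis
  proof (rule exI[of _ "\<Sum>j=1..n. cc j"], rule conjI, simp add: cc_def sum_nonneg, rule exI[of _ \<theta>], intro conjI allI impI \<theta>)
    fix p1 p2 q1 q2 d l :: real
    assume p: "0 \<le> p1" "p1 \<le> K" "0 \<le> p2" "p2 \<le> K" and q: "0 \<le> q1" "0 \<le> q2" and d: "0 < d" "d \<le> K" and l: "0 \<le> l"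
    define m where "m = max (max 1 q1) (max q2 (l / d))"
    have m: "1 \<le> m" "q1 \<le> m" "q2 \<le> m" "l / d \<le> m" by (auto simp: m_def)
    then have lm: "l \<le> m * d" using d by (simp add: field_simps)
    have "(\<Sum>j=1..n. (rpow p1 (\<zeta>1 j) * rpow q1 (\<zeta>2 j) + rpow p2 (\<zeta>1 j) * rpow q2 (\<zeta>2 j))
          * rpow d (\<delta>1 j) * rpow l (\<delta>2 j)) \<le> (\<Sum>j=1..n. cc j * (m powr \<theta> * d))"
    proof (rule sum_mono)
      fix j assume j: "j \<in> {1..n}"
      then have E: "\<zeta>1 j \<ge> 0" "\<zeta>2 j \<ge> 0" "\<delta>1 j \<ge> 0" "\<delta>2 j \<ge> 0" "\<zeta>2 j + \<delta>2 j < 1" "\<delta>1 j + \<delta>2 j \<ge> 1" using ex by auto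
      have a: "rpow p1 (\<zeta>1 j) * rpow q1 (\<zeta>2 j) \<le> K powr (\<zeta>1 j) * m powr (\<zeta>2 j)"
        "rpow p2 (\<zeta>1 j) * rpow q2 (\<zeta>2 j) \<le> K powr (\<zeta>1 j) * m powr (\<zeta>2 j)"
        using p q m K E by (auto intro!: mult_mono rpow_le_powr rpow_nonneg)
      have "rpow d (\<delta>1 j) * rpow l (\<delta>2 j) \<le> d powr (\<delta>1 j) * (m * d) powr (\<delta>2 j)"
        using d l lm m E by (intro mult_mono rpow_le_powr rpow_nonneg) auto
      also have "\<dots> = m powr (\<delta>2 j) * d powr (\<delta>1 j + \<delta>2 j - 1 + 1)"
        using d m by (simp add: powr_mult powr_add)
      also have "\<dots> = m powr (\<delta>2 j) * (d powr (\<delta>1 j + \<delta>2 j - 1) * d)"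
        using d by (subst powr_add) simp
      also have "\<dots> \<le> m powr (\<delta>2 j) * (K powr (\<delta>1 j + \<delta>2 j - 1) * d)"
        using d E by (intro mult_left_mono mult_right_mono powr_mono2) auto
      finally have b: "rpow d (\<delta>1 j) * rpow l (\<delta>2 j) \<le> m powr (\<delta>2 j) * (K powr (\<delta>1 j + \<delta>2 j - 1) * d)" .
      have "(rpow p1 (\<zeta>1 j) * rpow q1 (\<zeta>2 j) + rpow p2 (\<zeta>1 j) * rpow q2 (\<zeta>2 j)) * (rpow d (\<delta>1 j) * rpow l (\<delta>2 j))
         \<le> (2 * (K powr (\<zeta>1 j) * m powr (\<zeta>2 j))) * (m powr (\<delta>2 j) * (K powr (\<delta>1 j + \<delta>2 j - 1) * d))"
        using a by (intro mult_mono[OF _ b]) (auto intro!: mult_nonneg_nonneg add_nonneg_nonneg rpow_nonneg)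
      also have "\<dots> = cc j * (m powr (\<zeta>2 j + \<delta>2 j) * d)" by (simp add: cc_def powr_add)
      also have "\<dots> \<le> cc j * (m powr \<theta> * d)"
        using le\<theta>[OF j] m d by (intro mult_left_mono mult_right_mono powr_mono) (auto simp: cc_def)
      finally show "(rpow p1 (\<zeta>1 j) * rpow q1 (\<zeta>2 j) + rpow p2 (\<zeta>1 j) * rpow q2 (\<zeta>2 j))
          * rpow d (\<delta>1 j) * rpow l (\<delta>2 j) \<le> cc j * (m powr \<theta> * d)" by (simp add: mult.assoc)
    qed
    then show "(\<Sum>j=1..n. (rpow p1 (\<zeta>1 j) * rpow q1 (\<zeta>2 j) + rpow p2 (\<zeta>1 j) * rpow q2 (\<zeta>2 j))
          * rpow d (\<delta>1 j) * rpow l (\<delta>2 j)) \<le> (\<Sum>j=1..n. cc j) * m powr \<theta> * d"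
      by (simp add: sum_distrib_right mult.assoc)
  qed
qed

text \<open>After squaring, m^2 appears to the power \<theta> < 1 and \<open>powr_le_linear\<close>
  replaces this by a small multiple of m^2 plus a constant. Multiplied by d^2, m^2 is at most the
  sum of squares in \<open>lip\<close> plus d^2, because \<open>l / d\<close> turns into
  \<open>l\<close>; the entry 1 of the maximum is the reason for the extra \<epsilon> in the
  constant.\<close>

lemma (in spectral) nonlinearity_bound:
  fixes N :: "real \<Rightarrow> 'v \<Rightarrow> 'h" and \<zeta>1 \<zeta>2 \<delta>1 \<delta>2 :: "nat \<Rightarrow> real"
  assumes N_const: "C_N \<ge> 0" "n \<ge> 1"
    and N_exps: "\<forall>j\<in>{1..n}. \<zeta>1 j \<ge> 0 \<and> \<zeta>2 j \<ge> 0 \<and> \<delta>1 j \<ge> 0 \<and> \<delta>2 j \<ge> 0 \<and>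
                   \<zeta>2 j + \<delta>2 j < 1 \<and> \<delta>1 j + \<delta>2 j \<ge> 1"
    and N_bd: "\<forall>t>0. \<forall>y1\<in>DA \<iota> A. \<forall>y2\<in>DA \<iota> A.
        norm (N t y1 - N t y2) \<le> C_N * (\<Sum>j=1..n.
          (rpow (norm y1) (\<zeta>1 j) * rpow (DA_norm \<iota> A y1) (\<zeta>2 j)
           + rpow (norm y2) (\<zeta>1 j) * rpow (DA_norm \<iota> A y2) (\<zeta>2 j))
          * rpow (norm (y1 - y2)) (\<delta>1 j) * rpow (DA_norm \<iota> A (y1 - y2)) (\<delta>2 j))"
    and \<epsilon>: "0 < \<epsilon>" and K: "0 < K"
  shows "\<exists>C\<ge>0. \<forall>t>0. lip \<epsilon> K C (N t)"
proof -
  \<comment> \<open>Two elements of the ball differ by up to \<open>2 * K\<close>, and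
    \<open>holder_sum_bound\<close> asks for a radius of at least 1.\<close>
  define K' where "K' = max 1 (2 * K)"
  have K': "1 \<le> K'" "K \<le> K'" "2 * K \<le> K'" using K by (auto simp: K'_def)
  from holder_sum_bound[OF N_const(2) N_exps K'(1)] obtain C0 \<theta> where C0: "0 \<le> C0" and \<theta>: "0 \<le> \<theta>" "\<theta> < 1"
    and H: "\<forall>p1 p2 q1 q2 d l. 0 \<le> p1 \<longrightarrow> p1 \<le> K' \<longrightarrow> 0 \<le> p2 \<longrightarrow> p2 \<le> K' \<longrightarrow> 0 \<le> q1 \<longrightarrow> 0 \<le> q2 \<longrightarrow>
     0 < d \<longrightarrow> d \<le> K' \<longrightarrow> 0 \<le> l \<longrightarrow>
      (\<Sum>j=1..n. (rpow p1 (\<zeta>1 j) * rpow q1 (\<zeta>2 j) + rpow p2 (\<zeta>1 j) * rpow q2 (\<zeta>2 j))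
          * rpow d (\<delta>1 j) * rpow l (\<delta>2 j)) \<le> C0 * max (max 1 q1) (max q2 (l / d)) powr \<theta> * d" by (elim exE conjE)
  define c where "c = (C_N * C0)\<^sup>2"
  have c: "0 \<le> c" by (simp add: c_def)
  define \<beta> where "\<beta> = \<epsilon> / (c + 1)"
  have \<beta>: "0 < \<beta>" "c * \<beta> \<le> \<epsilon>" using \<epsilon> c by (auto simp: \<beta>_def field_simps)
  from powr_le_linear[OF \<theta> \<beta>(1)] obtain C1 where C1: "0 \<le> C1" and P: "\<forall>x>0. x powr \<theta> \<le> \<beta> * x + C1" by (elim exE conjE)
  show ?thesis
    unfolding lip_def
  proof (intro exI[of _ "\<epsilon> + c * C1"] conjI allI impI ballI)
    show "0 \<le> \<epsilon> + c * C1" using \<epsilon> c C1 by simp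
    fix t :: real and y z assume t: "0 < t" and y: "y \<in> D" "norm y \<le> K" and z: "z \<in> D" "norm z \<le> K"
    define d where "d = norm (y - z)"
    define l where "l = norm (L (y - z))"
    define q1 where "q1 = norm (L y)"
    define q2 where "q2 = norm (L z)"
    show "(norm (N t y - N t z))\<^sup>2 \<le> \<epsilon> * ((norm (L (y - z)))\<^sup>2
          + ((norm (L y))\<^sup>2 + (norm (L z))\<^sup>2) * (norm (y - z))\<^sup>2) + (\<epsilon> + c * C1) * (norm (y - z))\<^sup>2"
    proof (cases "y = z")
      case True
      then show ?thesis by simp
    next
      case False
      then have d: "0 < d" by (simp add: d_def)
      have dK: "d \<le> K'" using norm_triangle_ineq4[of y z] y z K' by (simp add: d_def)
      define m where "m = max (max 1 q1) (max q2 (l / d))"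
      have m: "1 \<le> m" by (simp add: m_def)
      have m2: "m\<^sup>2 \<le> 1 + q1\<^sup>2 + q2\<^sup>2 + l\<^sup>2 / d\<^sup>2"
      proof -
        have "m = 1 \<or> m = q1 \<or> m = q2 \<or> m = l / d" unfolding m_def by linarith
        then show ?thesis by (elim disjE) (auto simp: power_divide add_nonneg_nonneg)
      qed
      have "norm (N t y - N t z) \<le> C_N * (\<Sum>j=1..n. (rpow (norm y) (\<zeta>1 j) * rpow q1 (\<zeta>2 j)
           + rpow (norm z) (\<zeta>1 j) * rpow q2 (\<zeta>2 j)) * rpow d (\<delta>1 j) * rpow l (\<delta>2 j))"
        using N_bd t y z unfolding DA_norm_def q1_def q2_def d_def l_def by blast
      also have "\<dots> \<le> C_N * (C0 * m powr \<theta> * d)"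
        unfolding m_def using y z K' d dK N_const by (intro mult_left_mono H[rule_format]) (auto simp: q1_def q2_def l_def)
      finally have "(norm (N t y - N t z))\<^sup>2 \<le> (C_N * (C0 * m powr \<theta> * d))\<^sup>2" by (rule power_mono) simp
      also have "\<dots> = c * ((m\<^sup>2) powr \<theta>) * d\<^sup>2"
      proof -
        have "(m powr \<theta>)\<^sup>2 = (m\<^sup>2) powr \<theta>" using m by (simp add: power2_eq_square powr_mult)
        then show ?thesis by (simp add: c_def power_mult_distrib)
      qed
      also have "\<dots> \<le> c * (\<beta> * m\<^sup>2 + C1) * d\<^sup>2"
        using P m c by (intro mult_right_mono mult_left_mono) auto
      also have "\<dots> = (c * \<beta>) * (m\<^sup>2 * d\<^sup>2) + c * C1 * d\<^sup>2" by (simp add: algebra_simps)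
      also have "\<dots> \<le> \<epsilon> * ((1 + q1\<^sup>2 + q2\<^sup>2 + l\<^sup>2 / d\<^sup>2) * d\<^sup>2) + c * C1 * d\<^sup>2"
        using \<beta> m2 c \<epsilon> by (intro add_right_mono mult_mono mult_right_mono) auto
      also have "(1 + q1\<^sup>2 + q2\<^sup>2 + l\<^sup>2 / d\<^sup>2) * d\<^sup>2 = d\<^sup>2 + (q1\<^sup>2 + q2\<^sup>2) * d\<^sup>2 + l\<^sup>2"
        using d by (simp add: field_simps)
      finally show ?thesis unfolding d_def l_def q1_def q2_def by (simp add: algebra_simps)
    qed
  qed
qed

text \<open>Approximation of \<open>g\<close> by simple functions: along one of them only finitely
  many sections of \<open>f\<close> occur, each measurable in \<open>t\<close>, and continuity in
  the second argument carries measurability over to the limit.\<close>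

lemma borel_measurable_caratheodory:
  fixes f :: "'a \<Rightarrow> 'c::{second_countable_topology,metric_space} \<Rightarrow> 'b::metric_space"
  assumes g: "g \<in> borel_measurable M"
    and f: "\<And>x. (\<lambda>t. f t x) \<in> borel_measurable M"
    and cont: "\<And>t. t \<in> space M \<Longrightarrow> continuous_on UNIV (f t)"
  shows "(\<lambda>t. f t (g t)) \<in> borel_measurable M"
proof -
  obtain F where F: "\<And>i. simple_function M (F i)" "\<And>x. x \<in> space M \<Longrightarrow> (\<lambda>i. F i x) \<longlonglongrightarrow> g x"
    using borel_measurable_implies_sequence_metric[OF g] by metis
  show ?thesis
  proof (rule borel_measurable_LIMSEQ_metric)
    fix i
    have fin: "finite (F i ` space M)" using F(1) by (simp add: simple_function_def)
    show "(\<lambda>t. f t (F i t)) \<in> borel_measurable M"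
    proof (rule measurable_compose_countable'[where I="F i ` space M" and f="\<lambda>x t. f t x"])
      show "F i \<in> measurable M (count_space (F i ` space M))"
        using F(1)[of i] fin by (subst measurable_count_space_eq2) (auto simp: simple_function_def)
    qed (use f fin in \<open>auto intro: countable_finite\<close>)
  next
    fix t assume t: "t \<in> space M"
    show "(\<lambda>i. f t (F i t)) \<longlonglongrightarrow> f t (g t)"
      using continuous_on_tendsto_compose[OF cont[OF t] F(2)[OF t]] by simp
  qed
qed

text \<open>Only the point 0 can lie outside the open half line, and every subset of a singleton is
  measurable.\<close>

lemma borel_measurable_lebesgue_on_pos:
  fixes g :: "real \<Rightarrow> 'a::topological_space"
  assumes g: "g \<in> borel_measurable (lebesgue_on {0<..})" and a: "0 \<le> a"
  shows "g \<in> borel_measurable (lebesgue_on {a..b})"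
proof -
  have "g -` B \<inter> {a..b} \<in> sets lebesgue" if B: "B \<in> sets borel" for B
  proof -
    have "g -` B \<inter> {0<..} \<in> sets lebesgue" using g B by (subst (asm) measurable_lebesgue_on_iff) auto
    then have "(g -` B \<inter> {0<..}) \<inter> {a..b} \<in> sets lebesgue" by auto
    moreover have "g -` B \<inter> {a..b} \<inter> {0} \<in> sets lebesgue"
      by (cases "g -` B \<inter> {a..b} \<inter> {0} = {}") (auto simp: Int_insert_right)
    moreover have "g -` B \<inter> {a..b} = (g -` B \<inter> {0<..}) \<inter> {a..b} \<union> (g -` B \<inter> {a..b} \<inter> {0})" using a by force
    ultimately show ?thesis by (metis sets.Un)
  qed
  then show ?thesis by (subst measurable_lebesgue_on_iff) auto
qed

section \<open>Lyapunov function\<close>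

text \<open>Implicit Euler: \<open>n\<close> equal steps give the factor
  \<open>(1 + \<mu> * t / real n) ^ n\<close>, which tends to the exponential. In this form no
  derivative of \<Phi> is needed.\<close>

lemma exponential_decay:
  fixes \<Phi> :: "real \<Rightarrow> real"
  assumes \<mu>: "0 \<le> \<mu>" and t: "0 \<le> t"
    and step: "\<And>r s. 0 \<le> r \<Longrightarrow> r \<le> s \<Longrightarrow> s \<le> t \<Longrightarrow> (1 + \<mu> * (s - r)) * \<Phi> s \<le> \<Phi> r"
  shows "\<Phi> t \<le> exp (- \<mu> * t) * \<Phi> 0"
proof -
  have iter: "(1 + \<mu> * t / real n) ^ k * \<Phi> (real k * (t / real n)) \<le> \<Phi> 0" if "k \<le> n" for k n
    using that
  proof (induction k)
    case (Suc k)
    have "real (Suc k) / real n \<le> 1" using Suc.prems by (simp add: divide_le_eq_1)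
    from mult_right_mono[OF this t] have kn: "real (Suc k) * (t / real n) \<le> t" by simp
    have tn: "0 \<le> t / real n" using t by simp
    have "(1 + \<mu> * (real (Suc k) * (t / real n) - real k * (t / real n))) * \<Phi> (real (Suc k) * (t / real n)) \<le> \<Phi> (real k * (t / real n))"
      by (rule step[OF mult_nonneg_nonneg[OF of_nat_0_le_iff tn] mult_right_mono[OF _ tn] kn]) simp
    moreover have "real (Suc k) * (t / real n) - real k * (t / real n) = t / real n"
      by (simp add: algebra_simps add_divide_distrib)
    ultimately have "(1 + \<mu> * t / real n) * \<Phi> (real (Suc k) * (t / real n)) \<le> \<Phi> (real k * (t / real n))"
      by simp
    then have "(1 + \<mu> * t / real n) ^ k * ((1 + \<mu> * t / real n) * \<Phi> (real (Suc k) * (t / real n)))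
        \<le> (1 + \<mu> * t / real n) ^ k * \<Phi> (real k * (t / real n))"
      using \<mu> t by (intro mult_left_mono) auto
    also have "\<dots> \<le> \<Phi> 0" using Suc by simp
    finally show ?case by (simp add: mult_ac)
  qed simp
  have "exp (\<mu> * t) * \<Phi> t \<le> \<Phi> 0"
  proof (rule LIMSEQ_le_const2)
    show "(\<lambda>n. (1 + \<mu> * t / real n) ^ n * \<Phi> t) \<longlonglongrightarrow> exp (\<mu> * t) * \<Phi> t"
      by (intro tendsto_intros tendsto_exp_limit_sequentially)
    have "(1 + \<mu> * t / real n) ^ n * \<Phi> t \<le> \<Phi> 0" if "n \<ge> 1" for n
      using iter[of n n] that by simp
    then show "\<exists>N. \<forall>n\<ge>N. (1 + \<mu> * t / real n) ^ n * \<Phi> t \<le> \<Phi> 0" by blast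
  qed
  then have "exp (- \<mu> * t) * (exp (\<mu> * t) * \<Phi> t) \<le> exp (- \<mu> * t) * \<Phi> 0" by (intro mult_left_mono) auto
  then show ?thesis by (simp add: mult.assoc[symmetric] mult_exp_exp)
qed

lemma (in spectral) norm_L_PV: "(norm (L (PV m u)))\<^sup>2 = (\<Sum>i=1..m. (\<alpha> i * coord u i)\<^sup>2)"
  unfolding PV_def by (subst L_esum[OF atLeastAtMost_subset_atLeast], simp, rule norm_hsum[OF atLeastAtMost_subset_atLeast]) simp

context semilinear begin

text \<open>
  The Lyapunov function is \<open>|Q|\<^sup>2 + \<kappa> |q|\<^sup>2\<close> with \<open>q\<close> the component in the span of
  the first \<open>M\<close> eigenfunctions and \<open>Q\<close> the remainder. The component \<open>q\<close> obeys a linear equation and its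
  dissipation, weighted by \<open>\<kappa>\<close>, absorbs all contributions of \<open>q\<close> to the nonlinearity, whereas those of
  \<open>Q\<close> are absorbed since \<open>\<alpha>\<^sub>M\<^sub>+\<^sub>1\<close> is large. The weight depends on \<open>R\<close> but not on the
  radius \<open>K\<close>, so that \<open>K\<close> can be chosen after \<open>\<kappa>\<close>, and \<open>M\<close> after \<open>K\<close>.
\<close>

context
  fixes M :: nat and lam R K CR CK \<kappa> :: real
  assumes low: "\<And>t v i. i \<in> {1..M} \<Longrightarrow> G t v \<bullet> \<iota> (e i) = - lam * coord v i"
    and lam: "0 \<le> lam" and R: "0 < R" and K: "0 < K" and CR: "0 \<le> CR" and CK: "0 \<le> CK"
    and GbR: "\<And>a b. 0 \<le> a \<Longrightarrow> AE t in lebesgue_on {a..b}. lip (1 / (1 + R\<^sup>2)) R CR (G t)"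
    and GbK: "\<And>a b. 0 \<le> a \<Longrightarrow> AE t in lebesgue_on {a..b}. lip (1 / (4 * (1 + K\<^sup>2))) K CK (G t)"
    and \<kappa>: "\<kappa> = 3 + 2 * CR / \<alpha> 1" and KR: "K\<^sup>2 = \<kappa> * R\<^sup>2" and large: "8 * CK \<le> \<alpha> (Suc M)"
begin

text \<open>By Pythagoras, the weight \<kappa> - 1 on top of the full norm amounts to \<kappa> on
  the low part. This form matches the two energy identities, one for the solution and one for its
  truncation by \<open>PV M\<close>.\<close>

definition "\<Phi> v = (norm v)\<^sup>2 + (\<kappa> - 1) * (norm (PV M v))\<^sup>2"

lemma kappa3: "3 \<le> \<kappa>"
  using CR alpha_pos[of 1] by (simp add: \<kappa>)

lemma Phi_ge: "(norm v)\<^sup>2 \<le> \<Phi> v"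
  using kappa3 by (simp add: \<Phi>_def)

lemma Phi_nonneg: "0 \<le> \<Phi> v"
  using Phi_ge[of v] zero_le_power2[of "norm v"] by linarith

lemma Phi_le: "\<Phi> v \<le> \<kappa> * (norm v)\<^sup>2"
proof -
  have "(\<kappa> - 1) * (norm (PV M v))\<^sup>2 \<le> (\<kappa> - 1) * (norm v)\<^sup>2"
    using kappa3 by (intro mult_left_mono power_mono norm_PV_le) auto
  then show ?thesis by (simp add: \<Phi>_def algebra_simps)
qed

text \<open>By \<open>low\<close>, mode \<open>i\<close> of \<open>w\<close> is -(lam + \<alpha> i)
  times the coordinate, without coupling to other modes, and the \<open>lam\<close> part is
  nonpositive.\<close>

lemma low_dissipation:
  assumes "v \<in> D" and w: "w = G t v - L v"
  shows "(\<Sum>i=1..M. \<alpha> i * (coord v i * (w \<bullet> \<iota> (e i)))) \<le> - (norm (L (PV M v)))\<^sup>2"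
proof -
  have "(\<Sum>i=1..M. \<alpha> i * (coord v i * (w \<bullet> \<iota> (e i)))) \<le> (\<Sum>i=1..M. - (\<alpha> i * coord v i)\<^sup>2)"
  proof (rule sum_mono)
    fix i assume i: "i \<in> {1..M}"
    have weq: "w \<bullet> \<iota> (e i) = - lam * coord v i - \<alpha> i * coord v i"
      unfolding w using low[OF i] L_inner_e[OF assms(1), of i] i by (simp add: inner_diff_left)
    have "\<alpha> i * (coord v i * (w \<bullet> \<iota> (e i))) = - (\<alpha> i * coord v i)\<^sup>2 - lam * (\<alpha> i * (coord v i)\<^sup>2)"
      unfolding weq by (simp add: power2_eq_square algebra_simps)
    moreover have "0 \<le> lam * (\<alpha> i * (coord v i)\<^sup>2)" using lam alpha_pos[of i] i by simp
    ultimately show "\<alpha> i * (coord v i * (w \<bullet> \<iota> (e i))) \<le> - (\<alpha> i * coord v i)\<^sup>2" by linarith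
  qed
  then show ?thesis by (simp add: norm_L_PV sum_negf)
qed

text \<open>Writes G v as (G v - G q) + G q with q the low part and Q the rest. The difference uses
  the constants for \<open>K\<close>, where the small \<epsilon> compensates |Q| \<le> K; the value
  at q uses those for \<open>R\<close>, as |q| \<le> R. The coefficients are 3/4 = 2 (1/4 + 1/8),
  with 1/8 from \<open>large\<close>, and \<kappa> = 2 (1/2 + 1 + CR / \<alpha> 1).\<close>

lemma G_estimate:
  assumes GR: "lip (1 / (1 + R\<^sup>2)) R CR (G t)" and GK: "lip (1 / (4 * (1 + K\<^sup>2))) K CK (G t)" and G0: "G t 0 = 0"
    and v: "v \<in> D" "norm v \<le> K" "norm (PV M v) \<le> R"
  shows "(norm (G t v))\<^sup>2 \<le> (3/4) * (norm (L (v - PV M v)))\<^sup>2 + \<kappa> * (norm (L (PV M v)))\<^sup>2"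
proof -
  define q where "q = PV M v"
  define Q where "Q = v - q"
  have qD: "q \<in> D" by (simp add: q_def PV_D)
  have QD: "Q \<in> D" unfolding Q_def by (rule D_diff[OF v(1) qD])
  have qK: "norm q \<le> K" using norm_PV_le[of M v] v(2) by (simp add: q_def)
  have QK: "(norm Q)\<^sup>2 \<le> K\<^sup>2"
  proof -
    have "(norm Q)\<^sup>2 \<le> (norm v)\<^sup>2" using norm_PV_split[of v M] by (simp add: Q_def q_def)
    also have "\<dots> \<le> K\<^sup>2" using v(2) by (intro power_mono) auto
    finally show ?thesis .
  qed
  have qR: "(norm q)\<^sup>2 \<le> R\<^sup>2" using v(3) unfolding q_def by (intro power_mono) auto
  have Lv: "(norm (L v))\<^sup>2 = (norm (L q))\<^sup>2 + (norm (L Q))\<^sup>2"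
    using norm_PH_split[of "L v" M] L_PV[OF v(1)] L_diff[OF v(1) qD] by (simp add: q_def Q_def)
  have tail: "8 * CK * (norm Q)\<^sup>2 \<le> (norm (L Q))\<^sup>2"
  proof -
    have "\<alpha> (Suc M) * (norm Q)\<^sup>2 \<le> (norm (L Q))\<^sup>2"
      by (rule poincare_tail[OF QD]) (simp add: Q_def q_def co_diff co_PV)
    moreover have "8 * CK * (norm Q)\<^sup>2 \<le> \<alpha> (Suc M) * (norm Q)\<^sup>2" using large by (intro mult_right_mono) auto
    ultimately show ?thesis by linarith
  qed
  have head: "CR * (norm q)\<^sup>2 \<le> CR / \<alpha> 1 * (norm (L q))\<^sup>2"
  proof -
    have "CR / \<alpha> 1 * (\<alpha> 1 * (norm q)\<^sup>2) \<le> CR / \<alpha> 1 * (norm (L q))\<^sup>2"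
      using poincare[OF qD] CR alpha_pos[of 1] by (intro mult_left_mono) auto
    then show ?thesis using alpha_pos[of 1] by simp
  qed
  have pK: "0 < 1 + K\<^sup>2" and pR: "0 < 1 + R\<^sup>2" by (simp_all add: add_pos_nonneg)
  have 1: "(norm (G t v - G t q))\<^sup>2 \<le> (1/4) * (norm (L Q))\<^sup>2 + (1/2) * (norm (L q))\<^sup>2 + CK * (norm Q)\<^sup>2"
  proof -
    have "(norm (G t v - G t q))\<^sup>2 \<le> 1 / (4 * (1 + K\<^sup>2)) * ((norm (L Q))\<^sup>2
          + ((norm (L v))\<^sup>2 + (norm (L q))\<^sup>2) * (norm Q)\<^sup>2) + CK * (norm Q)\<^sup>2"
      unfolding Q_def by (rule lip_D[OF GK v(1) qD v(2) qK])
    also have "\<dots> \<le> 1 / (4 * (1 + K\<^sup>2)) * ((norm (L Q))\<^sup>2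
          + ((norm (L v))\<^sup>2 + (norm (L q))\<^sup>2) * K\<^sup>2) + CK * (norm Q)\<^sup>2"
      using QK pK by (intro add_right_mono mult_left_mono add_left_mono) auto
    also have "1 / (4 * (1 + K\<^sup>2)) * ((norm (L Q))\<^sup>2 + ((norm (L v))\<^sup>2 + (norm (L q))\<^sup>2) * K\<^sup>2)
       = 1 / (4 * (1 + K\<^sup>2)) * ((1 + K\<^sup>2) * (norm (L Q))\<^sup>2 + 2 * K\<^sup>2 * (norm (L q))\<^sup>2)"
      unfolding Lv by (simp add: algebra_simps)
    also have "\<dots> \<le> 1 / (4 * (1 + K\<^sup>2)) * ((1 + K\<^sup>2) * (norm (L Q))\<^sup>2 + 2 * (1 + K\<^sup>2) * (norm (L q))\<^sup>2)"
      using pK by (intro mult_left_mono add_left_mono mult_right_mono) auto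
    also have "\<dots> = (1/4) * (norm (L Q))\<^sup>2 + (1/2) * (norm (L q))\<^sup>2"
      using pK by (simp add: field_simps)
    finally show ?thesis by simp
  qed
  have 2: "(norm (G t q))\<^sup>2 \<le> (norm (L q))\<^sup>2 + CR * (norm q)\<^sup>2"
  proof -
    have "(norm (G t q - G t 0))\<^sup>2 \<le> 1 / (1 + R\<^sup>2) * ((norm (L (q - 0)))\<^sup>2
          + ((norm (L q))\<^sup>2 + (norm (L 0))\<^sup>2) * (norm (q - 0))\<^sup>2) + CR * (norm (q - 0))\<^sup>2"
      using v(3) R by (intro lip_D[OF GR qD D_0]) (auto simp: q_def)
    also have "\<dots> \<le> 1 / (1 + R\<^sup>2) * ((norm (L q))\<^sup>2 + (norm (L q))\<^sup>2 * R\<^sup>2) + CR * (norm q)\<^sup>2"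
      using qR pR by (simp add: divide_right_mono mult_left_mono)
    also have "1 / (1 + R\<^sup>2) * ((norm (L q))\<^sup>2 + (norm (L q))\<^sup>2 * R\<^sup>2) = 1 / (1 + R\<^sup>2) * ((1 + R\<^sup>2) * (norm (L q))\<^sup>2)"
      by (simp add: algebra_simps)
    also have "\<dots> = (norm (L q))\<^sup>2" using pR by simp
    finally show ?thesis using G0 by simp
  qed
  have "(norm (G t v))\<^sup>2 \<le> 2 * (norm (G t v - G t q))\<^sup>2 + 2 * (norm (G t q))\<^sup>2"
    using norm_add_sq_le[of "G t v - G t q" "G t q"] by simp
  then have "(norm (G t v))\<^sup>2 \<le> (3/4) * (norm (L Q))\<^sup>2 + 3 * (norm (L q))\<^sup>2 + 2 * (CR / \<alpha> 1 * (norm (L q))\<^sup>2)"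
    using 1 2 tail head by linarith
  also have "\<dots> = (3/4) * (norm (L Q))\<^sup>2 + \<kappa> * (norm (L q))\<^sup>2" by (simp add: \<kappa> algebra_simps)
  finally show ?thesis by (simp add: q_def Q_def)
qed

text \<open>The low modes are autonomous, so their V norm cannot grow. This keeps
  \<open>PV M (y t)\<close> in the ball of radius \<open>R\<close> without any a priori bound on
  \<open>y\<close> itself.\<close>

lemma PV_decreasing:
  assumes y: "sol 0 b y" and t: "t \<in> {0..b}"
  shows "norm (PV M (y t)) \<le> norm (y 0)"
proof -
  note r = y[unfolded sol_def]
  note E = energy_PV[OF r, of 0 t M]
  have "AE r in lebesgue_on {0..t}. y r \<in> D" by (rule AE_lebesgue_on_subset[OF reg_D[OF r]]) (use t in auto)
  then have "AE r in lebesgue_on {0..t}. (\<Sum>i=1..M. \<alpha> i * (coord (y r) i * ((G r (y r) - L (y r)) \<bullet> \<iota> (e i)))) \<le> 0"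
  proof eventually_elim
    case (elim r)
    show ?case using low_dissipation[OF elim refl, of r] zero_le_power2[of "norm (L (PV M (y r)))"] by linarith
  qed
  then have "(LINT r|lebesgue_on {0..t}. (\<Sum>i=1..M. \<alpha> i * (coord (y r) i * ((G r (y r) - L (y r)) \<bullet> \<iota> (e i))))) \<le> (LINT r|lebesgue_on {0..t}. 0)"
    by (intro integral_mono_AE E(1)) (use t in auto)
  then have "(norm (PV M (y t)))\<^sup>2 \<le> (norm (PV M (y 0)))\<^sup>2" using E(2) t by simp
  then have "norm (PV M (y t)) \<le> norm (PV M (y 0))" by (rule power2_le_imp_le) simp
  then show ?thesis using norm_PV_le[of M "y 0"] by linarith
qed

text \<open>The energy identity for \<open>y\<close> plus \<kappa> - 1 times the one for its low
  part. The bound \<open>yK\<close> enters through \<open>G_estimate\<close> and is justified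
  afterwards by \<open>a_priori\<close>.\<close>

lemma Phi_integral:
  assumes y: "sol 0 b y" and y0: "norm (y 0) < R" and yK: "\<And>t. t \<in> {0..b} \<Longrightarrow> norm (y t) \<le> K"
    and st: "0 \<le> s" "s \<le> t" "t \<le> b"
  shows "\<Phi> (y t) \<le> \<Phi> (y s) - (LINT r|lebesgue_on {s..t}. \<alpha> 1 / 4 * \<Phi> (y r))"
proof -
  note r = y[unfolded sol_def]
  note r' = reg_subinterval[OF r st]
  let ?M = "lebesgue_on {s..t}"
  let ?w = "\<lambda>r. G r (y r) - L (y r)"
  let ?f = "\<lambda>r. \<Sum>i=1..M. \<alpha> i * (coord (y r) i * (?w r \<bullet> \<iota> (e i)))"
  note EP = energy_PV[OF r st, of M]
  have i1: "integrable ?M (\<lambda>r. L (y r) \<bullet> ?w r)" by (rule integrable_inner_sqint[OF reg_L[OF r'] reg_w[OF r']])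
  have cPV: "continuous_on {s..t} (\<lambda>r. PV M (y r))"
    unfolding PV_def coord_def by (intro continuous_intros reg_cont[OF r'])
  have i2: "integrable ?M (\<lambda>r. \<alpha> 1 / 4 * \<Phi> (y r))"
    unfolding \<Phi>_def by (intro continuous_imp_integrable_real continuous_intros reg_cont[OF r'] cPV)
  have "AE r in ?M. r \<in> {0..b}" by (rule AE_I2) (use st in auto)
  with GbR[OF st(1), of t] GbK[OF st(1), of t] AE_lebesgue_on_pos[OF G_0 st(1), of t] reg_D[OF r']
  have ae: "AE r in ?M. 2 * (L (y r) \<bullet> ?w r) + (\<kappa> - 1) * (2 * ?f r) \<le> - (\<alpha> 1 / 4 * \<Phi> (y r))"
  proof eventually_elim
    case (elim r)
    define v where "v = y r"
    define q where "q = PV M v"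
    define Q where "Q = v - q"
    have vD: "v \<in> D" and vK: "norm v \<le> K" and vR: "norm (PV M v) \<le> R"
      using elim yK PV_decreasing[OF y, of r] y0 by (auto simp: v_def)
    have qD: "q \<in> D" by (simp add: q_def PV_D)
    have QD: "Q \<in> D" unfolding Q_def by (rule D_diff[OF vD qD])
    have Lv: "(norm (L v))\<^sup>2 = (norm (L q))\<^sup>2 + (norm (L Q))\<^sup>2"
      using norm_PH_split[of "L v" M] L_PV[OF vD] L_diff[OF vD qD] by (simp add: q_def Q_def)
    have G: "(norm (G r v))\<^sup>2 \<le> (3/4) * (norm (L Q))\<^sup>2 + \<kappa> * (norm (L q))\<^sup>2"
      using G_estimate[OF elim(1-3) vD vK vR] by (simp add: q_def Q_def)
    have "2 * (L v \<bullet> (G r v - L v)) \<le> (norm (G r v))\<^sup>2 - (norm (L v))\<^sup>2"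
      using zero_le_power2[of "norm (G r v - L v)"] unfolding power2_norm_eq_inner
      by (simp add: inner_diff_left inner_diff_right inner_commute)
    moreover have "(\<kappa> - 1) * (2 * ?f r) \<le> (\<kappa> - 1) * (2 * - (norm (L q))\<^sup>2)"
      using kappa3 low_dissipation[OF vD refl, of r] by (intro mult_left_mono) (auto simp: v_def q_def)
    ultimately have "2 * (L v \<bullet> (G r v - L v)) + (\<kappa> - 1) * (2 * ?f r)
       \<le> (3/4) * (norm (L Q))\<^sup>2 + \<kappa> * (norm (L q))\<^sup>2 - ((norm (L q))\<^sup>2 + (norm (L Q))\<^sup>2) + (\<kappa> - 1) * (2 * - (norm (L q))\<^sup>2)"
      using G Lv by linarith
    \<comment> \<open>The coefficient of |LQ|^2 is 3/4 - 1, that of |Lq|^2 is \<kappa> - 1 - 2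
      (\<kappa> - 1) = -(\<kappa> - 1), and the latter is at most -\<kappa>/4 because \<kappa> is at
      least 3.\<close>
    also have "\<dots> = - (1/4) * (norm (L Q))\<^sup>2 - (\<kappa> - 1) * (norm (L q))\<^sup>2" by (simp add: algebra_simps)
    also have "\<dots> \<le> - (1/4) * (norm (L Q))\<^sup>2 - \<kappa> / 4 * (norm (L q))\<^sup>2"
      using kappa3 by (intro diff_left_mono mult_right_mono) auto
    also have "\<dots> \<le> - (1/4) * (\<alpha> 1 * (norm Q)\<^sup>2) - \<kappa> / 4 * (\<alpha> 1 * (norm q)\<^sup>2)"
    proof -
      have "\<kappa> / 4 * (\<alpha> 1 * (norm q)\<^sup>2) \<le> \<kappa> / 4 * (norm (L q))\<^sup>2"
        using poincare[OF qD] kappa3 by (intro mult_left_mono) auto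
      with poincare[OF QD] show ?thesis by linarith
    qed
    also have "\<dots> = - (\<alpha> 1 / 4 * \<Phi> v)"
      unfolding \<Phi>_def norm_PV_split[of v M] by (simp add: q_def Q_def algebra_simps)
    finally show ?case by (simp add: v_def)
  qed
  have "(LINT r|?M. 2 * (L (y r) \<bullet> ?w r) + (\<kappa> - 1) * (2 * ?f r)) \<le> (LINT r|?M. - (\<alpha> 1 / 4 * \<Phi> (y r)))"
    by (rule integral_mono_AE[OF _ _ ae]) (use i1 i2 EP(1) in auto)
  also have "\<dots> = - (LINT r|?M. \<alpha> 1 / 4 * \<Phi> (y r))" using i2 by simp
  also have "(LINT r|?M. 2 * (L (y r) \<bullet> ?w r) + (\<kappa> - 1) * (2 * ?f r)) = (LINT r|?M. 2 * (L (y r) \<bullet> ?w r)) + (LINT r|?M. (\<kappa> - 1) * (2 * ?f r))"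
    by (rule Bochner_Integration.integral_add) (use i1 EP(1) in auto)
  also have "(LINT r|?M. 2 * (L (y r) \<bullet> ?w r)) = (norm (y t))\<^sup>2 - (norm (y s))\<^sup>2"
    using energy[OF r st] by simp
  also have "(LINT r|?M. (\<kappa> - 1) * (2 * ?f r)) = (\<kappa> - 1) * ((norm (PV M (y t)))\<^sup>2 - (norm (PV M (y s)))\<^sup>2)"
    using EP(2) by simp
  finally show ?thesis by (simp add: \<Phi>_def algebra_simps)
qed

text \<open>The integral inequality first shows that \<Phi> does not increase along the solution.
  Its integral over a step is therefore at least the length times the value at the right end, which
  is the implicit Euler inequality of \<open>exponential_decay\<close>.\<close>

lemma Phi_decay:
  assumes y: "sol 0 b y" and y0: "norm (y 0) < R" and yK: "\<And>t. t \<in> {0..b} \<Longrightarrow> norm (y t) \<le> K"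
    and t: "t \<in> {0..b}"
  shows "\<Phi> (y t) \<le> exp (- (\<alpha> 1 / 4) * t) * \<Phi> (y 0)"
proof (rule exponential_decay)
  have \<alpha>1: "0 < \<alpha> 1" by (rule alpha_pos) simp
  then show "0 \<le> \<alpha> 1 / 4" by simp
  show "0 \<le> t" using t by simp
  note r = y[unfolded sol_def]
  have mono: "\<Phi> (y s') \<le> \<Phi> (y r')" if "0 \<le> r'" "r' \<le> s'" "s' \<le> b" for r' s'
  proof -
    have "0 \<le> (LINT r|lebesgue_on {r'..s'}. \<alpha> 1 / 4 * \<Phi> (y r))" using \<alpha>1 Phi_nonneg by (intro Bochner_Integration.integral_nonneg) simp
    then show ?thesis using Phi_integral[OF y y0 yK that] by simp
  qed
  fix r' s' assume rs: "0 \<le> r'" "r' \<le> s'" "s' \<le> t"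
  then have rs': "0 \<le> r'" "r' \<le> s'" "s' \<le> b" using t by auto
  note r'' = reg_subinterval[OF r rs']
  have "continuous_on {r'..s'} (\<lambda>r. PV M (y r))"
    unfolding PV_def coord_def by (intro continuous_intros reg_cont[OF r''])
  then have i2: "integrable (lebesgue_on {r'..s'}) (\<lambda>r. \<alpha> 1 / 4 * \<Phi> (y r))"
    unfolding \<Phi>_def by (intro continuous_imp_integrable_real continuous_intros reg_cont[OF r''])
  have "\<alpha> 1 / 4 * (s' - r') * \<Phi> (y s') = (LINT r|lebesgue_on {r'..s'}. \<alpha> 1 / 4 * \<Phi> (y s'))"
    using rs by (simp add: measure_restrict_space)
  also have "\<dots> \<le> (LINT r|lebesgue_on {r'..s'}. \<alpha> 1 / 4 * \<Phi> (y r))"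
    by (rule integral_mono[OF _ i2]) (use \<alpha>1 rs' in \<open>auto intro!: mono\<close>)
  finally show "(1 + \<alpha> 1 / 4 * (s' - r')) * \<Phi> (y s') \<le> \<Phi> (y r')"
    using Phi_integral[OF y y0 yK rs'] unfolding distrib_right mult_1 by linarith
qed

text \<open>At the first time \<open>t1\<close> where the norm is at least \<open>K\<close>, the
  decay estimate applies up to \<open>t1\<close> and bounds the squared norm by
  \<open>\<Phi> (y 0)\<close>, hence by \<kappa> times the initial squared norm. This is strictly
  below \<open>\<kappa> * R\<^sup>2 = K\<^sup>2\<close>, a contradiction.\<close>

lemma a_priori:
  assumes y: "sol 0 b y" and y0: "norm (y 0) < R" and t: "t \<in> {0..b}"
  shows "norm (y t) \<le> K"
proof (rule ccontr)
  assume neg: "\<not> norm (y t) \<le> K"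
  define Z where "Z = {t \<in> {0..b}. norm (y t) \<in> {K..}}"
  note r = y[unfolded sol_def]
  have "closed Z" unfolding Z_def
    by (rule continuous_closed_preimage[OF _ _ closed_atLeast, unfolded vimage_def Int_def mem_Collect_eq])
       (auto intro!: continuous_intros reg_cont[OF r])
  moreover have "bounded Z" by (rule bounded_subset[OF bounded_closed_interval[of 0 b]]) (auto simp: Z_def)
  ultimately have "compact Z" by (simp add: compact_eq_bounded_closed)
  moreover have "t \<in> Z" using t neg by (simp add: Z_def)
  ultimately obtain t1 where t1: "t1 \<in> Z" "\<And>s. s \<in> Z \<Longrightarrow> t1 \<le> s" using compact_attains_inf[of Z] by blast
  have t1b: "0 \<le> t1" "t1 \<le> b" using t1 by (auto simp: Z_def)
  have cy: "continuous_on {0..t1} (\<lambda>s. norm (y s))"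
    by (intro continuous_intros continuous_on_subset[OF reg_cont[OF r]]) (use t1b in auto)
  have less: "norm (y s) < K" if "s \<in> {0..<t1}" for s
    using t1(2)[of s] that t1b by (auto simp: Z_def not_le[symmetric])
  have R2: "(norm (y 0))\<^sup>2 < R\<^sup>2" using y0 by (intro power_strict_mono) auto
  then have "\<kappa> * (norm (y 0))\<^sup>2 < K\<^sup>2" unfolding KR using kappa3 by simp
  then have \<Phi>0: "\<Phi> (y 0) < K\<^sup>2" using Phi_le[of "y 0"] by linarith
  \<comment> \<open>A jump beyond \<open>K\<close> is excluded by the intermediate value theorem, so
    the bound required by \<open>Phi_decay\<close> also holds at \<open>t1\<close>.\<close>
  have t1K: "norm (y t1) \<le> K"
  proof (rule ccontr)
    assume gt: "\<not> norm (y t1) \<le> K"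
    have "norm (y 0) \<le> K"
    proof (rule power2_le_imp_le)
      show "(norm (y 0))\<^sup>2 \<le> K\<^sup>2" using \<Phi>0 Phi_ge[of "y 0"] by linarith
    qed (use K in simp)
    then obtain s where s: "0 \<le> s" "s \<le> t1" "norm (y s) = K"
      using IVT'[of "\<lambda>s. norm (y s)" 0 K t1] gt t1b cy by auto
    with less[of s] gt show False by (cases "s = t1") auto
  qed
  have yK: "norm (y s) \<le> K" if "s \<in> {0..t1}" for s
    using less[of s] t1K that by (cases "s = t1") auto
  have "\<Phi> (y t1) \<le> exp (- (\<alpha> 1 / 4) * t1) * \<Phi> (y 0)"
    by (rule Phi_decay[OF sol_subinterval[OF y order_refl t1b] y0 yK]) (use t1b in auto)
  also have "\<dots> \<le> 1 * \<Phi> (y 0)"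
    using t1b alpha_pos[of 1] by (intro mult_right_mono Phi_nonneg) auto
  also have "\<dots> < K\<^sup>2" using \<Phi>0 by simp
  finally have "(norm (y t1))\<^sup>2 < K\<^sup>2" using Phi_ge[of "y t1"] by linarith
  then have "norm (y t1) < K" using K by (simp add: power_less_imp_less_base)
  then show False using t1(1) by (simp add: Z_def)
qed

theorem exponential_stability:
  assumes y0: "norm y0 < R"
  shows "\<exists>y. y 0 = y0 \<and> (\<forall>T>0. sol 0 T y) \<and> (\<forall>t\<ge>0. (norm (y t))\<^sup>2 \<le> \<kappa> * exp (- (\<alpha> 1 / 4) * t) * (norm y0)\<^sup>2)"
proof -
  have "1 * R\<^sup>2 \<le> \<kappa> * R\<^sup>2" by (rule mult_right_mono) (use kappa3 in auto)
  then have "R\<^sup>2 \<le> K\<^sup>2" unfolding KR by simp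
  then have "R \<le> K" by (rule power2_le_imp_le) (use K in simp)
  then have y0K: "norm y0 \<le> K" using y0 by simp
  have "\<exists>y. y 0 = y0 \<and> (\<forall>T>0. sol 0 T y)"
    by (rule global_existence[OF K y0K], rule a_priori) (use y0 in auto)
  then obtain y where y: "y 0 = y0" "\<forall>T>0. sol 0 T y" by (elim exE conjE)
  have "(norm (y t))\<^sup>2 \<le> \<kappa> * exp (- (\<alpha> 1 / 4) * t) * (norm y0)\<^sup>2" if t: "t \<ge> 0" for t
  proof -
    have s: "sol 0 (t + 1) y" using y(2) t by simp
    have "(norm (y t))\<^sup>2 \<le> \<Phi> (y t)" by (rule Phi_ge)
    also have "\<dots> \<le> exp (- (\<alpha> 1 / 4) * t) * \<Phi> (y 0)"
      by (rule Phi_decay[OF s _ a_priori[OF s]]) (use y y0 t in auto)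
    also have "\<dots> \<le> exp (- (\<alpha> 1 / 4) * t) * (\<kappa> * (norm y0)\<^sup>2)"
      unfolding y(1) by (intro mult_left_mono Phi_le) simp
    finally show ?thesis by (simp add: mult_ac)
  qed
  with y show ?thesis by blast
qed

end

end

section \<open>The closed loop\<close>

lemma oblique_proj_props:
  assumes "direct_sum F G"
  shows "oblique_proj F G h \<in> F" "h - oblique_proj F G h \<in> G"
proof -
  have F: "subspace F" and G: "subspace G" and FG: "F \<inter> G = {0}" and ex: "\<exists>f\<in>F. \<exists>g\<in>G. h = f + g"
    using assms by (auto simp: direct_sum_def)
  obtain f g where fg: "f \<in> F" "g \<in> G" "h = f + g" using ex by blast
  have eq: "oblique_proj F G h = f"
    unfolding oblique_proj_def
  proof (rule the_equality)
    show "f \<in> F \<and> h - f \<in> G" using fg by simp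
    fix f' assume f': "f' \<in> F \<and> h - f' \<in> G"
    have "f' - f \<in> F" using f' fg by (intro subspace_diff[OF F]) auto
    moreover have "(h - f) - (h - f') \<in> G" by (rule subspace_diff[OF G]) (use f' fg in auto)
    then have "f' - f \<in> G" by simp
    ultimately have "f' - f \<in> F \<inter> G" by (rule IntI)
    then show "f' = f" unfolding FG by simp
  qed
  show "oblique_proj F G h \<in> F" "h - oblique_proj F G h \<in> G" using fg unfolding eq by simp_all
qed

section \<open>Inverse of the operator, and the feedback\<close>

context spectral begin

text \<open>The inverse of \<open>L\<close>, isometric from H onto D(A) with \<open>DA_norm\<close>.
  It transfers N(t, .) from D(A) to all of H, where measurability in time and continuity refer to
  one fixed metric space.\<close>

definition "Linv h = (SOME u. u \<in> D \<and> L u = h)"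

lemma Linv: "Linv h \<in> D" "L (Linv h) = h"
proof -
  have "Linv h \<in> D \<and> L (Linv h) = h" unfolding Linv_def by (rule someI_ex[OF L_surj[unfolded Bex_def]])
  then show "Linv h \<in> D" "L (Linv h) = h" by auto
qed

lemma Linv_eqI: "u \<in> D \<Longrightarrow> L u = h \<Longrightarrow> Linv h = u"
proof -
  assume u: "u \<in> D" "L u = h"
  have "(Linv h - u) \<bullet> (Linv h - u) = L (Linv h - u) \<bullet> \<iota> (Linv h - u)" by (rule inner_L[OF D_diff[OF Linv(1) u(1)]])
  also have "L (Linv h - u) = 0" using u by (simp add: L_diff Linv)
  finally show "Linv h = u" by simp
qed

lemma Linv_bounded_linear: "bounded_linear Linv"
proof (rule bounded_linear_intro)
  show "Linv (x + y) = Linv x + Linv y" for x y by (rule Linv_eqI) (simp_all add: D_add L_add Linv)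
  show "Linv (r *\<^sub>R x) = r *\<^sub>R Linv x" for r x by (rule Linv_eqI) (simp_all add: D_scaleR L_scaleR Linv)
  show "norm (Linv h) \<le> norm h * sqrt (1 / \<alpha> 1)" for h
  proof (rule power2_le_imp_le)
    have \<alpha>: "0 < \<alpha> 1" by (rule alpha_pos) simp
    then have "(norm (Linv h))\<^sup>2 \<le> (norm h)\<^sup>2 / \<alpha> 1" using poincare[OF Linv(1), of h] by (simp add: Linv(2) field_simps)
    then show "(norm (Linv h))\<^sup>2 \<le> (norm h * sqrt (1 / \<alpha> 1))\<^sup>2" using \<alpha> by (simp add: power_mult_distrib)
  qed (use alpha_pos[of 1] in simp)
qed

text \<open>What remains of the closed loop besides \<open>L v\<close>. The argument of the
  projection contains \<open>L v\<close> once with each sign, so no term \<open>P (L v)\<close> is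
  left.\<close>

definition feedback :: "(real \<Rightarrow> ('v \<Rightarrow>\<^sub>L 'h)) \<Rightarrow> (real \<Rightarrow> 'v \<Rightarrow> 'h) \<Rightarrow> real \<Rightarrow> ('h \<Rightarrow> 'h) \<Rightarrow> real \<Rightarrow> 'v \<Rightarrow> 'h" where
  "feedback B N lam P t v = P (B t v + N t v) - (B t v + N t v) - lam *\<^sub>R P (\<iota> v)"

lemma closed_loop_eq:
  assumes "bounded_linear P"
  shows "closed_loop \<iota> A B N lam P t v = L v - feedback B N lam P t v"
proof -
  interpret P: bounded_linear P by fact
  show ?thesis by (simp add: closed_loop_def feedback_def P.add P.diff P.scaleR)
qed

lemma feedback_meas:
  fixes u :: "real \<Rightarrow> 'v"
  assumes B: "\<forall>v. (\<lambda>t. blinfun_apply (B t) v) \<in> borel_measurable (lebesgue_on {0<..})"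
    and N_Cbi: "\<forall>t>0. Cbi (DA \<iota> A) (DA_norm \<iota> A) (N t)"
    and N_meas: "\<forall>u\<in>DA \<iota> A. (\<lambda>t. N t u) \<in> borel_measurable (lebesgue_on {0<..})"
    and P: "bounded_linear P" and a: "0 \<le> a"
    and uD: "AE t in lebesgue_on {a..b}. u t \<in> D" and Lu: "(\<lambda>t. L (u t)) \<in> borel_measurable (lebesgue_on {a..b})"
  shows "(\<lambda>t. feedback B N lam P t (u t)) \<in> borel_measurable (lebesgue_on {a..b})"
proof -
  \<comment> \<open>In the variable h = L u the feedback is defined on all of H. Continuity of
    \<open>N t\<close> is given for t > 0 only; the value 0 elsewhere makes every section continuous
    and affects at most the time 0.\<close>
  define f where "f t h = (if 0 < t then feedback B N lam P t (Linv h) else 0)" for t h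
  have Pc: "continuous_on S P" for S by (rule linear_continuous_on[OF P])
  have pos: "AE t in lebesgue_on {a..b}. 0 < t"
    by (rule AE_lebesgue_on_pos[OF _ a]) (auto intro: AE_I2)
  have fm: "(\<lambda>t. f t h) \<in> borel_measurable (lebesgue_on {a..b})" for h
  proof (rule borel_measurable_lebesgue_on_AE)
    have 1: "(\<lambda>t. B t (Linv h) + N t (Linv h)) \<in> borel_measurable (lebesgue_on {a..b})"
      using B N_meas Linv(1) by (intro borel_measurable_add borel_measurable_lebesgue_on_pos[OF _ a]) auto
    show "(\<lambda>t. feedback B N lam P t (Linv h)) \<in> borel_measurable (lebesgue_on {a..b})"
      unfolding feedback_def
      by (intro borel_measurable_diff 1 borel_measurable_const borel_measurable_continuous_on[OF Pc 1])
    show "AE t in lebesgue_on {a..b}. feedback B N lam P t (Linv h) = f t h"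
      using pos by eventually_elim (simp add: f_def)
  qed simp
  have fc: "continuous_on UNIV (f t)" for t
  proof (cases "0 < t")
    case True
    have NJ: "continuous_on UNIV (\<lambda>h. N t (Linv h))"
      unfolding continuous_on_iff
    proof (intro ballI allI impI)
      fix h :: 'h and \<epsilon> :: real assume \<epsilon>: "0 < \<epsilon>"
      from N_Cbi True have "\<forall>x\<in>D. \<forall>\<epsilon>>0. \<exists>\<delta>>0. \<forall>z\<in>D. DA_norm \<iota> A (z - x) < \<delta> \<longrightarrow> norm (N t z - N t x) < \<epsilon>"
        by (simp add: Cbi_def)
      then obtain \<delta> where \<delta>: "\<delta> > 0" "\<forall>z\<in>D. DA_norm \<iota> A (z - Linv h) < \<delta> \<longrightarrow> norm (N t z - N t (Linv h)) < \<epsilon>"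
        using Linv(1) \<epsilon> by blast
      have "DA_norm \<iota> A (Linv k - Linv h) = dist k h" for k by (simp add: DA_norm_def L_diff Linv dist_norm)
      then show "\<exists>\<delta>>0. \<forall>k\<in>UNIV. dist k h < \<delta> \<longrightarrow> dist (N t (Linv k)) (N t (Linv h)) < \<epsilon>"
        using \<delta> Linv(1) by (auto simp: dist_norm)
    qed
    have Jc: "continuous_on UNIV Linv" by (rule linear_continuous_on[OF Linv_bounded_linear])
    have "continuous_on UNIV (\<lambda>h. feedback B N lam P t (Linv h))"
      unfolding feedback_def
      by (intro continuous_intros NJ Jc continuous_on_compose2[OF Pc[of UNIV]]) auto
    then show ?thesis using True by (simp add: f_def[abs_def])
  qed (simp add: f_def[abs_def])
  have m: "(\<lambda>t. f t (L (u t))) \<in> borel_measurable (lebesgue_on {a..b})"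
    by (rule borel_measurable_caratheodory[OF Lu fm fc])
  have "AE t in lebesgue_on {a..b}. f t (L (u t)) = feedback B N lam P t (u t)"
    using pos uD by eventually_elim (simp add: f_def Linv_eqI)
  then show ?thesis by (rule borel_measurable_lebesgue_on_AE[OF m, rotated]) simp
qed

text \<open>The constant is common to all projections, because \<open>M\<close> is chosen only after the constants.\<close>

lemma feedback_bound:
  assumes B: "C_rc \<ge> 0" "AE t in lebesgue_on {0<..}. norm (B t) \<le> C_rc" and C_P: "0 < C_P" and lam: "0 < lam"
    and N: "\<And>\<epsilon> K. 0 < \<epsilon> \<Longrightarrow> 0 < K \<Longrightarrow> \<exists>C\<ge>0. \<forall>t>0. lip \<epsilon> K C (N t)"
    and \<epsilon>: "0 < \<epsilon>" and K: "0 < K"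
  shows "\<exists>C\<ge>0. AE t in lebesgue_on {0<..}. \<forall>P. bounded_linear P \<longrightarrow> onorm P \<le> C_P \<longrightarrow>
     lip \<epsilon> K C (feedback B N lam P t)"
proof -
  \<comment> \<open>\<open>c1\<close> bounds the identity minus the projection; \<open>c2\<close>
    collects the linear terms, which are controlled by the V norm.\<close>
  define c1 where "c1 = 1 + C_P"
  define c2 where "c2 = c1 * C_rc + lam * C_P * norm \<iota>"
  have c: "0 < c1" "0 \<le> c2" using C_P B lam by (auto simp: c1_def c2_def)
  \<comment> \<open>The denominator cancels the factor that arises when the sum of two terms is
    squared.\<close>
  have "0 < \<epsilon> / (2 * c1\<^sup>2)" using \<epsilon> c by simp
  from N[OF this K] obtain C where C: "0 \<le> C" and NC: "\<forall>t>0. lip (\<epsilon> / (2 * c1\<^sup>2)) K C (N t)" by (elim exE conjE)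
  have "AE t in lebesgue_on {0<..}. (0::real) < t" by (rule AE_I2) simp
  with B(2) have "AE t in lebesgue_on {0<..}. \<forall>P. bounded_linear P \<longrightarrow> onorm P \<le> C_P \<longrightarrow>
     lip \<epsilon> K (2 * c1\<^sup>2 * C + 2 * c2\<^sup>2) (feedback B N lam P t)"
  proof eventually_elim
    case (elim t)
    show ?case
      unfolding lip_def
    proof (intro allI impI ballI)
      fix P :: "'h \<Rightarrow> 'h" and y z assume P: "bounded_linear P" "onorm P \<le> C_P"
        and y: "y \<in> D" "norm y \<le> K" and z: "z \<in> D" "norm z \<le> K"
      interpret P: bounded_linear P by fact
      have nP: "norm (P h) \<le> C_P * norm h" for h
        using onorm[OF P(1), of h] mult_right_mono[OF P(2) norm_ge_zero[of h]] by linarith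
      define d where "d = y - z"
      define b where "b = B t d + (N t y - N t z)"
      have diff: "feedback B N lam P t y - feedback B N lam P t z = P b - b - lam *\<^sub>R P (\<iota> d)"
        by (simp add: feedback_def b_def d_def P.add P.diff blinfun.diff_right algebra_simps)
      have nb: "norm b \<le> C_rc * norm d + norm (N t y - N t z)"
        using norm_triangle_ineq[of "B t d" "N t y - N t z"] norm_blinfun[of "B t" d] mult_right_mono[OF elim(1) norm_ge_zero[of d]]
        unfolding b_def by linarith
      have "norm (P b - b - lam *\<^sub>R P (\<iota> d)) \<le> norm (P b) + norm b + norm (lam *\<^sub>R P (\<iota> d))"
        using norm_triangle_ineq4[of "P b - b" "lam *\<^sub>R P (\<iota> d)"] norm_triangle_ineq4[of "P b" b] by linarith
      also have "norm (P b) + norm b \<le> c1 * norm b" using nP[of b] by (simp add: c1_def algebra_simps)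
      also have "\<dots> \<le> c1 * (C_rc * norm d + norm (N t y - N t z))" using nb c by (intro mult_left_mono) auto
      also have "norm (lam *\<^sub>R P (\<iota> d)) \<le> lam * (C_P * (norm \<iota> * norm d))"
      proof -
        have "C_P * norm (\<iota> d) \<le> C_P * (norm \<iota> * norm d)" using norm_blinfun[of \<iota> d] C_P by (intro mult_left_mono) auto
        then have "norm (P (\<iota> d)) \<le> C_P * (norm \<iota> * norm d)" using nP[of "\<iota> d"] by linarith
        then show ?thesis using lam by (simp add: mult_left_mono)
      qed
      also have "c1 * (C_rc * norm d + norm (N t y - N t z)) + lam * (C_P * (norm \<iota> * norm d))
         = c1 * norm (N t y - N t z) + c2 * norm d" by (simp add: c2_def algebra_simps)
      finally have "(norm (P b - b - lam *\<^sub>R P (\<iota> d)))\<^sup>2 \<le> (c1 * norm (N t y - N t z) + c2 * norm d)\<^sup>2"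
        by (simp add: power_mono)
      also have "\<dots> \<le> 2 * c1\<^sup>2 * (norm (N t y - N t z))\<^sup>2 + 2 * c2\<^sup>2 * (norm d)\<^sup>2"
        using sum_squares_bound[of "c1 * norm (N t y - N t z)" "c2 * norm d"] by (simp add: power2_sum power_mult_distrib)
      also have "2 * c1\<^sup>2 * (norm (N t y - N t z))\<^sup>2 \<le> 2 * c1\<^sup>2 * (\<epsilon> / (2 * c1\<^sup>2) * ((norm (L d))\<^sup>2
          + ((norm (L y))\<^sup>2 + (norm (L z))\<^sup>2) * (norm d)\<^sup>2) + C * (norm d)\<^sup>2)"
        unfolding d_def by (intro mult_left_mono lip_D[OF NC[rule_format, OF elim(2)]] y z) auto
      also have "\<dots> = \<epsilon> * ((norm (L d))\<^sup>2
          + ((norm (L y))\<^sup>2 + (norm (L z))\<^sup>2) * (norm d)\<^sup>2) + 2 * c1\<^sup>2 * C * (norm d)\<^sup>2"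
        unfolding distrib_left[of "2 * c1\<^sup>2"] using c by simp
      finally show "(norm (feedback B N lam P t y - feedback B N lam P t z))\<^sup>2 \<le> \<epsilon> * ((norm (L (y - z)))\<^sup>2
          + ((norm (L y))\<^sup>2 + (norm (L z))\<^sup>2) * (norm (y - z))\<^sup>2) + (2 * c1\<^sup>2 * C + 2 * c2\<^sup>2) * (norm (y - z))\<^sup>2"
        unfolding diff by (simp add: d_def algebra_simps)
    qed
  qed
  then show ?thesis using C by (intro exI[of _ "2 * c1\<^sup>2 * C + 2 * c2\<^sup>2"]) auto
qed

lemma N_zero:
  assumes "Cbi D (DA_norm \<iota> A) N" shows "N 0 = 0"
proof -
  obtain \<nn> where "\<nn> 0 = 0" "\<forall>x\<in>D. norm (N x) \<le> \<nn> (DA_norm \<iota> A x)" using assms by (auto simp: Cbi_def)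
  then have "norm (N 0) \<le> 0" using D_0 L_0 by (metis DA_norm_def norm_zero)
  then show ?thesis by simp
qed

end

text \<open>The equation determines the weak derivative up to a null set, so the existential
  \<open>w\<close> of \<open>strong_solution\<close> can be fixed as
  \<open>G t (y t) - L (y t)\<close>.\<close>

lemma (in semilinear) strong_solution_iff:
  assumes F: "\<And>t v. F t v = L v - G t v" and T: "0 < T"
  shows "strong_solution \<iota> A F y0 T y \<longleftrightarrow> y 0 = y0 \<and> sol 0 T y"
proof
  assume s: "strong_solution \<iota> A F y0 T y"
  then obtain w where y0: "y 0 = y0" and w: "L2_on T w"
    "\<forall>t\<in>{0..T}. \<iota> (y t) = \<iota> y0 + (LINT s|lebesgue_on {0..t}. w s)"
    and ae: "AE t in lebesgue_on {0..T}. w t + F t (y t) = 0"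
    unfolding strong_solution_def by blast
  have r: "maxreg 0 T y w" using s w y0 unfolding maxreg_def strong_solution_def L2_on_def sqint_def by auto
  have e: "AE t in lebesgue_on {0..T}. w t = G t (y t) - L (y t)"
    using ae by eventually_elim (simp add: F algebra_simps eq_neg_iff_add_eq_0)
  have "sol 0 T y" unfolding sol_def by (rule reg_cong[OF r _ _ e]) (use T in auto)
  with y0 show "y 0 = y0 \<and> sol 0 T y" by simp
next
  assume s: "y 0 = y0 \<and> sol 0 T y"
  then have "maxreg 0 T y (\<lambda>t. G t (y t) - L (y t))" by (simp add: sol_def)
  then show "strong_solution \<iota> A F y0 T y"
    using s unfolding maxreg_def strong_solution_def L2_on_def sqint_def
    by (intro conjI exI[of _ "\<lambda>t. G t (y t) - L (y t)"]) (auto simp: F)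
qed

theorem theorem1p3:
  fixes \<iota> :: "'v::{real_inner,banach,second_countable_topology} \<Rightarrow>\<^sub>L
                'h::{real_inner,banach,second_countable_topology}"
    and A :: "'v \<Rightarrow>\<^sub>L ('v \<Rightarrow>\<^sub>L real)"
    and \<alpha> :: "nat \<Rightarrow> real" and e :: "nat \<Rightarrow> 'v"
    and Arc :: "real \<Rightarrow> ('v \<Rightarrow>\<^sub>L 'h)" and C_rc :: real
    and N :: "real \<Rightarrow> 'v \<Rightarrow> 'h" and C_N :: real and n :: nat
    and \<zeta>1 \<zeta>2 \<delta>1 \<delta>2 :: "nat \<Rightarrow> real"
    and lam :: real and U :: "nat \<Rightarrow> 'h set" and C_P :: real
  assumes A_iso: "symmetric_isomorphism A"
    and V_inner: "\<forall>y z. y \<bullet> z = blinfun_apply (blinfun_apply A y) z"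
    and incl: "compact_dense_inclusion \<iota>"
    and eig: "eigenbasis \<iota> A \<alpha> e"
    and Arc_bd: "C_rc \<ge> 0" "ess_bounded_operator Arc C_rc"
    and N_Cbi: "\<forall>t>0. Cbi (DA \<iota> A) (DA_norm \<iota> A) (N t)"
    and N_meas: "\<forall>u\<in>DA \<iota> A. (\<lambda>t. N t u) \<in> borel_measurable (lebesgue_on {0<..})"
    and N_const: "C_N \<ge> 0" "n \<ge> 1"
    and N_exps: "\<forall>j\<in>{1..n}. \<zeta>1 j \<ge> 0 \<and> \<zeta>2 j \<ge> 0 \<and> \<delta>1 j \<ge> 0 \<and> \<delta>2 j \<ge> 0 \<and>
                   \<zeta>2 j + \<delta>2 j < 1 \<and> \<delta>1 j + \<delta>2 j \<ge> 1"
    and N_bd: "\<forall>t>0. \<forall>y1\<in>DA \<iota> A. \<forall>y2\<in>DA \<iota> A.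
        norm (N t y1 - N t y2) \<le> C_N * (\<Sum>j=1..n.
          (rpow (norm y1) (\<zeta>1 j) * rpow (DA_norm \<iota> A y1) (\<zeta>2 j)
           + rpow (norm y2) (\<zeta>1 j) * rpow (DA_norm \<iota> A y2) (\<zeta>2 j))
          * rpow (norm (y1 - y2)) (\<delta>1 j) * rpow (DA_norm \<iota> A (y1 - y2)) (\<delta>2 j))"
    and lam_pos: "lam > 0"
    and U_dim: "\<forall>M\<ge>1. subspace (U M) \<and> dim (U M) = M"
    and U_sum: "\<forall>M\<ge>1. direct_sum (U M) ((EM \<iota> e M)\<^sup>\<bottom>)"
    and C_P_pos: "C_P > 0"
    and P_bd: "\<forall>M\<ge>1. bounded_linear (oblique_proj (U M) ((EM \<iota> e M)\<^sup>\<bottom>)) \<and>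
                 onorm (oblique_proj (U M) ((EM \<iota> e M)\<^sup>\<bottom>)) \<le> C_P"
  shows "\<forall>R>0. \<exists>M_R\<ge>1. \<forall>M\<ge>M_R. \<exists>C\<ge>1. \<exists>\<mu>>0. \<forall>y0::'v. norm y0 < R \<longrightarrow>
    (let F = closed_loop \<iota> A Arc N lam (oblique_proj (U M) ((EM \<iota> e M)\<^sup>\<bottom>)) in
     \<exists>y. (\<forall>T>0. strong_solution \<iota> A F y0 T y) \<and>
         (\<forall>T>0. \<forall>z. strong_solution \<iota> A F y0 T z \<longrightarrow> (\<forall>t\<in>{0..T}. z t = y t)) \<and>
         (\<forall>t\<ge>0. (norm (y t))\<^sup>2 \<le> C * exp (- \<mu> * t) * (norm y0)\<^sup>2))"
proof (intro allI impI)
  fix R :: real assume R: "R > 0"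
  interpret spectral \<iota> A \<alpha> e by unfold_locales fact+
  define P where "P M = oblique_proj (U M) ((EM \<iota> e M)\<^sup>\<bottom>)" for M
  have P: "bounded_linear (P M)" "onorm (P M) \<le> C_P" if "1 \<le> M" for M using P_bd that by (auto simp: P_def)
  \<comment> \<open>h - P h is orthogonal to the first \<open>M\<close> eigenfunctions, so the
    oblique projection keeps the first \<open>M\<close> coordinates of h exactly.\<close>
  have P_inner: "P M h \<bullet> \<iota> (e i) = h \<bullet> \<iota> (e i)" if "1 \<le> M" "i \<in> {1..M}" for M h i
  proof -
    have "direct_sum (U M) ((EM \<iota> e M)\<^sup>\<bottom>)" using U_sum that by blast
    then have "h - P M h \<in> (EM \<iota> e M)\<^sup>\<bottom>" unfolding P_def by (rule oblique_proj_props)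
    moreover have "\<iota> (e i) \<in> EM \<iota> e M" unfolding EM_def using that by (intro span_base) auto
    ultimately have "(h - P M h) \<bullet> \<iota> (e i) = 0" by (auto simp: orthogonal_comp_def orthogonal_def inner_commute)
    then show ?thesis by (simp add: inner_diff_left)
  qed
  have Arc: "\<forall>v. (\<lambda>t. blinfun_apply (Arc t) v) \<in> borel_measurable (lebesgue_on {0<..})"
    "AE t in lebesgue_on {0<..}. norm (Arc t) \<le> C_rc"
    using Arc_bd(2) by (auto simp: ess_bounded_operator_def)
  have fb: "\<exists>C\<ge>0. AE t in lebesgue_on {0<..}. \<forall>P. bounded_linear P \<longrightarrow> onorm P \<le> C_P \<longrightarrow>
     lip \<epsilon> K C (feedback Arc N lam P t)" if "0 < \<epsilon>" "0 < K" for \<epsilon> K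
    by (rule feedback_bound[OF Arc_bd(1) Arc(2) C_P_pos lam_pos nonlinearity_bound[OF N_const N_exps N_bd] that])
  \<comment> \<open>Order of the choices: \<open>CR\<close> from \<open>R\<close>, then \<kappa>,
    then \<open>K\<close>, then \<open>CK\<close>, and \<open>M0\<close> last. Taking
    \<open>CR\<close> and \<open>CK\<close> before \<open>M\<close> is possible because
    \<open>fb\<close> is uniform over the projections.\<close>
  have pR: "0 < 1 / (1 + R\<^sup>2)" by (simp add: add_pos_nonneg)
  from fb[OF pR R] obtain CR where CR: "0 \<le> CR" and fR: "AE t in lebesgue_on {0<..}. \<forall>P. bounded_linear P \<longrightarrow> onorm P \<le> C_P \<longrightarrow>
     lip (1 / (1 + R\<^sup>2)) R CR (feedback Arc N lam P t)" by (elim exE conjE)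
  define \<kappa> where "\<kappa> = 3 + 2 * CR / \<alpha> 1"
  have \<alpha>1: "0 < \<alpha> 1" by (rule alpha_pos) simp
  have \<kappa>3: "3 \<le> \<kappa>" using CR \<alpha>1 by (simp add: \<kappa>_def)
  define K where "K = sqrt \<kappa> * R"
  have K: "0 < K" "K\<^sup>2 = \<kappa> * R\<^sup>2" using \<kappa>3 R by (auto simp: K_def power_mult_distrib)
  have pK: "0 < 1 / (4 * (1 + K\<^sup>2))" by (simp add: add_pos_nonneg)
  from fb[OF pK K(1)] obtain CK where CK: "0 \<le> CK" and fK: "AE t in lebesgue_on {0<..}. \<forall>P. bounded_linear P \<longrightarrow> onorm P \<le> C_P \<longrightarrow>
     lip (1 / (4 * (1 + K\<^sup>2))) K CK (feedback Arc N lam P t)" by (elim exE conjE)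
  have "filterlim \<alpha> at_top sequentially" using eig by (simp add: eigenbasis_def)
  then have "\<forall>\<^sub>F m in sequentially. 8 * CK \<le> \<alpha> m" by (simp add: filterlim_at_top)
  then obtain M0 where M0: "\<forall>m\<ge>M0. 8 * CK \<le> \<alpha> m" unfolding eventually_sequentially by (elim exE)
  show "\<exists>M_R\<ge>1. \<forall>M\<ge>M_R. \<exists>C\<ge>1. \<exists>\<mu>>0. \<forall>y0::'v. norm y0 < R \<longrightarrow>
    (let F = closed_loop \<iota> A Arc N lam (oblique_proj (U M) ((EM \<iota> e M)\<^sup>\<bottom>)) in
     \<exists>y. (\<forall>T>0. strong_solution \<iota> A F y0 T y) \<and>
         (\<forall>T>0. \<forall>z. strong_solution \<iota> A F y0 T z \<longrightarrow> (\<forall>t\<in>{0..T}. z t = y t)) \<and>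
         (\<forall>t\<ge>0. (norm (y t))\<^sup>2 \<le> C * exp (- \<mu> * t) * (norm y0)\<^sup>2))"
    unfolding P_def[symmetric] Let_def
  proof (rule exI[of _ "max 1 M0"], intro conjI allI impI)
    show "1 \<le> max 1 M0" by simp
    fix M assume "max 1 M0 \<le> M"
    then have M: "1 \<le> M" "M0 \<le> Suc M" by auto
    have Z: "AE t in lebesgue_on {0<..}. feedback Arc N lam (P M) t 0 = 0"
    proof -
      interpret PM: bounded_linear "P M" by (rule P(1)[OF M(1)])
      have "AE t in lebesgue_on {0<..}. (0::real) < t" by (rule AE_I2) simp
      then show ?thesis
      proof eventually_elim
        case (elim t)
        then have "N t 0 = 0" using N_Cbi by (intro N_zero) auto
        then show ?case by (simp add: feedback_def PM.zero)
      qed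
    qed
    interpret S: semilinear \<iota> A \<alpha> e "feedback Arc N lam (P M)"
    proof unfold_locales
      show "(\<lambda>t. feedback Arc N lam (P M) t (u t)) \<in> borel_measurable (lebesgue_on {a..b})"
        if "0 \<le> a" "AE t in lebesgue_on {a..b}. u t \<in> DA \<iota> A" "(\<lambda>t. AH \<iota> A (u t)) \<in> borel_measurable (lebesgue_on {a..b})" for a b u
        by (rule feedback_meas[OF Arc(1) N_Cbi N_meas P(1)[OF M(1)] that])
      show "\<exists>C\<ge>0. AE t in lebesgue_on {0<..}. lip \<epsilon> K C (feedback Arc N lam (P M) t)"
        if \<epsilon>K: "0 < \<epsilon>" "0 < K" for \<epsilon> K
      proof -
        from fb[OF \<epsilon>K] obtain C where C: "0 \<le> C" and ae: "AE t in lebesgue_on {0<..}. \<forall>P. bounded_linear P \<longrightarrow> onorm P \<le> C_P \<longrightarrow>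
          lip \<epsilon> K C (feedback Arc N lam P t)" by (elim exE conjE)
        from ae have "AE t in lebesgue_on {0<..}. lip \<epsilon> K C (feedback Arc N lam (P M) t)"
          by eventually_elim (simp add: P[OF M(1)])
        with C show ?thesis by (intro exI[of _ C] conjI)
      qed
      show "AE t in lebesgue_on {0<..}. feedback Arc N lam (P M) t 0 = 0" by (rule Z)
    qed
    \<comment> \<open>Tested against the first \<open>M\<close> eigenfunctions the projection acts
      as the identity, so the contributions of \<open>Arc\<close> and \<open>N\<close> cancel and
      only -lam times the coordinate survives.\<close>
    have low: "feedback Arc N lam (P M) t v \<bullet> \<iota> (e i) = - lam * coord v i" if "i \<in> {1..M}" for t v i
      using P_inner[OF M(1) that] by (simp add: feedback_def coord_def inner_diff_left)
    have "AE t in lebesgue_on {0<..}. lip (1 / (1 + R\<^sup>2)) R CR (feedback Arc N lam (P M) t)"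
      using fR by eventually_elim (simp add: P[OF M(1)])
    then have GbR: "AE t in lebesgue_on {a..b}. lip (1 / (1 + R\<^sup>2)) R CR (feedback Arc N lam (P M) t)" if "0 \<le> a" for a b
      using that by (rule AE_lebesgue_on_pos)
    have "AE t in lebesgue_on {0<..}. lip (1 / (4 * (1 + K\<^sup>2))) K CK (feedback Arc N lam (P M) t)"
      using fK by eventually_elim (simp add: P[OF M(1)])
    then have GbK: "AE t in lebesgue_on {a..b}. lip (1 / (4 * (1 + K\<^sup>2))) K CK (feedback Arc N lam (P M) t)" if "0 \<le> a" for a b
      using that by (rule AE_lebesgue_on_pos)
    have large: "8 * CK \<le> \<alpha> (Suc M)" using M0 M by blast
    have lam0: "0 \<le> lam" using lam_pos by simp
    have stab: "\<exists>y. y 0 = y0 \<and> (\<forall>T>0. S.sol 0 T y) \<and> (\<forall>t\<ge>0. (norm (y t))\<^sup>2 \<le> \<kappa> * exp (- (\<alpha> 1 / 4) * t) * (norm y0)\<^sup>2)"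
      if "norm y0 < R" for y0
      by (rule S.exponential_stability[OF low lam0 R K(1) CR CK GbR GbK \<kappa>_def K(2) large that])
    have sol_iff: "strong_solution \<iota> A (closed_loop \<iota> A Arc N lam (P M)) y0 T y \<longleftrightarrow> y 0 = y0 \<and> S.sol 0 T y"
      if "0 < T" for y0 T y
      by (rule S.strong_solution_iff[OF closed_loop_eq[OF P(1)[OF M(1)]] that])
    have "\<forall>y0. norm y0 < R \<longrightarrow>
      (\<exists>y. (\<forall>T>0. strong_solution \<iota> A (closed_loop \<iota> A Arc N lam (P M)) y0 T y) \<and>
         (\<forall>T>0. \<forall>z. strong_solution \<iota> A (closed_loop \<iota> A Arc N lam (P M)) y0 T z \<longrightarrow> (\<forall>t\<in>{0..T}. z t = y t)) \<and>
         (\<forall>t\<ge>0. (norm (y t))\<^sup>2 \<le> \<kappa> * exp (- (\<alpha> 1 / 4) * t) * (norm y0)\<^sup>2))"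
    proof (intro allI impI)
      fix y0 :: 'v assume "norm y0 < R"
      from stab[OF this] obtain y where y: "y 0 = y0" "\<forall>T>0. S.sol 0 T y"
        and decay: "\<forall>t\<ge>0. (norm (y t))\<^sup>2 \<le> \<kappa> * exp (- (\<alpha> 1 / 4) * t) * (norm y0)\<^sup>2" by (elim exE conjE)
      show "\<exists>y. (\<forall>T>0. strong_solution \<iota> A (closed_loop \<iota> A Arc N lam (P M)) y0 T y) \<and>
         (\<forall>T>0. \<forall>z. strong_solution \<iota> A (closed_loop \<iota> A Arc N lam (P M)) y0 T z \<longrightarrow> (\<forall>t\<in>{0..T}. z t = y t)) \<and>
         (\<forall>t\<ge>0. (norm (y t))\<^sup>2 \<le> \<kappa> * exp (- (\<alpha> 1 / 4) * t) * (norm y0)\<^sup>2)"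
      proof (intro exI[of _ y] conjI decay allI impI ballI)
        fix T :: real assume T: "0 < T"
        show "strong_solution \<iota> A (closed_loop \<iota> A Arc N lam (P M)) y0 T y"
          using y T by (simp add: sol_iff)
        fix z t assume "strong_solution \<iota> A (closed_loop \<iota> A Arc N lam (P M)) y0 T z" and t: "t \<in> {0..T}"
        then have "z 0 = y0" "S.sol 0 T z" by (simp_all add: sol_iff[OF T])
        then show "z t = y t" using y T t by (intro S.sol_unique[of 0 T z y t]) auto
      qed
    qed
    moreover have "1 \<le> \<kappa>" "0 < \<alpha> 1 / 4" using \<kappa>3 \<alpha>1 by auto
    ultimately show "\<exists>C\<ge>1. \<exists>\<mu>>0. \<forall>y0. norm y0 < R \<longrightarrow>
      (\<exists>y. (\<forall>T>0. strong_solution \<iota> A (closed_loop \<iota> A Arc N lam (P M)) y0 T y) \<and>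
         (\<forall>T>0. \<forall>z. strong_solution \<iota> A (closed_loop \<iota> A Arc N lam (P M)) y0 T z \<longrightarrow> (\<forall>t\<in>{0..T}. z t = y t)) \<and>
         (\<forall>t\<ge>0. (norm (y t))\<^sup>2 \<le> C * exp (- \<mu> * t) * (norm y0)\<^sup>2))"
      by (intro exI[where P="\<lambda>C. 1 \<le> C \<and> _ C" and x=\<kappa>] conjI exI[where P="\<lambda>\<mu>. 0 < \<mu> \<and> _ \<mu>" and x="\<alpha> 1 / 4"])
  qed
qed

end
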